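(* Let $\pi:\widetilde{\Gamma}\to\Gamma$ be a (free or dilated) double cover of metric graphs, with $\Gamma$ and $\widetilde{\Gamma}$ connected. Let $m_d(\widetilde{\Gamma}/\Gamma)$, $n_d(\widetilde{\Gamma}/\Gamma)$ and $d(\widetilde{\Gamma}/\Gamma)$ denote respectively the number of edges, vertices, and connected components of the dilation subgraph $\Gamma_{\mathrm{dil}}$. Then \[ J(\widetilde{\Gamma})=2^{1-m_d(\widetilde{\Gamma}/\Gamma)+n_d(\widetilde{\Gamma}/\Gamma)-2d(\widetilde{\Gamma}/\Gamma)}\,\mathrm{Pr}(\widetilde{\Gamma}/\Gamma)\,J(\Gamma), \] where $J$ denotes the Jacobian polynomial and $\mathrm{Pr}(\widetilde{\Gamma}/\Gamma)$ the Prym polynomial, and $J(\widetilde{\Gamma})$ is viewed as a polynomial in the edge lengths of $\Gamma$.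
   Context: **Graphs.** A graph $G$ has a finite non-empty vertex set $V(G)$, a finite set $H(G)$ of half-edges with a root map $r:H(G)\to V(G)$ and a fixed-point-free involution on $H(G)$ whose orbits $e=\{h,h'\}$ are the edges; $E(G)$ is the set of edges. Loops and multiple edges are allowed. The genus of a connected graph is $g(G)=b_1(G)=\#E(G)-\#V(G)+1$ (there are no vertex weights). A metric graph $\Gamma$ is a graph together with a positive length $\ell(e)$ for each edge $e$; a choice of underlying graph (model) is always fixed, and we write $V(\Gamma),E(\Gamma)$, etc. **Double covers.** A double cover $\pi:\widetilde{\Gamma}\to\Gamma$ consists of maps $V(\widetilde{\Gamma})\to V(\Gamma)$ and $H(\widetilde{\Gamma})\to H(\Gamma)$ commuting with the root maps and the edge involutions, and a degree function $d_\pi:V(\widetilde{\Gamma})\cup E(\widetilde{\Gamma})\to\mathbb{Z}_{>0}$ (the degree of a half-edge is that of its edge) such that: (i) for every $\widetilde{v}\in V(\widetilde{\Gamma})$ and every half-edge $h$ rooted at $\pi(\widetilde{v})$, $d_\pi(\widetilde{v})$ is the sum of $d_\pi(\widetilde{h})$ over the half-edges $\widetilde{h}$ rooted at $\widetilde{v}$ with $\pi(\widetilde{h})=h$; (ii) the degrees of the preimages of each vertex and each half-edge of $\Gamma$ sum to $2$; (iii) $\ell(\pi(\widetilde{e}))=d_\pi(\widetilde{e})\,\ell(\widetilde{e})$ for all $\widetilde{e}\in E(\widetilde{\Gamma})$. A vertex or edge of $\Gamma$ is dilated if it has a single preimage (of degree $2$), and undilated if it has two preimages (each of degree $1$). The dilated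 vertices and edges form the dilation subgraph $\Gamma_{\mathrm{dil}}\subset\Gamma$. The cover is free if $\Gamma_{\mathrm{dil}}=\emptyset$ and dilated otherwise. By (iii), $\ell(\widetilde{e})=\ell(\pi(\widetilde{e}))$ if $\pi(\widetilde{e})$ is undilated and $\ell(\widetilde{e})=\ell(\pi(\widetilde{e}))/2$ if $\pi(\widetilde{e})$ is dilated; in this way $J(\widetilde{\Gamma})$ below becomes a polynomial in the edge lengths of $\Gamma$. **Jacobian polynomial.** For a connected metric graph $\Gamma$ of genus $g$, \[ J(\Gamma)=\sum_{C\subset E(\Gamma)}\prod_{e\in C}\ell(e), \] summed over all $g$-element subsets $C\subset E(\Gamma)$ such that $\Gamma\backslash C$ is a tree (the interiors of the edges in $C$ are removed, all vertices are kept). **Ogods and the Prym polynomial.** Let $h=g(\widetilde{\Gamma})-g(\Gamma)$. A set $F\subset E(\Gamma)$ of exactly $h$ edges is an ogod if no edge in $F$ is dilated and each connected component of $\Gamma\backslash F$ has connected preimage in $\widetilde{\Gamma}$. Its rank $r(F)$ is the number of connected components of $\Gamma\backslash F$. The Prym polynomial is \[ \mathrm{Pr}(\widetilde{\Gamma}/\Gamma)=\sum_{F}4^{r(F)-1}\prod_{e\in F}\ell(e), \] summed over all ogods $F\subset E(\Gamma)$. *)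

theory Defs
  imports Complex_Main
begin

section \<open>Graphs with half-edges\<close>

record ('v, 'h) hgraph =
  verts :: "'v set"
  hedges :: "'h set"
  root :: "'h \<Rightarrow> 'v"
  opp :: "'h \<Rightarrow> 'h"

locale half_edge_graph =
  fixes G :: "('v, 'h, 'z) hgraph_scheme"
  assumes finite_verts: "finite (verts G)"
    and verts_nonempty: "verts G \<noteq> {}"
    and finite_hedges: "finite (hedges G)"
    and root_in: "h \<in> hedges G \<Longrightarrow> root G h \<in> verts G"
    and opp_in: "h \<in> hedges G \<Longrightarrow> opp G h \<in> hedges G"
    and opp_opp: "h \<in> hedges G \<Longrightarrow> opp G (opp G h) = h"
    and opp_neq: "h \<in> hedges G \<Longrightarrow> opp G h \<noteq> h"

definition edge_of :: "('v, 'h, 'z) hgraph_scheme \<Rightarrow> 'h \<Rightarrow> 'h set" where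
  "edge_of G h = {h, opp G h}"

definition edges :: "('v, 'h, 'z) hgraph_scheme \<Rightarrow> 'h set set" where
  "edges G = edge_of G ` hedges G"

definition del_edges ::
    "('v, 'h, 'z) hgraph_scheme \<Rightarrow> 'h set set \<Rightarrow> ('v, 'h, 'z) hgraph_scheme" where
  "del_edges G C = G\<lparr>hedges := hedges G - \<Union>C\<rparr>"

text \<open>
  The notions below are also applied to subgraphs, such as the dilation subgraph, whose
  vertex set may be empty; the empty graph has no components and is not connected.
  Since the half-edges are closed under the involution, the relation \<open>adj\<close> is symmetric.
\<close>

definition adj :: "('v, 'h, 'z) hgraph_scheme \<Rightarrow> 'v rel" where
  "adj G = {(root G h, root G (opp G h)) | h. h \<in> hedges G}"

definition conn_rel :: "('v, 'h, 'z) hgraph_scheme \<Rightarrow> 'v rel" where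
  "conn_rel G = {(u, v). u \<in> verts G \<and> v \<in> verts G \<and> (u, v) \<in> (adj G)\<^sup>*}"

definition connected_graph :: "('v, 'h, 'z) hgraph_scheme \<Rightarrow> bool" where
  "connected_graph G \<longleftrightarrow> verts G \<noteq> {} \<and> (\<forall>u\<in>verts G. \<forall>v\<in>verts G. (u, v) \<in> conn_rel G)"

definition subgraph_on ::
    "('v, 'h, 'z) hgraph_scheme \<Rightarrow> 'v set \<Rightarrow> ('v, 'h, 'z) hgraph_scheme" where
  "subgraph_on G A = G\<lparr>verts := A, hedges := {h \<in> hedges G. root G h \<in> A}\<rparr>"

definition components :: "('v, 'h, 'z) hgraph_scheme \<Rightarrow> ('v, 'h, 'z) hgraph_scheme set" where
  "components G = subgraph_on G ` (verts G // conn_rel G)"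

text \<open>
  Cycles are given by their oriented edges. Loops are cycles of length one, and two distinct
  parallel edges form a cycle of length two; distinctness of the edges excludes the walk
  that traverses one edge back and forth.
\<close>

definition is_cycle :: "('v, 'h, 'z) hgraph_scheme \<Rightarrow> 'h list \<Rightarrow> bool" where
  "is_cycle G hs \<longleftrightarrow> hs \<noteq> [] \<and> set hs \<subseteq> hedges G \<and>
     (\<forall>i < length hs. root G (opp G (hs ! i)) = root G (hs ! ((i + 1) mod length hs))) \<and>
     distinct (map (root G) hs) \<and> distinct (map (edge_of G) hs)"

definition is_tree :: "('v, 'h, 'z) hgraph_scheme \<Rightarrow> bool" where
  "is_tree G \<longleftrightarrow> connected_graph G \<and> (\<nexists>hs. is_cycle G hs)"

definition genus :: "('v, 'h, 'z) hgraph_scheme \<Rightarrow> int" where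
  "genus G = int (card (edges G)) - int (card (verts G)) + 1"


section \<open>Metric graphs and the Jacobian polynomial\<close>

record ('v, 'h) mgraph = "('v, 'h) hgraph" +
  len :: "'h set \<Rightarrow> real"

locale metric_graph = half_edge_graph G for G :: "('v, 'h) mgraph" +
  assumes len_pos: "e \<in> edges G \<Longrightarrow> len G e > 0"

definition jacobian_poly :: "('v, 'h) mgraph \<Rightarrow> real" where
  "jacobian_poly G =
     (\<Sum>C | C \<subseteq> edges G \<and> int (card C) = genus G \<and> is_tree (del_edges G C).
        \<Prod>e\<in>C. len G e)"


section \<open>Double covers\<close>

text \<open>
  By \<open>len_emap\<close>, the edge lengths of the source are determined by those of the target, which
  are arbitrary positive reals; \<open>jacobian_poly (src p)\<close> is thus the value of a polynomial
  in the edge lengths of the target.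
\<close>

record ('w, 'k, 'v, 'h) cover =
  src :: "('w, 'k) mgraph"
  tgt :: "('v, 'h) mgraph"
  vmap :: "'w \<Rightarrow> 'v"
  hmap :: "'k \<Rightarrow> 'h"
  vdeg :: "'w \<Rightarrow> nat"
  edeg :: "'k set \<Rightarrow> nat"

definition hdeg :: "('w, 'k, 'v, 'h) cover \<Rightarrow> 'k \<Rightarrow> nat" where
  "hdeg p h = edeg p (edge_of (src p) h)"

definition emap :: "('w, 'k, 'v, 'h) cover \<Rightarrow> 'k set \<Rightarrow> 'h set" where
  "emap p e = hmap p ` e"

locale double_cover =
  fixes p :: "('w, 'k, 'v, 'h) cover"
  assumes src_metric: "metric_graph (src p)"
    and tgt_metric: "metric_graph (tgt p)"
    and vmap_in: "w \<in> verts (src p) \<Longrightarrow> vmap p w \<in> verts (tgt p)"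
    and hmap_in: "k \<in> hedges (src p) \<Longrightarrow> hmap p k \<in> hedges (tgt p)"
    and root_hmap: "k \<in> hedges (src p) \<Longrightarrow> root (tgt p) (hmap p k) = vmap p (root (src p) k)"
    and opp_hmap: "k \<in> hedges (src p) \<Longrightarrow> opp (tgt p) (hmap p k) = hmap p (opp (src p) k)"
    and vdeg_pos: "w \<in> verts (src p) \<Longrightarrow> vdeg p w > 0"
    and edeg_pos: "e \<in> edges (src p) \<Longrightarrow> edeg p e > 0"
    and local_degree:
      "\<lbrakk>w \<in> verts (src p); h \<in> hedges (tgt p); root (tgt p) h = vmap p w\<rbrakk> \<Longrightarrow>
         vdeg p w = (\<Sum>k | k \<in> hedges (src p) \<and> root (src p) k = w \<and> hmap p k = h. hdeg p k)"
    and vertex_degree: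
      "v \<in> verts (tgt p) \<Longrightarrow> (\<Sum>w | w \<in> verts (src p) \<and> vmap p w = v. vdeg p w) = 2"
    and hedge_degree:
      "h \<in> hedges (tgt p) \<Longrightarrow> (\<Sum>k | k \<in> hedges (src p) \<and> hmap p k = h. hdeg p k) = 2"
    and len_emap:
      "e \<in> edges (src p) \<Longrightarrow> len (tgt p) (emap p e) = real (edeg p e) * len (src p) e"

definition dilated_verts :: "('w, 'k, 'v, 'h) cover \<Rightarrow> 'v set" where
  "dilated_verts p =
     {v \<in> verts (tgt p). card {w \<in> verts (src p). vmap p w = v} = 1}"

definition dilated_edges :: "('w, 'k, 'v, 'h) cover \<Rightarrow> 'h set set" where
  "dilated_edges p =
     {e \<in> edges (tgt p). card {e' \<in> edges (src p). emap p e' = e} = 1}"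

definition dilation_subgraph :: "('w, 'k, 'v, 'h) cover \<Rightarrow> ('v, 'h) mgraph" where
  "dilation_subgraph p = (tgt p)\<lparr>verts := dilated_verts p, hedges := \<Union>(dilated_edges p)\<rparr>"

definition num_dilated_edges :: "('w, 'k, 'v, 'h) cover \<Rightarrow> nat" where
  "num_dilated_edges p = card (edges (dilation_subgraph p))"

definition num_dilated_verts :: "('w, 'k, 'v, 'h) cover \<Rightarrow> nat" where
  "num_dilated_verts p = card (verts (dilation_subgraph p))"

definition num_dilated_components :: "('w, 'k, 'v, 'h) cover \<Rightarrow> nat" where
  "num_dilated_components p = card (components (dilation_subgraph p))"


section \<open>Ogods and the Prym polynomial\<close>

definition preimage_subgraph ::
    "('w, 'k, 'v, 'h) cover \<Rightarrow> ('v, 'h) mgraph \<Rightarrow> ('w, 'k) mgraph" where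
  "preimage_subgraph p K = (src p)
     \<lparr>verts := {w \<in> verts (src p). vmap p w \<in> verts K},
      hedges := {k \<in> hedges (src p). hmap p k \<in> hedges K}\<rparr>"

definition is_ogod :: "('w, 'k, 'v, 'h) cover \<Rightarrow> 'h set set \<Rightarrow> bool" where
  "is_ogod p F \<longleftrightarrow>
     F \<subseteq> edges (tgt p) \<and>
     int (card F) = genus (src p) - genus (tgt p) \<and>
     F \<inter> dilated_edges p = {} \<and>
     (\<forall>K \<in> components (del_edges (tgt p) F). connected_graph (preimage_subgraph p K))"

definition ogod_rank :: "('w, 'k, 'v, 'h) cover \<Rightarrow> 'h set set \<Rightarrow> nat" where
  "ogod_rank p F = card (components (del_edges (tgt p) F))"

text \<open>
  The rank is at least one because the vertex set of the base is non-empty, so the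
  natural-number subtraction in the exponent does not truncate.
\<close>

definition prym_poly :: "('w, 'k, 'v, 'h) cover \<Rightarrow> real" where
  "prym_poly p = (\<Sum>F | is_ogod p F. 4 ^ (ogod_rank p F - 1) * (\<Prod>e\<in>F. len (tgt p) e))"

end

theory Submission
  imports Defs "Jordan_Normal_Form.Determinant"
begin

text \<open>
  Give every edge the conductance \<open>1 / len\<close>. By the matrix-tree theorem, the Jacobian
  polynomial is the product of all lengths times a reduced determinant of the weighted Laplacian.
  Functions on the vertices of the cover split into those pulled back from the base and those that
  are antisymmetric on the fibres, the latter living on the undilated vertices. This splitting
  block-diagonalises the Laplacian of the cover into twice the Laplacian of the base and twice a
  signed Laplacian on the undilated vertices. Expanding the determinant of the signed Laplacian by
  the Cauchy--Binet formula gives a sum over the complements of the ogods: a minor is nonzero iff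
  the only antisymmetric function that is constant along the remaining edges is zero, i.e. iff the
  components have connected preimages. Rows of the signed incidence matrix have
  \<open>\<ell>\<^sub>1\<close>-norm at most two, so the absolute value of a nonzero minor counts
  its solutions modulo 2. These are the unions of components avoiding the dilated vertices, and
  there are \<open>2 ^ (r - d)\<close> of them.
\<close>

section \<open>Determinants of Gram matrices\<close>

text \<open>The Laplacian kills constants, so it has to be grounded, and deleting a row and a column
  of the cover's matrix would destroy the splitting. Instead a rank-one term is added, built from
  the functional that sums a function over the fibre of one base vertex. This functional vanishes on
  antisymmetric functions, and on pullbacks it is evaluation at that vertex times the size of the
  fibre. The block form therefore survives, and the grounding is felt in the base block alone. Its
  coefficients sum to 1 or 2, so as one more row of the incidence matrix it still obeys the norm
  bound, and a single lemma on minors serves both the tree sums and the ogod sum.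

  The power of two in the theorem collects the Gram determinant of the adapted basis, the doubled
  conductances in both blocks, the halved lengths of the dilated edges, and the comparison of the
  squared number of solutions modulo 2 with \<open>4 ^ (r - 1)\<close>.\<close>

definition fdet :: "nat \<Rightarrow> (nat \<Rightarrow> nat \<Rightarrow> 'a::comm_ring_1) \<Rightarrow> 'a" where
  "fdet n a = det (mat n n (\<lambda>(i, j). a i j))"

lemma fdet_sum:
  "fdet n a = (\<Sum>p | p permutes {0..<n}. signof p * (\<Prod>i = 0..<n. a i (p i)))"
proof -
  have "mat n n (\<lambda>(i, j). a i j) $$ (i, p i) = a i (p i)" if "p permutes {0..<n}" "i \<in> {0..<n}" for p i
    using that permutes_in_image[OF that(1), of i] by simp
  then show ?thesis
    unfolding fdet_def det_def'[of "mat n n (\<lambda>(i, j). a i j)" n, OF mat_carrier]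
    by (intro sum.cong refl arg_cong2[of _ _ _ _ "(*)"] prod.cong) auto
qed

lemma fdet_cong:
  "(\<And>i j. i < n \<Longrightarrow> j < n \<Longrightarrow> a i j = b i j) \<Longrightarrow> fdet n a = fdet n b"
  unfolding fdet_def by (rule arg_cong[of _ _ det]) auto

lemma fdet_0 [simp]: "fdet 0 a = 1"
  by (simp add: fdet_def)

lemma fdet_transpose: "fdet n (\<lambda>i j. a j i) = fdet n a"
proof -
  have "mat n n (\<lambda>(i, j). a j i) = transpose_mat (mat n n (\<lambda>(i, j). a i j))"
    by auto
  then show ?thesis
    unfolding fdet_def by (simp add: det_transpose[of _ n])
qed

lemma fdet_permute_rows:
  assumes "p permutes {..<n}"
  shows "fdet n (\<lambda>i j. a (p i) j) = signof p * fdet n a"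
proof -
  have p: "p permutes {0..<n}"
    using assms by (simp add: lessThan_atLeast0)
  have "mat n n (\<lambda>(i, j). a (p i) j) = mat n n (\<lambda>(i, j). mat n n (\<lambda>(i, j). a i j) $$ (p i, j))"
    using permutes_in_image[OF p] by (intro eq_matI) simp_all
  then show ?thesis
    unfolding fdet_def using det_permute_rows[OF _ p, of "mat n n (\<lambda>(i, j). a i j)"] by simp
qed

lemma fdet_permute_columns:
  assumes "p permutes {..<n}"
  shows "fdet n (\<lambda>i j. a i (p j)) = signof p * fdet n a"
  using fdet_permute_rows[OF assms, of "\<lambda>i j. a j i"]
    fdet_transpose[of n a] fdet_transpose[of n "\<lambda>i j. a i (p j)"] by simp

lemma fdet_mult:
  "fdet n (\<lambda>i j. \<Sum>k<n. a i k * b k j) = fdet n a * fdet n b"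
proof -
  have "mat n n (\<lambda>(i, j). \<Sum>k<n. a i k * b k j) = mat n n (\<lambda>(i, j). a i j) * mat n n (\<lambda>(i, j). b i j)"
    by (rule eq_matI) (simp_all add: scalar_prod_def lessThan_atLeast0)
  then show ?thesis
    unfolding fdet_def by (simp add: det_mult[of _ n])
qed

lemma fdet_scale: "fdet n (\<lambda>i j. c * a i j) = c ^ n * fdet n a"
proof -
  have "mat n n (\<lambda>(i, j). c * a i j) = c \<cdot>\<^sub>m mat n n (\<lambda>(i, j). a i j)"
    by auto
  then show ?thesis
    unfolding fdet_def by simp
qed

lemma fdet_block:
  fixes a :: "nat \<Rightarrow> nat \<Rightarrow> 'a::idom"
  assumes "\<And>i j. i < n \<Longrightarrow> j < m \<Longrightarrow> a (n + j) i = 0"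
  shows "fdet (n + m) a = fdet n a * fdet m (\<lambda>i j. a (n + i) (n + j))"
proof -
  have "a i j = 0" if "\<not> i < n" "j < n" "i < n + m" for i j
    using assms[of j "i - n"] that by auto
  then have "mat (n + m) (n + m) (\<lambda>(i, j). a i j) =
      four_block_mat (mat n n (\<lambda>(i, j). a i j)) (mat n m (\<lambda>(i, j). a i (n + j)))
        (0\<^sub>m m n) (mat m m (\<lambda>(i, j). a (n + i) (n + j)))"
    by (intro eq_matI) auto
  then show ?thesis
    unfolding fdet_def by (simp add: det_four_block_mat_lower_left_zero[of _ n _ m])
qed

lemma fdet_1 [simp]: "fdet (Suc 0) a = a 0 0"
  unfolding fdet_def using det_single[of "mat 1 1 (\<lambda>(i, j). a i j)"] by simp

lemma fdet_one: "(\<And>i j. i < n \<Longrightarrow> j < n \<Longrightarrow> a i j = (if i = j then 1 else 0)) \<Longrightarrow> fdet n a = 1"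
proof -
  assume *: "\<And>i j. i < n \<Longrightarrow> j < n \<Longrightarrow> a i j = (if i = j then 1 else 0)"
  have "mat n n (\<lambda>(i, j). a i j) = 1\<^sub>m n"
    using * by (intro eq_matI) auto
  then show ?thesis by (simp add: fdet_def)
qed

text \<open>Column operations with the pivot clear the rest of the last row. The inverse of the
  pivot is an explicit \<open>c\<close> instead of a quotient, so that integer matrices can be
  reduced when the pivot is 1 or -1.\<close>

lemma fdet_schur:
  fixes a :: "nat \<Rightarrow> nat \<Rightarrow> 'a::idom"
  assumes c: "c * a n n = 1"
  shows "fdet (Suc n) a = a n n * fdet n (\<lambda>i j. a i j - a i n * c * a n j)"
proof -
  define u where "u k j = (if k = j then 1 else if k = n \<and> j < n then - (c * a n j) else 0)" for k j
  \<comment> \<open>\<open>u\<close> is lower triangular; its transpose has the zero lower left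
    block that \<open>fdet_block\<close> asks for.\<close>
  have "fdet (n + 1) (\<lambda>i j. u j i) = fdet n (\<lambda>i j. u j i) * fdet 1 (\<lambda>i j. u (n + j) (n + i))"
    by (rule fdet_block) (auto simp: u_def)
  also have "fdet n (\<lambda>i j. u j i) = 1"
    by (rule fdet_one) (auto simp: u_def)
  finally have u: "fdet (Suc n) u = 1"
    using fdet_transpose[of "Suc n" u] by (simp add: u_def)
  have "fdet (Suc n) a = fdet (Suc n) (\<lambda>i j. \<Sum>k<Suc n. a i k * u k j)"
    using fdet_mult[of "Suc n" a u] u by simp
  also have "\<dots> = fdet (n + 1) (\<lambda>i j. if j = n then a i n else a i j - a i n * c * a n j)"
    unfolding Suc_eq_plus1
  proof (rule fdet_cong)
    fix i j assume "i < n + 1" "j < n + 1"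
    have "(\<Sum>k<n. a i k * u k j) = (\<Sum>k<n. if k = j then a i j else 0)"
      by (intro sum.cong) (auto simp: u_def)
    then show "(\<Sum>k<n + 1. a i k * u k j) = (if j = n then a i n else a i j - a i n * c * a n j)"
      using \<open>j < n + 1\<close> by (auto simp: u_def algebra_simps)
  qed
  also have "\<dots> = fdet n (\<lambda>i j. if j = n then a i n else a i j - a i n * c * a n j) * a n n"
  proof (subst fdet_block)
    fix i j assume "i < n" "j < (1::nat)"
    have "a n n * c * a n i = a n i"
      using c by (metis mult.commute mult_1)
    then show "(if i = n then a (n + j) n else a (n + j) i - a (n + j) n * c * a n i) = 0"
      using \<open>i < n\<close> \<open>j < 1\<close> by simp
  qed simp
  also have "fdet n (\<lambda>i j. if j = n then a i n else a i j - a i n * c * a n j) =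
      fdet n (\<lambda>i j. a i j - a i n * c * a n j)"
    by (rule fdet_cong) auto
  finally show ?thesis by (simp add: mult.commute)
qed

text \<open>Expanding the product of the row norms gives one nonnegative term for every map of the
  index set into itself; the permutations supply only some of them.\<close>

lemma abs_fdet_le:
  fixes a :: "nat \<Rightarrow> nat \<Rightarrow> int"
  shows "\<bar>fdet n a\<bar> \<le> (\<Prod>i<n. \<Sum>j<n. \<bar>a i j\<bar>)"
proof -
  let ?P = "{p. p permutes {0..<n}}"
  define g where "g f = (\<Prod>i = 0..<n. \<bar>a i (f i)\<bar>)" for f
  have inj: "inj_on (\<lambda>p. restrict p {0..<n}) ?P"
  proof (rule inj_onI)
    fix p q assume "p \<in> ?P" "q \<in> ?P" and eq: "restrict p {0..<n} = restrict q {0..<n}"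
    then have "p permutes {0..<n}" "q permutes {0..<n}" by auto
    then show "p = q"
      using eq by (metis permutes_not_in restrict_apply ext)
  qed
  have "\<bar>fdet n a\<bar> \<le> (\<Sum>p\<in>?P. \<bar>signof p * (\<Prod>i = 0..<n. a i (p i))\<bar>)"
    unfolding fdet_sum by (rule sum_abs)
  also have "\<dots> = (\<Sum>p\<in>?P. g (restrict p {0..<n}))"
    by (intro sum.cong) (auto simp: g_def abs_mult abs_prod sign_def)
  also have "\<dots> = (\<Sum>f\<in>(\<lambda>p. restrict p {0..<n}) ` ?P. g f)"
    by (simp add: sum.reindex[OF inj])
  also have "\<dots> \<le> (\<Sum>f\<in>{0..<n} \<rightarrow>\<^sub>E {0..<n}. g f)"
  proof (rule sum_mono2)
    show "finite ({0..<n} \<rightarrow>\<^sub>E {0..<n})" by (simp add: finite_PiE)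
    show "(\<lambda>p. restrict p {0..<n}) ` ?P \<subseteq> {0..<n} \<rightarrow>\<^sub>E {0..<n}"
    proof (rule image_subsetI)
      fix p assume "p \<in> ?P"
      then have p: "p permutes {0..<n}" by simp
      have "p i \<in> {0..<n}" if "i \<in> {0..<n}" for i
        using permutes_in_image[OF p] that by simp
      then show "restrict p {0..<n} \<in> {0..<n} \<rightarrow>\<^sub>E {0..<n}" by auto
    qed
  qed (auto simp: g_def intro: prod_nonneg)
  also have "\<dots> = (\<Prod>i = 0..<n. \<Sum>j = 0..<n. \<bar>a i j\<bar>)"
    unfolding g_def by (rule prod_sum_PiE[symmetric]) auto
  finally show ?thesis by (simp add: lessThan_atLeast0)
qed

text \<open>Halving all entries pulls out \<open>2 ^ n\<close> and leaves a nonzero integer, a lower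
  bound that meets the upper bound coming from the row norms.\<close>

lemma abs_fdet_even:
  fixes a :: "nat \<Rightarrow> nat \<Rightarrow> int"
  assumes norm: "\<And>i. i < n \<Longrightarrow> (\<Sum>j<n. \<bar>a i j\<bar>) \<le> 2"
    and even: "\<And>i j. i < n \<Longrightarrow> j < n \<Longrightarrow> even (a i j)"
    and nz: "fdet n a \<noteq> 0"
  shows "\<bar>fdet n a\<bar> = 2 ^ n"
proof -
  have "fdet n a = fdet n (\<lambda>i j. 2 * (a i j div 2))"
    by (rule fdet_cong) (use even in auto)
  then have eq: "fdet n a = 2 ^ n * fdet n (\<lambda>i j. a i j div 2)"
    by (simp add: fdet_scale)
  have "(\<Prod>i<n. \<Sum>j<n. \<bar>a i j\<bar>) \<le> (\<Prod>i<n. 2)"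
    by (rule prod_mono) (use norm in \<open>auto intro: sum_nonneg\<close>)
  then have "\<bar>fdet n a\<bar> \<le> 2 ^ n"
    using abs_fdet_le[of n a] by simp
  moreover have "\<bar>fdet n (\<lambda>i j. a i j div 2)\<bar> \<ge> 1"
    using nz eq by auto
  ultimately show ?thesis
    unfolding eq abs_mult by (auto simp: mult_le_cancel_left1 intro!: antisym)
qed

text \<open>
  In terms of lattices: the cokernel of a nonsingular integer matrix whose rows have \<open>\<ell>\<^sub>1\<close>-norm
  at most two is an elementary abelian 2-group, so its order is the number of solutions modulo 2.
\<close>

lemma abs_fdet_light:
  fixes a :: "nat \<Rightarrow> nat \<Rightarrow> int"
  assumes "\<And>i. i < n \<Longrightarrow> (\<Sum>j<n. \<bar>a i j\<bar>) \<le> 2"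
    and "fdet n a \<noteq> 0"
  shows "\<bar>fdet n a\<bar> = int (card {S. S \<subseteq> {..<n} \<and> (\<forall>i<n. even (\<Sum>j\<in>S. a i j))})"
  using assms
proof (induction n arbitrary: a)
  case 0
  have "{S. S \<subseteq> {..<0::nat} \<and> (\<forall>i<0. even (\<Sum>j\<in>S. a i j))} = {{}}" by auto
  then show ?case by simp
next
  case (Suc n)
  show ?case
  \<comment> \<open>If all entries are even, there is no condition modulo 2 and every subset counts.
    Otherwise an odd entry is moved to the last corner and eliminated, which changes neither the
    absolute value of the determinant nor the number of solutions.\<close>
  proof (cases "\<forall>i<Suc n. \<forall>j<Suc n. even (a i j)")
    case True
    have "{S. S \<subseteq> {..<Suc n} \<and> (\<forall>i<Suc n. even (\<Sum>j\<in>S. a i j))} = Pow {..<Suc n}"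
      using True by (auto intro!: dvd_sum)
    moreover have "\<bar>fdet (Suc n) a\<bar> = 2 ^ Suc n"
      using Suc.prems True by (intro abs_fdet_even) auto
    ultimately show ?thesis
      by (simp add: card_Pow)
  next
    case False
    then obtain i0 j0 where ij: "i0 < Suc n" "j0 < Suc n" "odd (a i0 j0)" by auto
    define p q where "p = transpose i0 n" and "q = transpose j0 n"
    have p: "p permutes {..<Suc n}" and q: "q permutes {..<Suc n}"
      unfolding p_def q_def using ij by (auto intro!: permutes_swap_id)
    define a' where "a' i j = a (p i) (q j)" for i j
    have qq: "q (q j) = j" for j by (simp add: q_def)
    have pp: "p (p j) = j" for j by (simp add: p_def)
    have plt: "p i < Suc n \<longleftrightarrow> i < Suc n" for i
      using permutes_in_image[OF p, of i] by simp
    have norm: "(\<Sum>j<Suc n. \<bar>a' i j\<bar>) \<le> 2" if "i < Suc n" for i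
    proof -
      have "(\<Sum>j<Suc n. \<bar>a' i j\<bar>) = (\<Sum>j<Suc n. \<bar>a (p i) j\<bar>)"
        unfolding a'_def by (rule sum.permute[OF q, symmetric, unfolded comp_def])
      then show ?thesis
        using Suc.prems(1)[of "p i"] that plt by simp
    qed
    have fa': "\<bar>fdet (Suc n) a'\<bar> = \<bar>fdet (Suc n) a\<bar>"
      unfolding a'_def
      using fdet_permute_rows[OF p, of "\<lambda>i j. a i (q j)"] fdet_permute_columns[OF q, of a]
      by (simp add: abs_mult sign_def)
    define c where "c = a' n n"
    have oddc: "odd c"
      using ij by (simp add: c_def a'_def p_def q_def)
    have "\<bar>c\<bar> \<le> 2"
    proof -
      have "0 \<le> (\<Sum>j<n. \<bar>a' n j\<bar>)" by (rule sum_nonneg) simp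
      moreover have "(\<Sum>j<n. \<bar>a' n j\<bar>) + \<bar>c\<bar> \<le> 2" using norm[of n] by (simp add: c_def)
      ultimately show ?thesis by linarith
    qed
    \<comment> \<open>The norm bound leaves 1 and -1 as the only odd values, so the pivot is its own
      inverse and the elimination stays integral.\<close>
    then have c1: "\<bar>c\<bar> = 1"
      using oddc by presburger
    then have cc: "c * a' n n = 1"
      unfolding c_def by (metis abs_mult_self_eq mult_1)
    define b where "b i j = a' i j - a' i n * c * a' n j" for i j
    have fb: "\<bar>fdet (Suc n) a'\<bar> = \<bar>fdet n b\<bar>"
    proof -
      have "fdet (Suc n) a' = c * fdet n b"
        unfolding b_def c_def by (rule fdet_schur) (use cc c_def in simp)
      then show ?thesis using c1 by (simp add: abs_mult)
    qed
    \<comment> \<open>The pivot uses up one unit of the norm of its row. Subtracting a multiple of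
      this row from another one thus adds at most the size of the entry that is cleared, and
      \<open>b\<close> stays within the bound.\<close>
    have rown: "(\<Sum>j<n. \<bar>a' n j\<bar>) \<le> 1"
      using norm[of n] c1 by (simp add: c_def)
    have IH: "\<bar>fdet n b\<bar> = int (card {S. S \<subseteq> {..<n} \<and> (\<forall>i<n. even (\<Sum>j\<in>S. b i j))})"
    proof (rule Suc.IH)
      fix i assume "i < n"
      have "(\<Sum>j<n. \<bar>b i j\<bar>) \<le> (\<Sum>j<n. \<bar>a' i j\<bar> + \<bar>a' i n\<bar> * \<bar>a' n j\<bar>)"
        unfolding b_def using c1 by (intro sum_mono) (metis abs_mult abs_triangle_ineq4 mult_1_right)
      also have "\<dots> = (\<Sum>j<n. \<bar>a' i j\<bar>) + \<bar>a' i n\<bar> * (\<Sum>j<n. \<bar>a' n j\<bar>)"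
        by (simp add: sum.distrib sum_distrib_left)
      also have "\<dots> \<le> (\<Sum>j<n. \<bar>a' i j\<bar>) + \<bar>a' i n\<bar> * 1"
        by (intro add_left_mono mult_left_mono rown) simp
      also have "\<dots> \<le> 2"
        using norm[of i] \<open>i < n\<close> by simp
      finally show "(\<Sum>j<n. \<bar>b i j\<bar>) \<le> 2" .
    next
      show "fdet n b \<noteq> 0"
        using fb fa' Suc.prems(2) by auto
    qed
    let ?A = "{S. S \<subseteq> {..<Suc n} \<and> (\<forall>i<Suc n. even (\<Sum>j\<in>S. a i j))}"
    let ?A' = "{S. S \<subseteq> {..<Suc n} \<and> (\<forall>i<Suc n. even (\<Sum>j\<in>S. a' i j))}"
    let ?B = "{S. S \<subseteq> {..<n} \<and> (\<forall>i<n. even (\<Sum>j\<in>S. b i j))}"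
    have inj: "inj_on q S" for S
      using permutes_inj[OF q] by (rule inj_on_subset) simp
    have img: "(\<Sum>j\<in>q ` S. h j) = (\<Sum>j\<in>S. h (q j))" for h :: "nat \<Rightarrow> int" and S
      by (simp add: sum.reindex[OF inj])
    have sub: "q ` S \<subseteq> {..<Suc n} \<longleftrightarrow> S \<subseteq> {..<Suc n}" for S
      using permutes_in_image[OF q] by auto
    have "bij_betw (image q) ?A ?A'"
    proof (rule bij_betw_byWitness[where f' = "image q"])
      show "image q ` ?A \<subseteq> ?A'"
        using sub plt by (auto simp: img a'_def qq)
      show "image q ` ?A' \<subseteq> ?A"
      proof (rule image_subsetI)
        fix S assume S: "S \<in> ?A'"
        have "even (\<Sum>j\<in>q ` S. a i j)" if "i < Suc n" for i
        proof -
          have "even (\<Sum>j\<in>S. a' (p i) j)" using S plt that by auto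
          then show ?thesis by (simp add: img a'_def pp)
        qed
        then show "q ` S \<in> ?A" using S sub by simp
      qed
    qed (auto simp: image_image qq)
    then have AA': "card ?A = card ?A'" by (rule bij_betw_same_card)
    \<comment> \<open>As the pivot is odd, row \<open>n\<close> modulo 2 decides from
      \<open>T - {n}\<close> whether \<open>n\<close> belongs to \<open>T\<close>; substituting this
      into the other rows turns them into the rows of \<open>b\<close>.\<close>
    have key: "(\<forall>i<Suc n. even (\<Sum>j\<in>T. a' i j)) \<longleftrightarrow>
        (n \<in> T \<longleftrightarrow> odd (\<Sum>j\<in>T - {n}. a' n j)) \<and> (\<forall>i<n. even (\<Sum>j\<in>T - {n}. b i j))"
      if T: "T \<subseteq> {..<Suc n}" for T
    proof -
      have fin: "finite T" using T finite_subset by blast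
      have spl: "(\<Sum>j\<in>T. a' i j) = (\<Sum>j\<in>T - {n}. a' i j) + (if n \<in> T then a' i n else 0)" for i
        using fin by (auto simp: sum.remove)
      have bs: "(\<Sum>j\<in>T - {n}. b i j) = (\<Sum>j\<in>T - {n}. a' i j) - a' i n * c * (\<Sum>j\<in>T - {n}. a' n j)" for i
        by (simp add: b_def sum_subtractf sum_distrib_left)
      have rn: "even (\<Sum>j\<in>T. a' n j) \<longleftrightarrow> (n \<in> T \<longleftrightarrow> odd (\<Sum>j\<in>T - {n}. a' n j))"
        using oddc unfolding spl[of n] c_def by (cases "n \<in> T") simp_all
      have ri: "even (\<Sum>j\<in>T. a' i j) \<longleftrightarrow> even (\<Sum>j\<in>T - {n}. b i j)"
        if "n \<in> T \<longleftrightarrow> odd (\<Sum>j\<in>T - {n}. a' n j)" for i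
        using that oddc unfolding spl[of i] bs by (cases "n \<in> T") simp_all
      show ?thesis
        using rn ri unfolding less_Suc_eq by blast
    qed
    have "bij_betw (\<lambda>S. S - {n}) ?A' ?B"
    proof (rule bij_betw_byWitness[where f' = "\<lambda>T. if odd (\<Sum>j\<in>T. a' n j) then insert n T else T"])
      show "\<forall>S\<in>?A'. (if odd (\<Sum>j\<in>S - {n}. a' n j) then insert n (S - {n}) else S - {n}) = S"
        using key by auto
      show "\<forall>T\<in>?B. (if odd (\<Sum>j\<in>T. a' n j) then insert n T else T) - {n} = T"
        by auto
      show "(\<lambda>S. S - {n}) ` ?A' \<subseteq> ?B"
      proof (rule image_subsetI)
        fix S assume "S \<in> ?A'"
        then have S: "S \<subseteq> {..<Suc n}" "\<forall>i<Suc n. even (\<Sum>j\<in>S. a' i j)" by auto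
        have "S - {n} \<subseteq> {..<n}" using S(1) by (auto simp: less_Suc_eq)
        moreover have "\<forall>i<n. even (\<Sum>j\<in>S - {n}. b i j)" using key[OF S(1)] S(2) by blast
        ultimately show "S - {n} \<in> ?B" by blast
      qed
      show "(\<lambda>T. if odd (\<Sum>j\<in>T. a' n j) then insert n T else T) ` ?B \<subseteq> ?A'"
      proof (rule image_subsetI)
        fix T assume "T \<in> ?B"
        then have T: "T \<subseteq> {..<n}" "\<forall>i<n. even (\<Sum>j\<in>T. b i j)" by auto
        let ?T = "if odd (\<Sum>j\<in>T. a' n j) then insert n T else T"
        have nT: "n \<notin> T" using T by auto
        then have "?T - {n} = T" by auto
        moreover have "?T \<subseteq> {..<Suc n}" using T by auto
        moreover have "n \<in> ?T \<longleftrightarrow> odd (\<Sum>j\<in>T. a' n j)" using nT by auto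
        ultimately show "?T \<in> ?A'"
          using key[of ?T] T by simp
      qed
    qed
    then have "card ?A' = card ?B" by (rule bij_betw_same_card)
    then show ?thesis
      using AA' IH fa' fb by simp
  qed
qed

lemma fdet_kernel:
  fixes a :: "nat \<Rightarrow> nat \<Rightarrow> 'a::idom"
  shows "fdet n a \<noteq> 0 \<longleftrightarrow> (\<forall>f. (\<forall>i<n. (\<Sum>j<n. a i j * f j) = 0) \<longrightarrow> (\<forall>j<n. f j = 0))"
proof -
  let ?A = "mat n n (\<lambda>(i, j). a i j)"
  have eq: "(?A *\<^sub>v v = 0\<^sub>v n) \<longleftrightarrow> (\<forall>i<n. (\<Sum>j<n. a i j * v $ j) = 0)" if "v \<in> carrier_vec n" for v
  proof -
    have "(?A *\<^sub>v v) $ i = (\<Sum>j<n. a i j * v $ j)" if "i < n" for i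
      using that \<open>v \<in> carrier_vec n\<close> by (auto simp: scalar_prod_def lessThan_atLeast0)
    then show ?thesis
      by (auto simp: vec_eq_iff)
  qed
  have "fdet n a = 0 \<longleftrightarrow> (\<exists>v. v \<in> carrier_vec n \<and> v \<noteq> 0\<^sub>v n \<and> ?A *\<^sub>v v = 0\<^sub>v n)"
    unfolding fdet_def by (rule det_0_iff_vec_prod_zero) simp
  also have "\<dots> \<longleftrightarrow> (\<exists>f. (\<forall>i<n. (\<Sum>j<n. a i j * f j) = 0) \<and> (\<exists>j<n. f j \<noteq> 0))"
  proof
    assume "\<exists>v. v \<in> carrier_vec n \<and> v \<noteq> 0\<^sub>v n \<and> ?A *\<^sub>v v = 0\<^sub>v n"
    then obtain v where v: "v \<in> carrier_vec n" "v \<noteq> 0\<^sub>v n" "?A *\<^sub>v v = 0\<^sub>v n" by blast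
    have "\<exists>j<n. v $ j \<noteq> 0"
      using v(1,2) by (auto simp: vec_eq_iff)
    then show "\<exists>f. (\<forall>i<n. (\<Sum>j<n. a i j * f j) = 0) \<and> (\<exists>j<n. f j \<noteq> 0)"
      using eq[OF v(1)] v(3) by (intro exI[of _ "vec_index v"]) blast
  next
    assume "\<exists>f. (\<forall>i<n. (\<Sum>j<n. a i j * f j) = 0) \<and> (\<exists>j<n. f j \<noteq> 0)"
    then obtain f j where f: "\<forall>i<n. (\<Sum>j<n. a i j * f j) = 0" "j < n" "f j \<noteq> 0" by blast
    have "vec n f \<noteq> 0\<^sub>v n"
    proof
      assume "vec n f = 0\<^sub>v n"
      then have "vec n f $ j = 0\<^sub>v n $ j" by simp
      then show False using f by simp
    qed
    moreover have "?A *\<^sub>v vec n f = 0\<^sub>v n"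
      using f(1) by (subst eq) auto
    ultimately show "\<exists>v. v \<in> carrier_vec n \<and> v \<noteq> 0\<^sub>v n \<and> ?A *\<^sub>v v = 0\<^sub>v n"
      by (intro exI[of _ "vec n f"]) simp
  qed
  finally show ?thesis by blast
qed

text \<open>Cramer's rule: the solution is the adjugate applied to \<open>y\<close>, divided by the
  determinant.\<close>

lemma fdet_solve:
  fixes a :: "nat \<Rightarrow> nat \<Rightarrow> 'a::field"
  assumes "fdet n a \<noteq> 0"
  shows "\<exists>f. \<forall>i<n. (\<Sum>j<n. a i j * f j) = y i"
proof -
  let ?A = "mat n n (\<lambda>(i, j). a i j)" and ?d = "fdet n a"
  define f where "f j = (\<Sum>k<n. adj_mat ?A $$ (j, k) * y k) / ?d" for j
  have adj: "?A * adj_mat ?A = ?d \<cdot>\<^sub>m 1\<^sub>m n" and dim: "adj_mat ?A \<in> carrier_mat n n"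
    using adj_mat[of ?A n] by (auto simp: fdet_def)
  have row: "(\<Sum>j<n. a i j * adj_mat ?A $$ (j, k)) = (if i = k then ?d else 0)" if "i < n" "k < n" for i k
  proof -
    have "(?A * adj_mat ?A) $$ (i, k) = (\<Sum>j<n. a i j * adj_mat ?A $$ (j, k))"
      using that dim by (auto simp: scalar_prod_def lessThan_atLeast0)
    moreover have "(?A * adj_mat ?A) $$ (i, k) = (if i = k then ?d else 0)"
      unfolding adj using that by simp
    ultimately show ?thesis by metis
  qed
  have "(\<Sum>j<n. a i j * f j) = y i" if "i < n" for i
  proof -
    have "(\<Sum>j<n. a i j * f j) = (\<Sum>j<n. \<Sum>k<n. a i j * adj_mat ?A $$ (j, k) * y k) / ?d"
      by (simp add: f_def sum_divide_distrib sum_distrib_left mult.assoc)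
    also have "(\<Sum>j<n. \<Sum>k<n. a i j * adj_mat ?A $$ (j, k) * y k) =
        (\<Sum>k<n. (\<Sum>j<n. a i j * adj_mat ?A $$ (j, k)) * y k)"
      by (subst sum.swap) (simp add: sum_distrib_right)
    also have "\<dots> = (\<Sum>k<n. if k = i then ?d * y i else 0)"
      using that by (intro sum.cong) (auto simp: row)
    also have "\<dots> / ?d = y i"
      using that assms by simp
    finally show ?thesis .
  qed
  then show ?thesis by blast
qed

lemma fdet_of_int: "fdet n (\<lambda>i j. of_int (a i j)) = (of_int (fdet n a) :: 'a::{comm_ring_1,ring_char_0})"
  by (simp add: fdet_sum)

lemma fdet_identical_rows:
  assumes "i < n" "k < n" "i \<noteq> k" "\<And>j. j < n \<Longrightarrow> a i j = a k j"
  shows "fdet n a = 0"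
  unfolding fdet_def using assms
  by (intro det_identical_rows[of _ n i k]) (auto simp: row_def intro!: eq_vecI)

text \<open>Multiplying out the sums in the Leibniz formula assigns an element of \<open>E\<close>
  to each row. Assignments that repeat an element give equal rows and vanish; the injective ones are
  grouped by their image \<open>B\<close>. The enumeration \<open>g B\<close> is arbitrary because
  the minor occurs squared.\<close>

lemma cauchy_binet_gram:
  fixes b :: "'e \<Rightarrow> nat \<Rightarrow> 'a::comm_ring_1"
  assumes E: "finite E"
    and g: "\<And>B. B \<subseteq> E \<Longrightarrow> card B = n \<Longrightarrow> bij_betw (g B) {0..<n} B"
  shows "fdet n (\<lambda>i j. \<Sum>e\<in>E. x e * b e i * b e j) =
    (\<Sum>B | B \<subseteq> E \<and> card B = n. (\<Prod>e\<in>B. x e) * (fdet n (\<lambda>i j. b (g B i) j))\<^sup>2)"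
proof -
  let ?N = "{0..<n}" and ?\<B> = "{B. B \<subseteq> E \<and> card B = n}"
  let ?P = "{p. p permutes ?N}"
  \<comment> \<open>The contribution of one assignment \<open>f\<close> once the sum over the
    permutations of the outer determinant has been carried out.\<close>
  define t where "t f = (\<Prod>i\<in>?N. x (f i) * b (f i) i) * fdet n (\<lambda>i j. b (f i) j)" for f :: "nat \<Rightarrow> 'e"
  have finP: "finite (?N \<rightarrow>\<^sub>E E)" using E by (simp add: finite_PiE)
  have "fdet n (\<lambda>i j. \<Sum>e\<in>E. x e * b e i * b e j) =
      (\<Sum>p\<in>?P. signof p * (\<Sum>f\<in>?N \<rightarrow>\<^sub>E E. \<Prod>i\<in>?N. x (f i) * b (f i) i * b (f i) (p i)))"
    unfolding fdet_sum using E by (subst prod_sum_PiE) auto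
  also have "\<dots> = (\<Sum>f\<in>?N \<rightarrow>\<^sub>E E. \<Sum>p\<in>?P. signof p * (\<Prod>i\<in>?N. x (f i) * b (f i) i * b (f i) (p i)))"
    by (simp only: sum_distrib_left, rule sum.swap)
  also have "\<dots> = (\<Sum>f\<in>?N \<rightarrow>\<^sub>E E. t f)"
    unfolding t_def fdet_sum
    by (simp only: sum_distrib_left prod.distrib) (intro sum.cong refl, simp only: ac_simps)
  also have "\<dots> = (\<Sum>f | f \<in> ?N \<rightarrow>\<^sub>E E \<and> inj_on f ?N. t f)"
  proof (rule sum.mono_neutral_right[OF finP])
    show "\<forall>f\<in>(?N \<rightarrow>\<^sub>E E) - {f. f \<in> ?N \<rightarrow>\<^sub>E E \<and> inj_on f ?N}. t f = 0"
    proof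
      fix f assume "f \<in> (?N \<rightarrow>\<^sub>E E) - {f. f \<in> ?N \<rightarrow>\<^sub>E E \<and> inj_on f ?N}"
      then obtain i k where "i < n" "k < n" "i \<noteq> k" "f i = f k"
        by (auto simp: inj_on_def)
      then have "fdet n (\<lambda>i j. b (f i) j) = 0"
        by (intro fdet_identical_rows[of i n k]) auto
      then show "t f = 0" by (simp add: t_def)
    qed
  qed auto
  also have "\<dots> = (\<Sum>B\<in>?\<B>. \<Sum>f | f \<in> ?N \<rightarrow>\<^sub>E E \<and> inj_on f ?N \<and> f ` ?N = B. t f)"
  proof -
    have "(\<Sum>f | f \<in> ?N \<rightarrow>\<^sub>E E \<and> inj_on f ?N. t f) =
        (\<Sum>B\<in>?\<B>. \<Sum>f | f \<in> {f. f \<in> ?N \<rightarrow>\<^sub>E E \<and> inj_on f ?N} \<and> f ` ?N = B. t f)"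
    proof (rule sum.group[symmetric])
      show "finite {f. f \<in> ?N \<rightarrow>\<^sub>E E \<and> inj_on f ?N}"
        by (rule finite_subset[OF _ finP]) auto
      show "finite ?\<B>" using E by (auto intro: finite_subset[of _ "Pow E"])
      show "(\<lambda>f. f ` ?N) ` {f. f \<in> ?N \<rightarrow>\<^sub>E E \<and> inj_on f ?N} \<subseteq> ?\<B>"
        by (auto simp: card_image)
    qed
    then show ?thesis by (simp add: conj_assoc)
  qed
  also have "\<dots> = (\<Sum>B\<in>?\<B>. (\<Prod>e\<in>B. x e) * (fdet n (\<lambda>i j. b (g B i) j))\<^sup>2)"
  proof (rule sum.cong[OF refl])
    fix B assume "B \<in> ?\<B>"
    then have B: "B \<subseteq> E" and gB: "bij_betw (g B) ?N B" using g by auto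
    let ?h = "g B" and ?inv = "inv_into ?N (g B)"
    have hin: "?h i \<in> B" if "i \<in> ?N" for i
      using gB that by (auto simp: bij_betw_def)
    have inv_h: "?inv (?h i) = i" if "i \<in> ?N" for i
      using gB that by (auto simp: bij_betw_def)
    have h_inv: "?h (?inv e) = e" "?inv e \<in> ?N" if "e \<in> B" for e
      using bij_betw_inv_into_right[OF gB] bij_betw_apply[OF bij_betw_inv_into[OF gB]] that by auto
    let ?F = "{f. f \<in> ?N \<rightarrow>\<^sub>E E \<and> inj_on f ?N \<and> f ` ?N = B}"
    have "(\<Sum>f\<in>?F. t f) = (\<Sum>p\<in>?P. t (restrict (?h \<circ> p) ?N))"
    \<comment> \<open>An injective assignment with image \<open>B\<close> is the fixed enumeration
      precomposed with a permutation, which is extended by the identity outside the index range as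
      \<open>permutes\<close> demands.\<close>
    proof (rule sum.reindex_bij_witness[of _ "\<lambda>p. restrict (?h \<circ> p) ?N"
          "\<lambda>f i. if i \<in> ?N then ?inv (f i) else i"])
      fix p assume "p \<in> ?P"
      then have p: "p permutes ?N" by simp
      have pin: "p i \<in> ?N \<longleftrightarrow> i \<in> ?N" for i using permutes_in_image[OF p] .
      show "(\<lambda>i. if i \<in> ?N then ?inv (restrict (?h \<circ> p) ?N i) else i) = p"
      proof
        fix i show "(if i \<in> ?N then ?inv (restrict (?h \<circ> p) ?N i) else i) = p i"
          using inv_h pin[of i] permutes_not_in[OF p, of i] by auto
      qed
      have "bij_betw (?h \<circ> p) ?N B"
        using permutes_imp_bij[OF p] gB by (rule bij_betw_trans)
      then have "bij_betw (restrict (?h \<circ> p) ?N) ?N B"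
        by (rule bij_betw_cong[THEN iffD1, rotated]) simp
      then show "restrict (?h \<circ> p) ?N \<in> ?F"
        using B by (auto simp: bij_betw_def)
    next
      fix f assume "f \<in> ?F"
      then have f: "f \<in> ?N \<rightarrow>\<^sub>E E" "bij_betw f ?N B" by (auto simp: bij_betw_def)
      have fin: "f i \<in> B" if "i \<in> ?N" for i using f(2) that by (auto simp: bij_betw_def)
      show eq: "restrict (?h \<circ> (\<lambda>i. if i \<in> ?N then ?inv (f i) else i)) ?N = f"
      proof
        fix i show "restrict (?h \<circ> (\<lambda>i. if i \<in> ?N then ?inv (f i) else i)) ?N i = f i"
          using h_inv fin f(1) by (auto simp: PiE_def extensional_def)
      qed
      have "bij_betw (?inv \<circ> f) ?N ?N"
        using f(2) bij_betw_inv_into[OF gB] by (rule bij_betw_trans)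
      then have "bij_betw (\<lambda>i. if i \<in> ?N then ?inv (f i) else i) ?N ?N"
        by (rule bij_betw_cong[THEN iffD1, rotated]) simp
      then have "(\<lambda>i. if i \<in> ?N then ?inv (f i) else i) permutes ?N"
        by (rule bij_imp_permutes) auto
      then show "(\<lambda>i. if i \<in> ?N then ?inv (f i) else i) \<in> ?P" by simp
      show "t (restrict (?h \<circ> (\<lambda>i. if i \<in> ?N then ?inv (f i) else i)) ?N) = t f"
        unfolding eq ..
    qed
    \<comment> \<open>The weights do not depend on the order of \<open>B\<close>, and the minor of
      the permuted enumeration differs by a sign. What is left of the sum over \<open>p\<close> is a
      second copy of the same minor.\<close>
    also have "\<dots> = (\<Sum>p\<in>?P. signof p * (\<Prod>i\<in>?N. b (?h (p i)) i)) * ((\<Prod>e\<in>B. x e) * fdet n (\<lambda>i j. b (?h i) j))"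
      unfolding sum_distrib_right
    proof (rule sum.cong[OF refl])
      fix p assume "p \<in> ?P"
      then have p: "p permutes ?N" by simp
      have "bij_betw (?h \<circ> p) ?N B"
        using permutes_imp_bij[OF p] gB by (rule bij_betw_trans)
      then have "(\<Prod>i\<in>?N. x (?h (p i))) = (\<Prod>e\<in>B. x e)"
        using prod.reindex_bij_betw[of "?h \<circ> p" ?N B x] by simp
      moreover have "fdet n (\<lambda>i j. b (restrict (?h \<circ> p) ?N i) j) = fdet n (\<lambda>i j. b (?h (p i)) j)"
        by (rule fdet_cong) simp
      moreover have "fdet n (\<lambda>i j. b (?h (p i)) j) = signof p * fdet n (\<lambda>i j. b (?h i) j)"
        using fdet_permute_rows[of p n "\<lambda>i. b (?h i)"] p by (simp add: lessThan_atLeast0)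
      ultimately show "t (restrict (?h \<circ> p) ?N) =
          signof p * (\<Prod>i\<in>?N. b (?h (p i)) i) * ((\<Prod>e\<in>B. x e) * fdet n (\<lambda>i j. b (?h i) j))"
        by (simp add: t_def prod.distrib ac_simps)
    qed
    also have "(\<Sum>p\<in>?P. signof p * (\<Prod>i\<in>?N. b (?h (p i)) i)) = fdet n (\<lambda>i j. b (?h i) j)"
      using fdet_transpose[of n "\<lambda>i j. b (?h i) j"] fdet_sum[of n "\<lambda>i j. b (?h j) i"] by simp
    finally show "(\<Sum>f\<in>?F. t f) = (\<Prod>e\<in>B. x e) * (fdet n (\<lambda>i j. b (?h i) j))\<^sup>2"
      by (simp add: power2_eq_square ac_simps)
  qed
  finally show ?thesis .
qed

section \<open>Square minors indexed by finite sets\<close>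

definition nondeg :: "'w set \<Rightarrow> ('e \<Rightarrow> 'w \<Rightarrow> int) \<Rightarrow> 'e set \<Rightarrow> bool" where
  "nondeg W b B \<longleftrightarrow> (\<forall>f::'w \<Rightarrow> real. (\<forall>e\<in>B. (\<Sum>w\<in>W. of_int (b e w) * f w) = 0) \<longrightarrow> (\<forall>w\<in>W. f w = 0))"

text \<open>The kernel of the matrix modulo 2, each vector being encoded by its support.\<close>

definition parity_sets :: "'w set \<Rightarrow> ('e \<Rightarrow> 'w \<Rightarrow> int) \<Rightarrow> 'e set \<Rightarrow> 'w set set" where
  "parity_sets W b B = {S. S \<subseteq> W \<and> (\<forall>e\<in>B. even (\<Sum>w\<in>S. b e w))}"

lemma nondeg_iff_fdet:
  assumes g: "bij_betw g {..<n} B" and u: "bij_betw u {..<n} W"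
  shows "nondeg W b B \<longleftrightarrow> fdet n (\<lambda>i j. real_of_int (b (g i) (u j))) \<noteq> 0"
  unfolding fdet_kernel
proof
  have sum_u: "(\<Sum>w\<in>W. h w) = (\<Sum>j<n. h (u j))" for h :: "'b \<Rightarrow> real"
    by (rule sum.reindex_bij_betw[OF u, symmetric])
  have gi: "g i \<in> B" if "i < n" for i using bij_betw_apply[OF g, of i] that by simp
  have ui: "u i \<in> W" if "i < n" for i using bij_betw_apply[OF u, of i] that by simp
  {
    assume nd: "nondeg W b B"
    show "\<forall>f. (\<forall>i<n. (\<Sum>j<n. real_of_int (b (g i) (u j)) * f j) = 0) \<longrightarrow> (\<forall>j<n. f j = 0)"
    proof (intro allI impI)
      fix f :: "nat \<Rightarrow> real" and j
      assume f: "\<forall>i<n. (\<Sum>j<n. real_of_int (b (g i) (u j)) * f j) = 0" and j: "j < n"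
      define f' where "f' w = f (inv_into {..<n} u w)" for w
      have f'u: "f' (u j) = f j" if "j < n" for j
        using bij_betw_inv_into_left[OF u] that by (simp add: f'_def)
      have "(\<Sum>w\<in>W. of_int (b e w) * f' w) = 0" if e: "e \<in> B" for e
      proof -
        obtain i where "i < n" "e = g i"
          using e g by (auto simp: bij_betw_def)
        then show ?thesis using f by (simp add: sum_u f'u)
      qed
      then have "f' (u j) = 0" using nd ui[OF j] unfolding nondeg_def by blast
      then show "f j = 0" using f'u j by simp
    qed
  next
    assume *: "\<forall>f. (\<forall>i<n. (\<Sum>j<n. real_of_int (b (g i) (u j)) * f j) = 0) \<longrightarrow> (\<forall>j<n. f j = 0)"
    show "nondeg W b B"
      unfolding nondeg_def
    proof (intro allI impI ballI)
      fix f :: "'b \<Rightarrow> real" and w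
      assume f: "\<forall>e\<in>B. (\<Sum>w\<in>W. real_of_int (b e w) * f w) = 0" and w: "w \<in> W"
      have "\<forall>i<n. (\<Sum>j<n. real_of_int (b (g i) (u j)) * f (u j)) = 0"
        using f gi by (simp add: sum_u)
      then have "\<forall>j<n. f (u j) = 0" using *[rule_format, of "\<lambda>j. f (u j)"] by blast
      then show "f w = 0" using w u by (auto simp: bij_betw_def)
    qed
  }
qed

text \<open>Nondegeneracy speaks of real vectors and the count of solutions concerns integers modulo
  2; the two meet in the integer determinant. Squaring removes the sign, which depends on the
  enumerations.\<close>

lemma light_minor:
  assumes g: "bij_betw g {..<n} B" and u: "bij_betw u {..<n} W"
    and norm: "\<And>e. e \<in> B \<Longrightarrow> (\<Sum>w\<in>W. \<bar>b e w\<bar>) \<le> 2"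
  shows "(fdet n (\<lambda>i j. real_of_int (b (g i) (u j))))\<^sup>2 =
    (if nondeg W b B then (real (card (parity_sets W b B)))\<^sup>2 else 0)"
proof (cases "nondeg W b B")
  case True
  have inj: "inj_on u S" if "S \<subseteq> {..<n}" for S
    using u that by (auto simp: bij_betw_def intro: inj_on_subset)
  have "fdet n (\<lambda>i j. b (g i) (u j)) \<noteq> 0"
    using True nondeg_iff_fdet[OF g u, of b] fdet_of_int[of n "\<lambda>i j. b (g i) (u j)", where 'a=real] by auto
  then have "\<bar>fdet n (\<lambda>i j. b (g i) (u j))\<bar> =
      int (card {S. S \<subseteq> {..<n} \<and> (\<forall>i<n. even (\<Sum>j\<in>S. b (g i) (u j)))})"
  proof (rule abs_fdet_light[rotated])
    fix i assume "i < n"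
    then have "g i \<in> B" using bij_betw_apply[OF g, of i] by simp
    then show "(\<Sum>j<n. \<bar>b (g i) (u j)\<bar>) \<le> 2"
      using norm[of "g i"] sum.reindex_bij_betw[OF u, of "\<lambda>w. \<bar>b (g i) w\<bar>"] by simp
  qed
  also have "card {S. S \<subseteq> {..<n} \<and> (\<forall>i<n. even (\<Sum>j\<in>S. b (g i) (u j)))} = card (parity_sets W b B)"
  proof (rule bij_betw_same_card)
    have im: "(\<Sum>w\<in>u ` S. b e w) = (\<Sum>j\<in>S. b e (u j))" if "S \<subseteq> {..<n}" for S e
      by (simp add: sum.reindex[OF inj[OF that]])
    have "inj_on (image u) {S. S \<subseteq> {..<n} \<and> (\<forall>i<n. even (\<Sum>j\<in>S. b (g i) (u j)))}"
      using inj[of "{..<n}"] by (auto intro!: inj_onI dest: inj_on_image_eq_iff)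
    moreover have "image u ` {S. S \<subseteq> {..<n} \<and> (\<forall>i<n. even (\<Sum>j\<in>S. b (g i) (u j)))} = parity_sets W b B"
    proof (intro equalityI image_subsetI subsetI)
      fix S assume "S \<in> {S. S \<subseteq> {..<n} \<and> (\<forall>i<n. even (\<Sum>j\<in>S. b (g i) (u j)))}"
      then show "u ` S \<in> parity_sets W b B"
        using g u by (auto simp: parity_sets_def im bij_betw_def)
    next
      fix T assume T: "T \<in> parity_sets W b B"
      then have "T \<subseteq> u ` {..<n}" using u by (auto simp: parity_sets_def bij_betw_def)
      then obtain S where S: "S \<subseteq> {..<n}" "T = u ` S" by (auto simp: subset_image_iff)
      have "even (\<Sum>j\<in>S. b (g i) (u j))" if "i < n" for i
      proof -
        have "g i \<in> B" using bij_betw_apply[OF g, of i] that by simp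
        then have "even (\<Sum>w\<in>T. b (g i) w)" using T by (auto simp: parity_sets_def)
        then show ?thesis using im[OF S(1), of "g i"] by (simp only: S(2))
      qed
      then show "T \<in> image u ` {S. S \<subseteq> {..<n} \<and> (\<forall>i<n. even (\<Sum>j\<in>S. b (g i) (u j)))}"
        using S by blast
    qed
    ultimately show "bij_betw (image u) {S. S \<subseteq> {..<n} \<and> (\<forall>i<n. even (\<Sum>j\<in>S. b (g i) (u j)))} (parity_sets W b B)"
      by (simp add: bij_betw_def)
  qed
  finally have "\<bar>fdet n (\<lambda>i j. real_of_int (b (g i) (u j)))\<bar> = real (card (parity_sets W b B))"
    unfolding fdet_of_int by linarith
  then show ?thesis
    using True by (metis power2_abs)
next
  case False
  then show ?thesis
    using nondeg_iff_fdet[OF g u, of b] by simp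
qed

text \<open>A square system with trivial kernel is solvable for every right-hand side. Well-chosen
  right-hand sides later rule out cycles and separate the components of the dilation
  subgraph.\<close>

lemma nondeg_solve:
  assumes "nondeg W b B" "card B = card W" "finite W" "finite B"
  shows "\<exists>f. \<forall>e\<in>B. (\<Sum>w\<in>W. of_int (b e w) * f w) = (y e :: real)"
proof -
  obtain u where u: "bij_betw u {..<card W} W"
    using \<open>finite W\<close> by (metis ex_bij_betw_nat_finite lessThan_atLeast0)
  obtain g where g: "bij_betw g {..<card W} B"
    using \<open>finite B\<close> \<open>card B = card W\<close> by (metis ex_bij_betw_nat_finite lessThan_atLeast0)
  obtain f where f: "\<forall>i<card W. (\<Sum>j<card W. real_of_int (b (g i) (u j)) * f j) = y (g i)"
    using fdet_solve[of "card W" "\<lambda>i j. real_of_int (b (g i) (u j))" "\<lambda>i. y (g i)"]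
      nondeg_iff_fdet[OF g u, of b] assms(1) by blast
  define f' where "f' w = f (inv_into {..<card W} u w)" for w
  have f'u: "f' (u j) = f j" if "j < card W" for j
    using bij_betw_inv_into_left[OF u] that by (simp add: f'_def)
  have "(\<Sum>w\<in>W. of_int (b e w) * f' w) = y e" if e: "e \<in> B" for e
  proof -
    obtain i where i: "i < card W" "e = g i"
      using e g by (auto simp: bij_betw_def)
    have "(\<Sum>w\<in>W. of_int (b e w) * f' w) = (\<Sum>j<card W. of_int (b e (u j)) * f' (u j))"
      by (rule sum.reindex_bij_betw[OF u, symmetric])
    also have "\<dots> = y e" using f i by (simp add: f'u)
    finally show ?thesis .
  qed
  then show ?thesis by blast
qed

lemma gram_light:
  assumes E: "finite E"
    and norm: "\<And>e. e \<in> E \<Longrightarrow> (\<Sum>w\<in>W. \<bar>b e w\<bar>) \<le> 2"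
    and u: "bij_betw u {..<n} W"
  shows "fdet n (\<lambda>i j. \<Sum>e\<in>E. x e * real_of_int (b e (u i)) * real_of_int (b e (u j))) =
    (\<Sum>B | B \<subseteq> E \<and> card B = n \<and> nondeg W b B. (\<Prod>e\<in>B. x e) * (real (card (parity_sets W b B)))\<^sup>2)"
proof -
  \<comment> \<open>Any enumeration will do: reordering the rows changes the minor by a sign
    only.\<close>
  define g where "g B = (SOME g. bij_betw g {0..<n} B)" for B :: "'a set"
  have g: "bij_betw (g B) {0..<n} B" if "B \<subseteq> E" "card B = n" for B
  proof -
    have "finite B" using that E finite_subset by blast
    then have "\<exists>g. bij_betw g {0..<n} B" using ex_bij_betw_nat_finite[of B] that by simp
    then show ?thesis unfolding g_def by (rule someI_ex)
  qed
  have "fdet n (\<lambda>i j. \<Sum>e\<in>E. x e * real_of_int (b e (u i)) * real_of_int (b e (u j))) =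
      (\<Sum>B | B \<subseteq> E \<and> card B = n. (\<Prod>e\<in>B. x e) * (fdet n (\<lambda>i j. real_of_int (b (g B i) (u j))))\<^sup>2)"
    by (rule cauchy_binet_gram[OF E g])
  also have "\<dots> = (\<Sum>B | B \<subseteq> E \<and> card B = n.
      if nondeg W b B then (\<Prod>e\<in>B. x e) * (real (card (parity_sets W b B)))\<^sup>2 else 0)"
  proof (rule sum.cong[OF refl])
    fix B assume "B \<in> {B. B \<subseteq> E \<and> card B = n}"
    then have "bij_betw (g B) {..<n} B" "\<And>e. e \<in> B \<Longrightarrow> (\<Sum>w\<in>W. \<bar>b e w\<bar>) \<le> 2"
      using g norm by (auto simp: lessThan_atLeast0)
    from light_minor[where b = b, OF this(1) u this(2)]
    show "(\<Prod>e\<in>B. x e) * (fdet n (\<lambda>i j. real_of_int (b (g B i) (u j))))\<^sup>2 =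
        (if nondeg W b B then (\<Prod>e\<in>B. x e) * (real (card (parity_sets W b B)))\<^sup>2 else 0)"
      by simp
  qed
  also have "\<dots> = (\<Sum>B | B \<subseteq> E \<and> card B = n \<and> nondeg W b B.
      (\<Prod>e\<in>B. x e) * (real (card (parity_sets W b B)))\<^sup>2)"
    using E by (subst sum.inter_filter[symmetric]) (auto simp: conj_assoc intro: finite_subset[of _ "Pow E"])
  finally show ?thesis .
qed

text \<open>With \<open>A\<close> the matrix of \<open>s\<close> and \<open>G\<close> the Gram
  matrix of \<open>b\<close>, both sides are \<open>det A\<close> squared times
  \<open>det G\<close>. Writing the first factor as the determinant of \<open>A\<close> times its
  transpose spares computing \<open>det A\<close> itself, whose sign depends on
  \<open>u\<close>.\<close>

lemma gram_congruence:
  fixes b :: "'e \<Rightarrow> 'w \<Rightarrow> 'a::comm_ring_1"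
  assumes u: "bij_betw u {..<n} W"
  shows "fdet n (\<lambda>i j. \<Sum>w\<in>W. s i w * s j w) * fdet n (\<lambda>i j. \<Sum>e\<in>E. y e * b e (u i) * b e (u j)) =
    fdet n (\<lambda>i j. \<Sum>e\<in>E. y e * (\<Sum>w\<in>W. s i w * b e w) * (\<Sum>w\<in>W. s j w * b e w))"
proof -
  let ?A = "\<lambda>i k. s i (u k)" and ?G = "\<lambda>i j. \<Sum>e\<in>E. y e * b e (u i) * b e (u j)"
  have sum_u: "(\<Sum>w\<in>W. h w) = (\<Sum>j<n. h (u j))" for h :: "'w \<Rightarrow> 'a"
    by (rule sum.reindex_bij_betw[OF u, symmetric])
  have "fdet n (\<lambda>i j. \<Sum>k<n. ?A i k * ?A j k) = fdet n ?A * fdet n ?A"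
    using fdet_mult[of n ?A "\<lambda>k j. ?A j k"] fdet_transpose[of n ?A] by simp
  moreover have "fdet n (\<lambda>i j. \<Sum>k<n. (\<Sum>l<n. ?A i l * ?G l k) * ?A j k) = fdet n ?A * fdet n ?G * fdet n ?A"
    using fdet_mult[of n "\<lambda>i k. \<Sum>l<n. ?A i l * ?G l k" "\<lambda>k j. ?A j k"] fdet_mult[of n ?A ?G]
      fdet_transpose[of n ?A] by simp
  moreover have "(\<Sum>k<n. (\<Sum>l<n. ?A i l * ?G l k) * ?A j k) =
      (\<Sum>e\<in>E. y e * (\<Sum>w\<in>W. s i w * b e w) * (\<Sum>w\<in>W. s j w * b e w))" for i j
  proof -
    have eq: "(\<Sum>l<n. ?A i l * ?G l k) = (\<Sum>e\<in>E. y e * (\<Sum>l<n. ?A i l * b e (u l)) * b e (u k))" for k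
    proof -
      have "(\<Sum>l<n. ?A i l * ?G l k) = (\<Sum>l<n. \<Sum>e\<in>E. y e * (?A i l * b e (u l)) * b e (u k))"
        by (simp add: sum_distrib_left ac_simps)
      also have "\<dots> = (\<Sum>e\<in>E. \<Sum>l<n. y e * (?A i l * b e (u l)) * b e (u k))"
        by (rule sum.swap)
      finally show ?thesis by (simp add: sum_distrib_left sum_distrib_right)
    qed
    have "(\<Sum>k<n. (\<Sum>l<n. ?A i l * ?G l k) * ?A j k) =
        (\<Sum>k<n. \<Sum>e\<in>E. y e * (\<Sum>l<n. ?A i l * b e (u l)) * (?A j k * b e (u k)))"
      unfolding eq sum_distrib_right by (intro sum.cong refl) (simp only: ac_simps)
    also have "\<dots> = (\<Sum>e\<in>E. \<Sum>k<n. y e * (\<Sum>l<n. ?A i l * b e (u l)) * (?A j k * b e (u k)))"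
      by (rule sum.swap)
    finally show ?thesis by (simp add: sum_u sum_distrib_left)
  qed
  ultimately show ?thesis
    by (simp add: sum_u mult.assoc mult.left_commute)
qed

section \<open>Graphs and the matrix-tree theorem\<close>

text \<open>These are the unions of connected components. Counting them turns numbers of components
  into exponents of 2, which can be compared with numbers of solutions modulo 2.\<close>

definition closed_sets :: "('v, 'h, 'z) hgraph_scheme \<Rightarrow> 'v set set" where
  "closed_sets G = {T. T \<subseteq> verts G \<and> (\<forall>h\<in>hedges G. root G h \<in> T \<longleftrightarrow> root G (opp G h) \<in> T)}"

lemma adj_closed:
  assumes "(u, v) \<in> (adj G)\<^sup>*" and "\<forall>h\<in>hedges G. P (root G h) \<longleftrightarrow> P (root G (opp G h))"
  shows "P u \<longleftrightarrow> P v"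
  using assms(1) by (induction rule: rtrancl_induct) (use assms(2) in \<open>auto simp: adj_def\<close>)

lemma adj_const:
  assumes "(u, v) \<in> (adj G)\<^sup>*" and "\<And>h. h \<in> hedges G \<Longrightarrow> f (root G h) = f (root G (opp G h))"
  shows "f u = f v"
  using assms(1) by (induction rule: rtrancl_induct) (use assms(2) in \<open>auto simp: adj_def\<close>)

text \<open>The dilation subgraph may be empty, so it need not satisfy \<open>half_edge_graph\<close>.\<close>

locale half_edge_subgraph =
  fixes G :: "('v, 'h, 'z) hgraph_scheme"
  assumes fin_verts: "finite (verts G)"
    and root_verts: "h \<in> hedges G \<Longrightarrow> root G h \<in> verts G"
    and opp_hedges: "h \<in> hedges G \<Longrightarrow> opp G h \<in> hedges G"
    and opp_invol: "h \<in> hedges G \<Longrightarrow> opp G (opp G h) = h"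
begin

lemma sym_adj: "sym (adj G)"
proof (rule symI)
  fix u v assume "(u, v) \<in> adj G"
  then obtain h where "h \<in> hedges G" "u = root G h" "v = root G (opp G h)"
    by (auto simp: adj_def)
  then show "(v, u) \<in> adj G"
    using opp_hedges[of h] opp_invol[of h] by (auto simp: adj_def intro!: exI[of _ "opp G h"])
qed

lemma equiv_conn: "equiv (verts G) (conn_rel G)"
proof (rule equivI)
  show "refl_on (verts G) (conn_rel G)" by (auto simp: refl_on_def conn_rel_def)
  show "sym (conn_rel G)"
    using sym_rtrancl[OF sym_adj] by (auto simp: sym_def conn_rel_def)
  show "trans (conn_rel G)" by (auto simp: trans_def conn_rel_def)
qed (auto simp: conn_rel_def)

lemma card_components: "card (components G) = card (verts G // conn_rel G)"
proof -
  have "inj_on (subgraph_on G) X" for X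
  proof (rule inj_onI)
    fix A B assume "subgraph_on G A = subgraph_on G B"
    then have "verts (subgraph_on G A) = verts (subgraph_on G B)" by simp
    then show "A = B" by (simp add: subgraph_on_def)
  qed
  then show ?thesis by (simp add: components_def card_image)
qed

text \<open>A closed set contains with each vertex its whole class, so taking unions matches sets of
  classes with closed sets.\<close>

lemma card_closed_sets: "card (closed_sets G) = 2 ^ card (components G)"
proof -
  let ?Q = "verts G // conn_rel G"
  have finQ: "finite ?Q" using fin_verts by (rule finite_quotient) (auto simp: conn_rel_def)
  have sub: "c \<subseteq> verts G" if "c \<in> ?Q" for c
    using that by (auto simp: quotient_def conn_rel_def)
  have adjQ: "u \<in> c \<longleftrightarrow> v \<in> c" if "c \<in> ?Q" "(u, v) \<in> conn_rel G" for u v c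
    using that equiv_conn by (metis equiv_class_eq_iff quotient_eq_iff equiv_class_self in_quotient_imp_closed symE equivE)
  have "bij_betw Union (Pow ?Q) (closed_sets G)"
  proof (rule bij_betw_byWitness[where f' = "\<lambda>T. {c \<in> ?Q. c \<subseteq> T}"])
    show "\<forall>X\<in>Pow ?Q. {c \<in> ?Q. c \<subseteq> \<Union>X} = X"
    proof (intro ballI equalityI subsetI)
      fix X c assume X: "X \<in> Pow ?Q" and c: "c \<in> {c \<in> ?Q. c \<subseteq> \<Union>X}"
      then obtain u where u: "u \<in> c" using in_quotient_imp_non_empty[OF equiv_conn] by blast
      then obtain d where d: "d \<in> X" "u \<in> d" using c by blast
      have "c = d"
        using quotient_disj[OF equiv_conn, of c d] X c d u by blast
      then show "c \<in> X" using d by simp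
    qed auto
    show "\<forall>T\<in>closed_sets G. \<Union>{c \<in> ?Q. c \<subseteq> T} = T"
    proof (intro ballI equalityI subsetI)
      fix T u assume T: "T \<in> closed_sets G" and u: "u \<in> T"
      then have uV: "u \<in> verts G" by (auto simp: closed_sets_def)
      have "conn_rel G `` {u} \<subseteq> T"
      proof
        fix v assume "v \<in> conn_rel G `` {u}"
        then have "(u, v) \<in> (adj G)\<^sup>*" by (simp add: conn_rel_def)
        then show "v \<in> T"
          using adj_closed[of u v G "\<lambda>w. w \<in> T"] T u by (auto simp: closed_sets_def)
      qed
      moreover have "conn_rel G `` {u} \<in> ?Q" using uV by (rule quotientI)
      moreover have "u \<in> conn_rel G `` {u}" using uV by (simp add: conn_rel_def)
      ultimately show "u \<in> \<Union>{c \<in> ?Q. c \<subseteq> T}" by blast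
    qed auto
    show "Union ` Pow ?Q \<subseteq> closed_sets G"
    proof (rule image_subsetI)
      fix X assume X: "X \<in> Pow ?Q"
      have "root G h \<in> \<Union>X \<longleftrightarrow> root G (opp G h) \<in> \<Union>X" if h: "h \<in> hedges G" for h
      proof -
        have "(root G h, root G (opp G h)) \<in> conn_rel G"
          using root_verts opp_hedges h by (auto simp: conn_rel_def adj_def)
        then show ?thesis using adjQ X by blast
      qed
      moreover have "\<Union>X \<subseteq> verts G" using X sub by blast
      ultimately show "\<Union>X \<in> closed_sets G" by (simp only: closed_sets_def mem_Collect_eq) blast
    qed
    show "(\<lambda>T. {c \<in> ?Q. c \<subseteq> T}) ` closed_sets G \<subseteq> Pow ?Q" by auto
  qed
  then have "card (closed_sets G) = card (Pow ?Q)" by (metis bij_betw_same_card)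
  then show ?thesis using finQ by (simp add: card_Pow card_components)
qed

end

section \<open>Incidence matrices and spanning trees\<close>

definition half_edge_of :: "'h set \<Rightarrow> 'h" where
  "half_edge_of e = (SOME h. h \<in> e)"

text \<open>The chosen half-edge orients the edge; the other choice would negate the row, which
  affects neither kernels nor products of two entries. A loop has a zero row.\<close>

definition incidence :: "('v, 'h, 'z) hgraph_scheme \<Rightarrow> 'h set \<Rightarrow> 'v \<Rightarrow> int" where
  "incidence G e v = of_bool (root G (opp G (half_edge_of e)) = v) - of_bool (root G (half_edge_of e) = v)"

context half_edge_graph
begin

sublocale half_edge_subgraph
  by unfold_locales (auto simp: finite_verts root_in opp_in opp_opp)

lemma finite_edges: "finite (edges G)"
  by (simp add: edges_def finite_hedges)

lemma half_edge_of_edge: "h \<in> hedges G \<Longrightarrow> half_edge_of (edge_of G h) \<in> {h, opp G h}"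
  unfolding half_edge_of_def edge_of_def by (rule someI_ex) auto

lemma edge_of_opp: "h \<in> hedges G \<Longrightarrow> edge_of G (opp G h) = edge_of G h"
  by (auto simp: edge_of_def opp_opp)

lemma half_edge_of_in:
  assumes "e \<in> edges G"
  shows "half_edge_of e \<in> hedges G" "edge_of G (half_edge_of e) = e"
proof -
  obtain h where h: "h \<in> hedges G" "e = edge_of G h" using assms by (auto simp: edges_def)
  then show "half_edge_of e \<in> hedges G" "edge_of G (half_edge_of e) = e"
    using half_edge_of_edge[OF h(1)] opp_in[OF h(1)] edge_of_opp[OF h(1)] by (metis insertE singletonD)+
qed

lemma edge_of_fibre:
  assumes "h0 \<in> hedges G"
  shows "{h \<in> hedges G. edge_of G h = edge_of G h0} = {h0, opp G h0}"
  using assms opp_in[of h0] edge_of_opp[of h0] by (auto simp: edge_of_def)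

text \<open>Sums over edges involve a chosen orientation, which a covering map need not respect.
  Half-edges need no choice, so all comparisons between cover and base pass through them.\<close>

lemma sum_hedges:
  fixes f :: "'h \<Rightarrow> 'a::comm_semiring_1"
  assumes "\<And>h. h \<in> hedges G \<Longrightarrow> f (opp G h) = f h"
  shows "(\<Sum>h\<in>hedges G. f h) = 2 * (\<Sum>e\<in>edges G. f (half_edge_of e))"
proof -
  have "(\<Sum>h\<in>hedges G. f h) = (\<Sum>e\<in>edges G. \<Sum>h | h \<in> hedges G \<and> edge_of G h = e. f h)"
    unfolding edges_def by (rule sum.image_gen[OF finite_hedges])
  also have "\<dots> = (\<Sum>e\<in>edges G. 2 * f (half_edge_of e))"
  proof (rule sum.cong[OF refl])
    fix e assume e: "e \<in> edges G"
    let ?h = "half_edge_of e"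
    have "{h \<in> hedges G. edge_of G h = e} = {?h, opp G ?h}"
      using edge_of_fibre[of ?h] half_edge_of_in[OF e] by simp
    then show "(\<Sum>h | h \<in> hedges G \<and> edge_of G h = e. f h) = 2 * f ?h"
      using half_edge_of_in[OF e] opp_neq[of ?h] assms[of ?h] by (auto simp: mult_2)
  qed
  finally show ?thesis by (simp add: sum_distrib_left)
qed

lemma hedges_del:
  assumes "B \<subseteq> edges G"
  shows "hedges (del_edges G (edges G - B)) = {h \<in> hedges G. edge_of G h \<in> B}"
proof -
  have "h \<in> \<Union>(edges G - B) \<longleftrightarrow> edge_of G h \<notin> B" if h: "h \<in> hedges G" for h
  proof
    assume "h \<in> \<Union>(edges G - B)"
    then obtain e where e: "e \<in> edges G" "e \<notin> B" "h \<in> e" by blast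
    then obtain h0 where "h0 \<in> hedges G" "e = edge_of G h0" by (auto simp: edges_def)
    then have "e = edge_of G h" using e(3) edge_of_opp[of h0] by (auto simp: edge_of_def)
    then show "edge_of G h \<notin> B" using e by simp
  next
    assume "edge_of G h \<notin> B"
    then show "h \<in> \<Union>(edges G - B)" using h by (auto simp: edges_def edge_of_def)
  qed
  then show ?thesis by (auto simp: del_edges_def)
qed

lemma del_edges_simps [simp]:
  "verts (del_edges G C) = verts G" "root (del_edges G C) = root G" "opp (del_edges G C) = opp G"
  "edge_of (del_edges G C) = edge_of G"
  by (auto simp: del_edges_def edge_of_def)

lemma sum_incidence:
  fixes f :: "'v \<Rightarrow> real"
  assumes "e \<in> edges G"
  shows "(\<Sum>v\<in>verts G. of_int (incidence G e v) * f v) =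
    f (root G (opp G (half_edge_of e))) - f (root G (half_edge_of e))"
proof -
  have "root G (opp G (half_edge_of e)) \<in> verts G" "root G (half_edge_of e) \<in> verts G"
    using half_edge_of_in[OF assms] root_in opp_in by auto
  then show ?thesis
    using finite_verts by (simp add: incidence_def left_diff_distrib sum_subtractf)
qed

lemma incidence_norm:
  assumes "e \<in> edges G"
  shows "(\<Sum>v\<in>verts G. \<bar>incidence G e v\<bar>) \<le> 2"
proof -
  have "(\<Sum>v\<in>verts G. \<bar>incidence G e v\<bar>) \<le> (\<Sum>v\<in>verts G.
      of_bool (root G (opp G (half_edge_of e)) = v) + of_bool (root G (half_edge_of e) = v))"
    by (rule sum_mono) (simp add: incidence_def)
  also have "\<dots> \<le> 2"
    using finite_verts by (simp add: sum.distrib of_bool_def del: sum_of_bool_eq)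
  finally show ?thesis .
qed

text \<open>The edge sets of spanning trees: with one edge fewer than vertices, connectedness
  already forces acyclicity, which \<open>spanning_acyclic\<close> derives.\<close>

definition spanning :: "'h set set \<Rightarrow> bool" where
  "spanning B \<longleftrightarrow> B \<subseteq> edges G \<and> card B + 1 = card (verts G) \<and> connected_graph (del_edges G (edges G - B))"

text \<open>Incidence vectors together with one further linear functional \<open>c\<close>, indexed by \<open>None\<close>.\<close>

definition grounded :: "('v \<Rightarrow> int) \<Rightarrow> 'h set option \<Rightarrow> 'v \<Rightarrow> int" where
  "grounded c eo = (case eo of None \<Rightarrow> c | Some e \<Rightarrow> incidence G e)"

lemma grounded_simps [simp]: "grounded c None = c" "grounded c (Some e) = incidence G e"
  by (simp_all add: grounded_def)

lemma incidence_zero_iff: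
  fixes f :: "'v \<Rightarrow> real"
  assumes B: "B \<subseteq> edges G"
  shows "(\<forall>e\<in>B. (\<Sum>v\<in>verts G. of_int (incidence G e v) * f v) = 0) \<longleftrightarrow>
    (\<forall>h\<in>hedges (del_edges G (edges G - B)). f (root G h) = f (root G (opp G h)))"
proof -
  have "(\<Sum>v\<in>verts G. of_int (incidence G (edge_of G h) v) * f v) = 0 \<longleftrightarrow> f (root G h) = f (root G (opp G h))"
    if "h \<in> hedges G" for h
    using sum_incidence[of "edge_of G h" f] that half_edge_of_edge[OF that] opp_opp[OF that]
    by (auto simp: edges_def)
  moreover have "\<exists>h\<in>hedges G. e = edge_of G h" if "e \<in> B" for e
    using B that by (auto simp: edges_def)
  ultimately show ?thesis
    unfolding hedges_del[OF B] by blast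
qed

text \<open>The incidence rows in \<open>B\<close> cut out the functions that are constant on
  components. If there is a single component, a functional with nonzero total forces the constant to
  be zero; if there are more, some nonzero combination satisfies one further equation.\<close>

lemma nondeg_grounded_iff:
  assumes B: "B \<subseteq> edges G" and s: "(\<Sum>v\<in>verts G. c v) \<noteq> 0"
  shows "nondeg (verts G) (grounded c) (insert None (Some ` B)) \<longleftrightarrow> connected_graph (del_edges G (edges G - B))"
    (is "?nd \<longleftrightarrow> connected_graph ?G")
proof
  assume conn: "connected_graph ?G"
  show ?nd
    unfolding nondeg_def
  proof (intro allI impI ballI)
    fix f :: "'v \<Rightarrow> real" and w
    assume f: "\<forall>e\<in>insert None (Some ` B). (\<Sum>v\<in>verts G. of_int (grounded c e v) * f v) = 0"
      and w: "w \<in> verts G"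
    have step: "f (root ?G h) = f (root ?G (opp ?G h))" if "h \<in> hedges ?G" for h
      using f incidence_zero_iff[OF B, of f] that by simp
    have "f v = f w" if "v \<in> verts G" for v
    proof (rule adj_const[of v w ?G f, OF _ step])
      show "(v, w) \<in> (adj ?G)\<^sup>*"
        using conn that w by (auto simp: connected_graph_def conn_rel_def)
    qed
    then have "(\<Sum>v\<in>verts G. of_int (c v) * f v) = (\<Sum>v\<in>verts G. of_int (c v) * f w)"
      by (intro sum.cong) simp_all
    also have "\<dots> = of_int (\<Sum>v\<in>verts G. c v) * f w"
      by (simp add: sum_distrib_right)
    finally have "(\<Sum>v\<in>verts G. real_of_int (c v)) * f w = 0" using f by simp
    moreover have "(\<Sum>v\<in>verts G. real_of_int (c v)) \<noteq> 0"
      using s by (metis of_int_sum of_int_eq_0_iff)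
    ultimately show "f w = 0" by simp
  qed
next
  assume nd: ?nd
  show "connected_graph ?G"
    unfolding connected_graph_def
  proof (intro conjI ballI)
    show "verts ?G \<noteq> {}" using verts_nonempty by simp
    fix u w assume "u \<in> verts ?G" "w \<in> verts ?G"
    then have uw: "u \<in> verts G" "w \<in> verts G" by simp_all
    show "(u, w) \<in> conn_rel ?G"
    proof (rule ccontr)
      assume nc: "(u, w) \<notin> conn_rel ?G"
      define A where "A = {v \<in> verts G. (u, v) \<in> (adj ?G)\<^sup>*}"
      have uA: "u \<in> A" and wA: "w \<notin> A" using uw nc by (auto simp: A_def conn_rel_def)
      define \<alpha> where "\<alpha> = (\<Sum>v\<in>verts G - A. c v)"
      define \<beta> where "\<beta> = (\<Sum>v\<in>A. c v)"
      have AV: "A \<subseteq> verts G" by (auto simp: A_def)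
      have tot: "\<alpha> + \<beta> = (\<Sum>v\<in>verts G. c v)"
        unfolding \<alpha>_def \<beta>_def using sum.subset_diff[OF AV finite_verts, of c] by simp
      \<comment> \<open>The two values are chosen so that the weighted sums over \<open>A\<close>
        and over its complement cancel. They are not both zero, because \<alpha> + \<beta> is the
        nonzero total of \<open>c\<close>.\<close>
      define f where "f v = (if v \<in> A then real_of_int \<alpha> else - real_of_int \<beta>)" for v
      have "root G h \<in> A \<longleftrightarrow> root G (opp G h) \<in> A" if h: "h \<in> hedges ?G" for h
      proof -
        have hG: "h \<in> hedges G" using h hedges_del[OF B] by simp
        have 1: "(root G h, root G (opp G h)) \<in> adj ?G" using h by (auto simp: adj_def)
        have "opp G h \<in> hedges ?G" using h hedges_del[OF B] opp_in edge_of_opp by auto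
        then have 2: "(root G (opp G h), root G h) \<in> adj ?G"
          using opp_opp[OF hG] by (auto simp: adj_def intro!: exI[of _ "opp G h"])
        show ?thesis
          using root_in[OF hG] root_in[OF opp_in[OF hG]] 1 2
          by (auto simp: A_def intro: rtrancl_into_rtrancl)
      qed
      then have "\<forall>e\<in>B. (\<Sum>v\<in>verts G. of_int (incidence G e v) * f v) = 0"
        unfolding incidence_zero_iff[OF B] by (auto simp: f_def)
      moreover have "(\<Sum>v\<in>verts G. of_int (c v) * f v) = 0"
      proof -
        have "(\<Sum>v\<in>verts G. of_int (c v) * f v) =
            (\<Sum>v\<in>verts G - A. of_int (c v) * f v) + (\<Sum>v\<in>A. of_int (c v) * f v)"
          by (rule sum.subset_diff[OF AV finite_verts])
        also have "(\<Sum>v\<in>verts G - A. of_int (c v) * f v) = - (real_of_int \<alpha> * real_of_int \<beta>)"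
          by (simp add: f_def \<alpha>_def sum_distrib_right sum_negf)
        also have "(\<Sum>v\<in>A. of_int (c v) * f v) = real_of_int \<beta> * real_of_int \<alpha>"
          by (simp add: f_def \<beta>_def sum_distrib_right)
        finally show ?thesis by simp
      qed
      ultimately have "\<forall>v\<in>verts G. f v = 0"
        using nd unfolding nondeg_def by simp
      then have "f u = 0" "f w = 0" using uw by blast+
      then show False using uA wA tot s by (simp add: f_def)
    qed
  qed
qed

text \<open>The constant function 1 satisfies every incidence equation, so only the grounding row
  can exclude it.\<close>

lemma nondeg_imp_None:
  assumes "nondeg (verts G) (grounded c) B" "B \<subseteq> insert None (Some ` edges G)"
  shows "None \<in> B"
proof (rule ccontr)
  assume "None \<notin> B"
  have "(\<Sum>v\<in>verts G. of_int (grounded c e v) * (1::real)) = 0" if eB: "e \<in> B" for e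
  proof -
    obtain e' where "e = Some e'" "e' \<in> edges G" using eB assms(2) \<open>None \<notin> B\<close> by auto
    then show ?thesis using sum_incidence[of e' "\<lambda>_. 1"] by simp
  qed
  then have "\<forall>w\<in>verts G. (1::real) = 0"
    using assms(1) unfolding nondeg_def by (elim allE[of _ "\<lambda>_. 1"]) simp
  then show False using verts_nonempty by auto
qed

text \<open>Modulo 2 the incidence rows say that a set is closed, which in a connected graph leaves
  the empty set and the whole vertex set. The latter passes the grounding row iff the total of
  \<open>c\<close> is even, so a total of 1 gives one solution and a total of 2 gives two.\<close>

lemma card_parity_sets_grounded:
  assumes B: "B \<subseteq> edges G" and conn: "connected_graph (del_edges G (edges G - B))"
    and s: "(\<Sum>v\<in>verts G. c v) = 1 \<or> (\<Sum>v\<in>verts G. c v) = 2"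
  shows "int (card (parity_sets (verts G) (grounded c) (insert None (Some ` B)))) = (\<Sum>v\<in>verts G. c v)"
proof -
  let ?G = "del_edges G (edges G - B)"
  let ?P = "parity_sets (verts G) (grounded c) (insert None (Some ` B))"
  have inc: "(\<Sum>v\<in>S. incidence G e v) =
      of_bool (root G (opp G (half_edge_of e)) \<in> S) - of_bool (root G (half_edge_of e) \<in> S)"
    if "S \<subseteq> verts G" for S e
    using finite_subset[OF that finite_verts]
    by (auto simp: incidence_def sum_subtractf of_bool_def)
  have sub: "S = {} \<or> S = verts G" if S: "S \<in> ?P" for S
  proof (rule ccontr)
    assume "\<not> ?thesis"
    moreover have SV: "S \<subseteq> verts G" using S by (simp add: parity_sets_def)
    ultimately obtain u w where uw: "u \<in> S" "w \<in> verts G" "w \<notin> S" by blast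
    have "root ?G h \<in> S \<longleftrightarrow> root ?G (opp ?G h) \<in> S" if h: "h \<in> hedges ?G" for h
    proof -
      have h: "h \<in> hedges G" "edge_of G h \<in> B" using h hedges_del[OF B] by auto
      then have "even (\<Sum>v\<in>S. incidence G (edge_of G h) v)"
        using S by (auto simp: parity_sets_def)
      then show ?thesis
        unfolding inc[OF SV] using half_edge_of_edge[OF h(1)] opp_opp[OF h(1)]
        by (auto simp: of_bool_def split: if_splits)
    qed
    moreover have "(u, w) \<in> (adj ?G)\<^sup>*"
      using conn uw SV by (auto simp: connected_graph_def conn_rel_def)
    ultimately show False
      using adj_closed[of u w ?G "\<lambda>v. v \<in> S"] uw by blast
  qed
  have empty: "{} \<in> ?P" by (auto simp: parity_sets_def)
  have full: "verts G \<in> ?P \<longleftrightarrow> even (\<Sum>v\<in>verts G. c v)"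
  proof -
    have "even (\<Sum>v\<in>verts G. incidence G e v)" if "e \<in> B" for e
      using inc[of "verts G" e] half_edge_of_in[of e] root_in opp_in that B by auto
    then show ?thesis by (auto simp: parity_sets_def)
  qed
  show ?thesis
  proof (cases "even (\<Sum>v\<in>verts G. c v)")
    case True
    then have "?P = {{}, verts G}" using sub empty full by blast
    then show ?thesis using s True verts_nonempty by auto
  next
    case False
    have "?P = {{}}" using False sub empty full by blast
    then have "card ?P = card {{} :: 'v set}" by (rule arg_cong)
    then have "card ?P = 1" by simp
    moreover have "(\<Sum>v\<in>verts G. c v) = 1" using s False by (metis even_numeral)
    ultimately show ?thesis by linarith
  qed
qed

text \<open>Matrix-tree theorem with a rank-one grounding term in place of a deleted row and column.
  Every nondegenerate choice of rows consists of the grounding row and a spanning tree, and its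
  minor is the total of \<open>c\<close> up to sign. Nonnegative coefficients with total 1 or 2 keep
  the grounding row within the norm bound of \<open>gram_light\<close>.\<close>

lemma matrix_tree:
  assumes u: "bij_betw u {..<card (verts G)} (verts G)"
    and c: "\<And>v. v \<in> verts G \<Longrightarrow> c v \<ge> 0"
    and s: "(\<Sum>v\<in>verts G. c v) = 1 \<or> (\<Sum>v\<in>verts G. c v) = 2"
  shows "fdet (card (verts G)) (\<lambda>i j.
      (\<Sum>e\<in>edges G. x e * real_of_int (incidence G e (u i)) * real_of_int (incidence G e (u j))) +
      y * real_of_int (c (u i)) * real_of_int (c (u j))) =
    y * (of_int (\<Sum>v\<in>verts G. c v))\<^sup>2 * (\<Sum>B | spanning B. \<Prod>e\<in>B. x e)"
proof -
  let ?V = "verts G" and ?b = "grounded c"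
  let ?n = "card ?V" and ?E = "insert None (Some ` edges G)" and ?s = "\<Sum>v\<in>verts G. c v"
  define x' where "x' eo = (case eo of None \<Rightarrow> y | Some e \<Rightarrow> x e)" for eo
  have finE: "finite ?E" using finite_edges by simp
  have "fdet ?n (\<lambda>i j. (\<Sum>e\<in>edges G. x e * real_of_int (incidence G e (u i)) * real_of_int (incidence G e (u j))) +
        y * real_of_int (c (u i)) * real_of_int (c (u j))) =
      fdet ?n (\<lambda>i j. \<Sum>e\<in>?E. x' e * real_of_int (?b e (u i)) * real_of_int (?b e (u j)))"
    using finite_edges by (intro fdet_cong) (simp add: x'_def sum.reindex)
  also have "\<dots> = (\<Sum>B | B \<subseteq> ?E \<and> card B = ?n \<and> nondeg ?V ?b B. (\<Prod>e\<in>B. x' e) * (real (card (parity_sets ?V ?b B)))\<^sup>2)"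
  proof (rule gram_light[OF finE _ u])
    fix e assume "e \<in> ?E"
    then consider "e = None" | e' where "e = Some e'" "e' \<in> edges G" by auto
    then show "(\<Sum>v\<in>?V. \<bar>?b e v\<bar>) \<le> 2"
    proof cases
      case 1
      have "(\<Sum>v\<in>?V. \<bar>c v\<bar>) = ?s" using c by (intro sum.cong) auto
      then show ?thesis using 1 s by auto
    next
      case 2
      then show ?thesis using incidence_norm by simp
    qed
  qed
  also have "\<dots> = (\<Sum>B | spanning B. y * (of_int ?s)\<^sup>2 * (\<Prod>e\<in>B. x e))"
  proof (rule sum.reindex_bij_witness[of _ "\<lambda>B. insert None (Some ` B)" "\<lambda>B. Some -` B"])
    fix B assume "B \<in> {B. B \<subseteq> ?E \<and> card B = ?n \<and> nondeg ?V ?b B}"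
    then have B: "B \<subseteq> ?E" "card B = ?n" "nondeg ?V ?b B" by auto
    have N: "None \<in> B" using nondeg_imp_None[OF B(3,1)] .
    show eq: "insert None (Some ` (Some -` B)) = B"
      using N B(1) by auto
    have sub: "Some -` B \<subseteq> edges G" using B(1) by auto
    have fin: "finite (Some -` B)" using sub finite_edges finite_subset by blast
    have "card B = card (insert None (Some ` (Some -` B)))" by (simp only: eq)
    also have "\<dots> = card (Some -` B) + 1" using fin by (simp add: card_image del: image_vimage_eq)
    finally have cd: "card (Some -` B) + 1 = ?n" using B(2) by simp
    have conn: "connected_graph (del_edges G (edges G - Some -` B))"
      using nondeg_grounded_iff[OF sub, of c] B(3) s eq by auto
    then show "Some -` B \<in> {B. spanning B}" using cd sub by (simp add: spanning_def)
    have "(\<Prod>e\<in>B. x' e) = (\<Prod>e\<in>insert None (Some ` (Some -` B)). x' e)" by (simp only: eq)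
    also have "\<dots> = y * (\<Prod>e\<in>Some -` B. x e)"
      using fin by (simp add: x'_def prod.reindex del: image_vimage_eq)
    finally have pr: "(\<Prod>e\<in>B. x' e) = y * (\<Prod>e\<in>Some -` B. x e)" .
    have "int (card (parity_sets ?V ?b B)) = ?s"
      using card_parity_sets_grounded[OF sub conn s] eq by simp
    then have "real (card (parity_sets ?V ?b B)) = of_int ?s" by linarith
    then show "y * (of_int ?s)\<^sup>2 * (\<Prod>e\<in>Some -` B. x e) = (\<Prod>e\<in>B. x' e) * (real (card (parity_sets ?V ?b B)))\<^sup>2"
      using pr by simp
  next
    fix B assume "B \<in> {B. spanning B}"
    then have B: "B \<subseteq> edges G" "card B + 1 = ?n" "connected_graph (del_edges G (edges G - B))"
      by (auto simp: spanning_def)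
    show "Some -` insert None (Some ` B) = B" by auto
    have "finite B" using B(1) finite_edges finite_subset by blast
    then have "card (insert None (Some ` B)) = ?n" using B(2) by (simp add: card_image)
    then show "insert None (Some ` B) \<in> {B. B \<subseteq> ?E \<and> card B = ?n \<and> nondeg ?V ?b B}"
      using B nondeg_grounded_iff[OF B(1), of c] s by auto
  qed
  finally show ?thesis by (simp add: sum_distrib_left)
qed

text \<open>
  A cycle would make the incidence vectors of \<open>B\<close> dependent: a potential that jumps along
  exactly one of its edges cannot return to its initial value.
\<close>

lemma spanning_acyclic:
  assumes "spanning B"
  shows "\<not> is_cycle (del_edges G (edges G - B)) hs"
proof
  let ?G = "del_edges G (edges G - B)"
  assume cyc: "is_cycle ?G hs"
  have B: "B \<subseteq> edges G" "card B + 1 = card (verts G)" "connected_graph ?G"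
    using assms by (auto simp: spanning_def)
  have finB: "finite B" using B(1) finite_edges finite_subset by blast
  obtain v0 where v0: "v0 \<in> verts G" using verts_nonempty by blast
  define c :: "'v \<Rightarrow> int" where "c v = of_bool (v = v0)" for v
  have "(\<Sum>v\<in>verts G. c v) \<noteq> 0" using v0 finite_verts by (simp add: c_def of_bool_def)
  then have "nondeg (verts G) (grounded c) (insert None (Some ` B))"
    using nondeg_grounded_iff[OF B(1), of c] B(3) by blast
  moreover have "card (insert None (Some ` B)) = card (verts G)"
    using B(2) finB by (simp add: card_image)
  ultimately obtain f where
    f: "\<forall>e\<in>insert None (Some ` B). (\<Sum>v\<in>verts G. of_int (grounded c e v) * f v) =
      (of_bool (e = Some (edge_of G (hs ! 0))) :: real)"
    using nondeg_solve[of "verts G" "grounded c" "insert None (Some ` B)"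
        "\<lambda>e. of_bool (e = Some (edge_of G (hs ! 0)))"] finB finite_verts by auto
  let ?m = "length hs" and ?d = "\<lambda>i. f (root G (opp G (hs ! i))) - f (root G (hs ! i))"
  have hs: "hs \<noteq> []" "set hs \<subseteq> hedges ?G" "distinct (map (edge_of G) hs)"
    "\<And>i. i < ?m \<Longrightarrow> root G (opp G (hs ! i)) = root G (hs ! ((i + 1) mod ?m))"
    using cyc by (auto simp: is_cycle_def)
  \<comment> \<open>Only the absolute value is known, since the cycle may run through an edge
    against its chosen orientation.\<close>
  have d: "\<bar>?d i\<bar> = of_bool (i = 0)" if i: "i < ?m" for i
  proof -
    let ?h = "hs ! i"
    have h: "?h \<in> hedges G" "edge_of G ?h \<in> B"
    proof -
      have "?h \<in> hedges ?G" using hs(2) nth_mem[OF i] by blast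
      then show "?h \<in> hedges G" "edge_of G ?h \<in> B" using hedges_del[OF B(1)] by auto
    qed
    have "f (root G (opp G (half_edge_of (edge_of G ?h)))) - f (root G (half_edge_of (edge_of G ?h))) =
        of_bool (edge_of G ?h = edge_of G (hs ! 0))"
      using bspec[OF f, of "Some (edge_of G ?h)"] h(2) sum_incidence[of "edge_of G ?h" f] B(1)
      by (simp add: subset_iff)
    moreover have "edge_of G ?h = edge_of G (hs ! 0) \<longleftrightarrow> i = 0"
      using hs(1,3) i nth_eq_iff_index_eq[OF hs(3), of i 0] by auto
    ultimately show ?thesis
      using half_edge_of_edge[OF h(1)] opp_opp[OF h(1)] by auto
  qed
  obtain k where k: "?m = Suc k" using hs(1) by (cases hs) auto
  \<comment> \<open>Each edge ends where the next one starts, so the increments of the potential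
    cancel around the cycle, although exactly one of them is nonzero.\<close>
  have "(\<Sum>i<?m. ?d i) = (\<Sum>i<?m. f (root G (hs ! ((i + 1) mod ?m)))) - (\<Sum>i<?m. f (root G (hs ! i)))"
    using hs(4) by (simp add: sum_subtractf)
  also have "(\<Sum>i<?m. f (root G (hs ! ((i + 1) mod ?m)))) = (\<Sum>i<k. f (root G (hs ! Suc i))) + f (root G (hs ! 0))"
    unfolding k by simp
  also have "\<dots> = (\<Sum>i<?m. f (root G (hs ! i)))"
    unfolding k sum.lessThan_Suc_shift by simp
  finally have "(\<Sum>i<?m. ?d i) = 0" by simp
  moreover have "(\<Sum>i<?m. ?d i) = ?d 0"
  proof -
    have "?d i = 0" if "i < ?m" "i \<noteq> 0" for i
      using d[OF that(1)] that(2) by simp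
    then have "(\<Sum>i\<in>{0}. ?d i) = (\<Sum>i<?m. ?d i)"
      by (intro sum.mono_neutral_left) (auto simp: k)
    then show ?thesis by simp
  qed
  ultimately show False using d[of 0] k by simp
qed

end

text \<open>A set of genus-many edges has a complement with one edge fewer than there are vertices.
  Dividing by the product of all lengths turns the lengths of the removed edges into the
  conductances of the tree.\<close>

lemma (in metric_graph) jacobian_poly_eq:
  "jacobian_poly G = (\<Prod>e\<in>edges G. len G e) * (\<Sum>B | spanning B. \<Prod>e\<in>B. 1 / len G e)"
proof -
  have "jacobian_poly G = (\<Sum>B | spanning B. (\<Prod>e\<in>edges G. len G e) * (\<Prod>e\<in>B. 1 / len G e))"
    unfolding jacobian_poly_def
  proof (rule sum.reindex_bij_witness[of _ "\<lambda>B. edges G - B" "\<lambda>C. edges G - C"])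
    fix C assume "C \<in> {C. C \<subseteq> edges G \<and> int (card C) = genus G \<and> is_tree (del_edges G C)}"
    then have C: "C \<subseteq> edges G" "int (card C) = genus G" "is_tree (del_edges G C)" by auto
    have CC: "edges G - (edges G - C) = C" using C(1) by auto
    then show "edges G - (edges G - C) = C" .
    have "card (edges G - C) + card C = card (edges G)"
      using C(1) finite_edges by (metis card_Diff_subset card_mono finite_subset le_add_diff_inverse2)
    then show "edges G - C \<in> {B. spanning B}"
      using C CC by (auto simp: spanning_def genus_def is_tree_def)
    have split: "(\<Prod>e\<in>edges G. len G e) = (\<Prod>e\<in>edges G - C. len G e) * (\<Prod>e\<in>C. len G e)"
      by (rule prod.subset_diff[OF C(1) finite_edges])
    have inv: "(\<Prod>e\<in>edges G - C. len G e) * (\<Prod>e\<in>edges G - C. 1 / len G e) = 1"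
      unfolding prod.distrib[symmetric] by (rule prod.neutral) (use len_pos in force)
    have "(\<Prod>e\<in>edges G. len G e) * (\<Prod>e\<in>edges G - C. 1 / len G e) =
        ((\<Prod>e\<in>edges G - C. len G e) * (\<Prod>e\<in>edges G - C. 1 / len G e)) * (\<Prod>e\<in>C. len G e)"
      unfolding split by (simp only: ac_simps)
    also have "\<dots> = (\<Prod>e\<in>C. len G e)"
      unfolding inv by simp
    finally show "(\<Prod>e\<in>edges G. len G e) * (\<Prod>e\<in>edges G - C. 1 / len G e) = (\<Prod>e\<in>C. len G e)" .
  next
    fix B assume "B \<in> {B. spanning B}"
    then have sp: "spanning B" and B: "B \<subseteq> edges G" "card B + 1 = card (verts G)"
      "connected_graph (del_edges G (edges G - B))" by (auto simp: spanning_def)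
    show "edges G - (edges G - B) = B" using B(1) by auto
    have "card (edges G - B) + card B = card (edges G)"
      using B(1) finite_edges by (metis card_Diff_subset card_mono finite_subset le_add_diff_inverse2)
    then show "edges G - B \<in> {C. C \<subseteq> edges G \<and> int (card C) = genus G \<and> is_tree (del_edges G C)}"
      using B spanning_acyclic[OF sp] by (auto simp: genus_def is_tree_def)
  qed
  then show ?thesis by (simp add: sum_distrib_left)
qed

section \<open>The Laplacian of a double cover\<close>

lemma sum_pos_eq_2:
  fixes f :: "'a \<Rightarrow> nat"
  assumes "finite A" "\<And>a. a \<in> A \<Longrightarrow> f a > 0" "(\<Sum>a\<in>A. f a) = 2"
  obtains (single) a where "A = {a}" "f a = 2" | (pair) a b where "a \<noteq> b" "A = {a, b}" "f a = 1" "f b = 1"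
proof -
  have "card A * 1 \<le> (\<Sum>a\<in>A. f a)"
    using sum_bounded_below[of A 1 f] assms(2) by (simp add: Suc_le_eq)
  then consider "card A = 0" | "card A = 1" | "card A = 2" using assms(3) by linarith
  then show ?thesis
  proof cases
    case 1
    then show ?thesis using assms(1,3) by simp
  next
    case 2
    then obtain a where "A = {a}" by (auto simp: card_1_singleton_iff)
    then show ?thesis using assms(3) by (intro single) auto
  next
    case 3
    then obtain a b where "a \<noteq> b" "A = {a, b}" by (auto simp: card_2_iff)
    moreover have "f a = 1" "f b = 1"
      using assms(2)[of a] assms(2)[of b] assms(3) calculation by auto
    ultimately show ?thesis by (intro pair)
  qed
qed

lemma fdet_diag:
  fixes a :: "nat \<Rightarrow> nat \<Rightarrow> 'a::idom"
  assumes "\<And>i j. i < n \<Longrightarrow> j < n \<Longrightarrow> i \<noteq> j \<Longrightarrow> a i j = 0"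
  shows "fdet n a = (\<Prod>i<n. a i i)"
  using assms
proof (induction n)
  case (Suc n)
  have "fdet (n + 1) a = fdet n a * fdet 1 (\<lambda>i j. a (n + i) (n + j))"
    by (rule fdet_block) (use Suc.prems in auto)
  then show ?case using Suc by simp
qed simp

context double_cover
begin

sublocale S: metric_graph "src p" by (rule src_metric)
sublocale T: metric_graph "tgt p" by (rule tgt_metric)

definition vfib :: "'v \<Rightarrow> 'w set" where
  "vfib v = {w \<in> verts (src p). vmap p w = v}"

definition hfib :: "'h \<Rightarrow> 'k set" where
  "hfib h = {k \<in> hedges (src p). hmap p k = h}"

lemma finite_vfib: "finite (vfib v)" and finite_hfib: "finite (hfib h)"
  using S.finite_verts S.finite_hedges by (auto simp: vfib_def hfib_def)

lemma hdeg_pos: "k \<in> hedges (src p) \<Longrightarrow> hdeg p k > 0"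
  unfolding hdeg_def by (rule edeg_pos) (simp add: edges_def)

lemma hdeg_opp: "k \<in> hedges (src p) \<Longrightarrow> hdeg p (opp (src p) k) = hdeg p k"
  by (simp add: hdeg_def S.edge_of_opp)

lemma vfib_cases:
  assumes "v \<in> verts (tgt p)"
  obtains (dil) w where "v \<in> dilated_verts p" "vfib v = {w}" "vdeg p w = 2"
  | (und) w w' where "v \<notin> dilated_verts p" "w \<noteq> w'" "vfib v = {w, w'}" "vdeg p w = 1" "vdeg p w' = 1"
proof -
  have 1: "v \<in> dilated_verts p \<longleftrightarrow> card (vfib v) = 1"
    using assms by (simp add: dilated_verts_def vfib_def)
  have pos: "vdeg p w > 0" if "w \<in> vfib v" for w
    using that by (simp add: vfib_def vdeg_pos)
  have sum: "(\<Sum>w\<in>vfib v. vdeg p w) = 2"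
    using vertex_degree[OF assms] by (simp add: vfib_def)
  show ?thesis
  proof (rule sum_pos_eq_2[OF finite_vfib pos sum])
    fix w assume "vfib v = {w}" "vdeg p w = 2"
    then show ?thesis using 1 by (intro dil) auto
  next
    fix w w' assume "w \<noteq> w'" "vfib v = {w, w'}" "vdeg p w = 1" "vdeg p w' = 1"
    then show ?thesis using 1 und[of w w'] by auto
  qed
qed

lemma emap_edge_of: "k \<in> hedges (src p) \<Longrightarrow> emap p (edge_of (src p) k) = edge_of (tgt p) (hmap p k)"
  by (simp add: emap_def edge_of_def opp_hmap)

text \<open>The two halves of an edge upstairs never lie over the same half-edge, because the
  involution downstairs has no fixed point; this includes loops. Dilation, defined by counting
  edges, can thus be read off from half-edges, where the degree conditions live.\<close>

lemma edge_fibre_bij: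
  assumes h: "h \<in> hedges (tgt p)"
  shows "bij_betw (edge_of (src p)) (hfib h) {e' \<in> edges (src p). emap p e' = edge_of (tgt p) h}"
  unfolding bij_betw_def
proof
  show "inj_on (edge_of (src p)) (hfib h)"
  proof (rule inj_onI)
    fix k k' assume k: "k \<in> hfib h" "k' \<in> hfib h" and eq: "edge_of (src p) k = edge_of (src p) k'"
    then have kin: "k \<in> hedges (src p)" "hmap p k = h" "hmap p k' = h" by (auto simp: hfib_def)
    have "k' = k \<or> k' = opp (src p) k" using eq by (auto simp: edge_of_def doubleton_eq_iff)
    moreover have "hmap p (opp (src p) k) \<noteq> h"
      using opp_hmap[OF kin(1)] T.opp_neq[OF h] kin by simp
    ultimately show "k = k'" using kin by auto
  qed
  show "edge_of (src p) ` hfib h = {e' \<in> edges (src p). emap p e' = edge_of (tgt p) h}"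
  proof (intro equalityI image_subsetI subsetI)
    fix k assume "k \<in> hfib h"
    then show "edge_of (src p) k \<in> {e' \<in> edges (src p). emap p e' = edge_of (tgt p) h}"
      by (auto simp: hfib_def edges_def emap_edge_of)
  next
    fix e' assume "e' \<in> {e' \<in> edges (src p). emap p e' = edge_of (tgt p) h}"
    then obtain k where k: "k \<in> hedges (src p)" "e' = edge_of (src p) k"
      "edge_of (tgt p) (hmap p k) = edge_of (tgt p) h"
      by (auto simp: edges_def emap_edge_of)
    then consider "hmap p k = h" | "hmap p k = opp (tgt p) h"
      by (auto simp: edge_of_def doubleton_eq_iff)
    then show "e' \<in> edge_of (src p) ` hfib h"
    proof cases
      case 1
      then show ?thesis using k by (auto simp: hfib_def)
    next
      case 2
      then have "opp (src p) k \<in> hfib h"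
        using k opp_hmap[OF k(1)] T.opp_opp[OF h] S.opp_in by (auto simp: hfib_def)
      then show ?thesis using k S.edge_of_opp by (metis image_eqI)
    qed
  qed
qed

lemma card_edge_fibre:
  assumes "h \<in> hedges (tgt p)"
  shows "card {e' \<in> edges (src p). emap p e' = edge_of (tgt p) h} = card (hfib h)"
  using edge_fibre_bij[OF assms] by (simp add: bij_betw_same_card)

lemma hfib_cases:
  assumes "h \<in> hedges (tgt p)"
  obtains (dil) k where "edge_of (tgt p) h \<in> dilated_edges p" "hfib h = {k}" "hdeg p k = 2"
  | (und) k k' where "edge_of (tgt p) h \<notin> dilated_edges p" "k \<noteq> k'" "hfib h = {k, k'}" "hdeg p k = 1" "hdeg p k' = 1"
proof -
  have 1: "edge_of (tgt p) h \<in> dilated_edges p \<longleftrightarrow> card (hfib h) = 1"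
    using card_edge_fibre[OF assms] assms by (simp add: dilated_edges_def edges_def)
  have pos: "hdeg p k > 0" if "k \<in> hfib h" for k
    using that by (simp add: hfib_def hdeg_pos)
  have sum: "(\<Sum>k\<in>hfib h. hdeg p k) = 2"
    using hedge_degree[OF assms] by (simp add: hfib_def)
  show ?thesis
  proof (rule sum_pos_eq_2[OF finite_hfib pos sum])
    fix k assume "hfib h = {k}" "hdeg p k = 2"
    then show ?thesis using 1 by (intro dil) auto
  next
    fix k k' assume "k \<noteq> k'" "hfib h = {k, k'}" "hdeg p k = 1" "hdeg p k' = 1"
    then show ?thesis using 1 und[of k k'] by auto
  qed
qed

text \<open>Grouping the lifts of \<open>h\<close> by their roots makes the inner sums of degrees
  those of the local degree condition. With \<phi> the sheet function this yields the cancellation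
  behind the antisymmetric block.\<close>

lemma sum_hfib_root:
  fixes \<phi> :: "'w \<Rightarrow> 'a::comm_semiring_1"
  assumes h: "h \<in> hedges (tgt p)"
  shows "(\<Sum>k\<in>hfib h. of_nat (hdeg p k) * \<phi> (root (src p) k)) =
    (\<Sum>w\<in>vfib (root (tgt p) h). of_nat (vdeg p w) * \<phi> w)"
proof -
  have "(\<Sum>k\<in>hfib h. of_nat (hdeg p k) * \<phi> (root (src p) k)) =
      (\<Sum>w\<in>vfib (root (tgt p) h). \<Sum>k | k \<in> hfib h \<and> root (src p) k = w. of_nat (hdeg p k) * \<phi> (root (src p) k))"
    by (rule sum.group[OF finite_hfib finite_vfib, symmetric]) (auto simp: hfib_def vfib_def root_hmap S.root_in)
  also have "\<dots> = (\<Sum>w\<in>vfib (root (tgt p) h). of_nat (vdeg p w) * \<phi> w)"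
  proof (rule sum.cong[OF refl])
    fix w assume w: "w \<in> vfib (root (tgt p) h)"
    have "vdeg p w = (\<Sum>k | k \<in> hfib h \<and> root (src p) k = w. hdeg p k)"
      using local_degree[of w h] h w by (simp add: vfib_def hfib_def conj_ac)
    then show "(\<Sum>k | k \<in> hfib h \<and> root (src p) k = w. of_nat (hdeg p k) * \<phi> (root (src p) k)) =
        of_nat (vdeg p w) * \<phi> w"
      by (simp add: sum_distrib_right)
  qed
  finally show ?thesis .
qed

text \<open>An arbitrary labelling of each undilated fibre by 1 and -1. Restricted to one fibre it
  spans the antisymmetric functions there; the value 0 reflects that a one-point fibre carries
  none.\<close>

definition sheet :: "'w \<Rightarrow> int" where
  "sheet w = (if vmap p w \<in> dilated_verts p then 0
     else if w = (SOME w'. w' \<in> vfib (vmap p w)) then 1 else - 1)"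

lemma sheet_dilated: "vmap p w \<in> dilated_verts p \<Longrightarrow> sheet w = 0"
  by (simp add: sheet_def)

lemma sheet_undilated: "vmap p w \<notin> dilated_verts p \<Longrightarrow> \<bar>sheet w\<bar> = 1"
  by (simp add: sheet_def)

lemma abs_sheet: "\<bar>sheet w\<bar> \<le> 1"
  by (simp add: sheet_def)

lemma sheet_swap:
  assumes "v \<in> verts (tgt p)" "v \<notin> dilated_verts p" "w \<in> vfib v" "w' \<in> vfib v" "w \<noteq> w'"
  shows "sheet w' = - sheet w"
  using assms(1)
proof (cases rule: vfib_cases)
  case (und a b)
  have "(SOME x. x \<in> vfib v) \<in> vfib v" by (rule someI_ex) (use und in auto)
  moreover have "vmap p w = v" "vmap p w' = v" using assms by (auto simp: vfib_def)
  ultimately show ?thesis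
    using und assms by (auto simp: sheet_def)
qed (use assms in auto)

lemma sum_sheet:
  assumes "v \<in> verts (tgt p)"
  shows "(\<Sum>w\<in>vfib v. sheet w) = 0" "(\<Sum>w\<in>vfib v. int (vdeg p w) * sheet w) = 0"
proof -
  have "(\<Sum>w\<in>vfib v. sheet w) = 0 \<and> (\<Sum>w\<in>vfib v. int (vdeg p w) * sheet w) = 0"
    using assms
  proof (cases rule: vfib_cases)
    case (dil w)
    then have "vmap p w = v" by (auto simp: vfib_def)
    then show ?thesis using dil by (simp add: sheet_dilated)
  next
    case (und a b)
    then show ?thesis using sheet_swap[of v a b] assms by auto
  qed
  then show "(\<Sum>w\<in>vfib v. sheet w) = 0" "(\<Sum>w\<in>vfib v. int (vdeg p w) * sheet w) = 0" by blast+
qed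

lemma sum_hfib_sheet:
  assumes "h \<in> hedges (tgt p)"
  shows "(\<Sum>k\<in>hfib h. int (hdeg p k) * sheet (root (src p) k)) = 0"
  using sum_hfib_root[OF assms, of sheet] sum_sheet(2)[of "root (tgt p) h"] T.root_in[OF assms] by simp

text \<open>The only lift of \<open>h\<close> has degree 2, so by the local degree condition its
  root has degree 2 as well and cannot lie in a two-point fibre. Hence the dilated vertices and
  edges form a subgraph.\<close>

lemma dilated_edge_root:
  assumes h: "h \<in> hedges (tgt p)" and d: "edge_of (tgt p) h \<in> dilated_edges p"
  shows "root (tgt p) h \<in> dilated_verts p"
  using h
proof (cases rule: hfib_cases)
  case (dil k)
  let ?w = "root (src p) k"
  have k: "k \<in> hedges (src p)" "hmap p k = h" using dil by (auto simp: hfib_def)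
  have w: "?w \<in> verts (src p)" "vmap p ?w = root (tgt p) h"
    using k root_hmap[OF k(1)] S.root_in by auto
  have "{k' \<in> hedges (src p). root (src p) k' = ?w \<and> hmap p k' = h} = {k}"
    using dil by (auto simp: hfib_def)
  then have deg: "vdeg p ?w = 2" using local_degree[OF w(1) h] w dil by simp
  show ?thesis
    using T.root_in[OF h]
  proof (cases rule: vfib_cases)
    case (und a b)
    moreover have "?w \<in> vfib (root (tgt p) h)" using w by (simp add: vfib_def)
    ultimately show ?thesis using deg by auto
  qed auto
qed (use d in auto)

definition lift :: "'h \<Rightarrow> 'k" where
  "lift h = (SOME k. k \<in> hfib h)"

lemma lift_in: "h \<in> hedges (tgt p) \<Longrightarrow> lift h \<in> hfib h"
proof -
  assume "h \<in> hedges (tgt p)"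
  then have "\<exists>k. k \<in> hfib h" by (cases rule: hfib_cases) auto
  then show ?thesis unfolding lift_def by (rule someI_ex)
qed

lemma hfibD: "k \<in> hfib h \<Longrightarrow> k \<in> hedges (src p) \<and> hmap p k = h"
  by (simp add: hfib_def)

lemma root_hfib: "k \<in> hfib h \<Longrightarrow> vmap p (root (src p) k) = root (tgt p) h"
  using root_hmap by (auto simp: hfib_def)

lemma opp_hfib: "k \<in> hfib h \<Longrightarrow> opp (src p) k \<in> hfib (opp (tgt p) h)"
  using opp_hmap S.opp_in by (auto simp: hfib_def)

text \<open>Both lifts have degree 1, so the weighted cancellation over the fibre of
  \<open>h\<close> is a plain one. It also covers a dilated root, where both values are 0.\<close>

lemma sheet_root_swap:
  assumes "h \<in> hedges (tgt p)" "k \<in> hfib h" "k' \<in> hfib h" "k \<noteq> k'"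
  shows "sheet (root (src p) k') = - sheet (root (src p) k)"
  using assms(1)
proof (cases rule: hfib_cases)
  case (und a b)
  then show ?thesis using sum_hfib_sheet[OF assms(1)] assms by auto
qed (use assms in auto)

text \<open>
  For an undilated edge this is, up to sign, the row of the antisymmetric part of the incidence
  matrix of the cover; the two lifts of the edge give opposite rows.
\<close>

definition anti_row :: "'k \<Rightarrow> 'v \<Rightarrow> int" where
  "anti_row k u = sheet (root (src p) (opp (src p) k)) * of_bool (vmap p (root (src p) (opp (src p) k)) = u)
     - sheet (root (src p) k) * of_bool (vmap p (root (src p) k) = u)"

lemma anti_row_opp: "k \<in> hedges (src p) \<Longrightarrow> anti_row (opp (src p) k) u = - anti_row k u"
  by (simp add: anti_row_def S.opp_opp)

lemma anti_row_swap:
  assumes h: "h \<in> hedges (tgt p)" and k: "k \<in> hfib h" "k' \<in> hfib h" "k \<noteq> k'"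
  shows "anti_row k' u = - anti_row k u"
proof -
  have ne: "opp (src p) k \<noteq> opp (src p) k'"
    using k S.opp_opp by (metis hfibD)
  have "sheet (root (src p) (opp (src p) k')) = - sheet (root (src p) (opp (src p) k))"
    using sheet_root_swap[OF T.opp_in[OF h] opp_hfib[OF k(1)] opp_hfib[OF k(2)] ne] .
  then show ?thesis
    using sheet_root_swap[OF h k] root_hfib[OF k(1)] root_hfib[OF k(2)]
      root_hfib[OF opp_hfib[OF k(1)]] root_hfib[OF opp_hfib[OF k(2)]]
    by (simp add: anti_row_def)
qed

lemma anti_row_prod:
  assumes "h \<in> hedges (tgt p)" "k \<in> hfib h"
  shows "anti_row k u * anti_row k u' = anti_row (lift h) u * anti_row (lift h) u'"
  using anti_row_swap[OF assms(1) lift_in[OF assms(1)] assms(2)] by (cases "k = lift h") auto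

lemma anti_row_dilated:
  assumes "h \<in> hedges (tgt p)" "k \<in> hfib h" "edge_of (tgt p) h \<in> dilated_edges p"
  shows "anti_row k u = 0"
proof -
  have "edge_of (tgt p) (opp (tgt p) h) \<in> dilated_edges p"
    using assms T.edge_of_opp by simp
  then have "root (tgt p) (opp (tgt p) h) \<in> dilated_verts p"
    by (rule dilated_edge_root[OF T.opp_in[OF assms(1)]])
  then show ?thesis
    using dilated_edge_root[OF assms(1,3)] root_hfib[OF assms(2)] root_hfib[OF opp_hfib[OF assms(2)]]
    by (simp add: anti_row_def sheet_dilated)
qed

text \<open>The degree-weighted sheets cancel at each end separately; the far end is handled by
  carrying the fibre over \<open>h\<close> to the fibre over its opposite. This is what makes the
  mixed block vanish.\<close>

lemma sum_anti_row:
  assumes "h \<in> hedges (tgt p)"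
  shows "(\<Sum>k\<in>hfib h. int (hdeg p k) * anti_row k u) = 0"
proof -
  let ?o = "opp (src p)"
  have bij: "bij_betw ?o (hfib h) (hfib (opp (tgt p) h))"
  proof (rule bij_betw_byWitness[where f' = ?o])
    show "?o ` hfib h \<subseteq> hfib (opp (tgt p) h)" using opp_hfib by auto
    show "?o ` hfib (opp (tgt p) h) \<subseteq> hfib h" using opp_hfib T.opp_opp[OF assms] by force
  qed (auto dest!: hfibD simp: S.opp_opp)
  have "(\<Sum>k\<in>hfib h. int (hdeg p k) * sheet (root (src p) (?o k))) =
      (\<Sum>k\<in>hfib h. int (hdeg p (?o k)) * sheet (root (src p) (?o k)))"
    by (intro sum.cong) (auto dest!: hfibD simp: hdeg_opp)
  also have "\<dots> = (\<Sum>k\<in>hfib (opp (tgt p) h). int (hdeg p k) * sheet (root (src p) k))"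
    by (rule sum.reindex_bij_betw[OF bij])
  also have "\<dots> = 0" by (rule sum_hfib_sheet[OF T.opp_in[OF assms]])
  finally have 1: "(\<Sum>k\<in>hfib h. int (hdeg p k) * sheet (root (src p) (?o k))) = 0" .
  have "(\<Sum>k\<in>hfib h. int (hdeg p k) * anti_row k u) =
      (\<Sum>k\<in>hfib h. int (hdeg p k) * sheet (root (src p) (?o k))) * of_bool (root (tgt p) (opp (tgt p) h) = u)
      - (\<Sum>k\<in>hfib h. int (hdeg p k) * sheet (root (src p) k)) * of_bool (root (tgt p) h = u)"
    unfolding sum_distrib_right sum_subtractf[symmetric]
    by (intro sum.cong) (auto simp: anti_row_def root_hfib root_hfib[OF opp_hfib] algebra_simps)
  then show ?thesis using 1 sum_hfib_sheet[OF assms] by simp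
qed

text \<open>In terms of conductances the length condition is linear: a lift of degree d carries d
  times the conductance of its image. The degree sums of the cover therefore apply directly to the
  Laplacian.\<close>

lemma len_src:
  assumes "k \<in> hedges (src p)"
  shows "1 / len (src p) (edge_of (src p) k) = real (hdeg p k) / len (tgt p) (edge_of (tgt p) (hmap p k))"
proof -
  have e: "edge_of (src p) k \<in> edges (src p)" using assms by (simp add: edges_def)
  show ?thesis
    using len_emap[OF e] S.len_pos[OF e] edeg_pos[OF e] emap_edge_of[OF assms]
    by (simp add: hdeg_def field_simps)
qed

text \<open>Common first step for all three blocks: a conductance-weighted sum over the cover
  becomes a sum over fibres with the degrees as weights. The factor 2 counts the two halves of an
  edge.\<close>

lemma sum_src_edges:
  assumes "\<And>k. k \<in> hedges (src p) \<Longrightarrow> f (opp (src p) k) = (f k :: real)"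
  shows "2 * (\<Sum>e\<in>edges (src p). 1 / len (src p) e * f (half_edge_of e)) =
    (\<Sum>h\<in>hedges (tgt p). 1 / len (tgt p) (edge_of (tgt p) h) * (\<Sum>k\<in>hfib h. real (hdeg p k) * f k))"
proof -
  have "2 * (\<Sum>e\<in>edges (src p). 1 / len (src p) e * f (half_edge_of e)) =
      2 * (\<Sum>e\<in>edges (src p). 1 / len (src p) (edge_of (src p) (half_edge_of e)) * f (half_edge_of e))"
    by (simp add: S.half_edge_of_in)
  also have "\<dots> = (\<Sum>k\<in>hedges (src p). 1 / len (src p) (edge_of (src p) k) * f k)"
    by (rule S.sum_hedges[symmetric]) (simp add: assms S.edge_of_opp)
  also have "\<dots> = (\<Sum>h\<in>hedges (tgt p). \<Sum>k | k \<in> hedges (src p) \<and> hmap p k = h.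
      1 / len (src p) (edge_of (src p) k) * f k)"
    by (rule sum.group[symmetric]) (auto simp: S.finite_hedges T.finite_hedges hmap_in)
  also have "\<dots> = (\<Sum>h\<in>hedges (tgt p). 1 / len (tgt p) (edge_of (tgt p) h) * (\<Sum>k\<in>hfib h. real (hdeg p k) * f k))"
    unfolding sum_distrib_left hfib_def by (intro sum.cong) (auto simp: len_src)
  finally show ?thesis .
qed

end

lemma prod_lessThan_add:
  fixes g :: "nat \<Rightarrow> 'a::comm_monoid_mult"
  shows "(\<Prod>i<n + m. g i) = (\<Prod>i<n. g i) * (\<Prod>i<m. g (n + i))"
  by (induction m) (simp_all add: mult.assoc)

context double_cover
begin

section \<open>Block form of the Laplacian of the cover\<close>

definition undilated_verts :: "'v set" where
  "undilated_verts = verts (tgt p) - dilated_verts p"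

definition undilated_edges :: "'h set set" where
  "undilated_edges = edges (tgt p) - dilated_edges p"

text \<open>Up to signs of rows and columns this is the incidence matrix of a signed graph: the
  relative sign at the two ends tells whether the lift changes sheets, an end at a dilated vertex
  contributes 0, and a loop that changes sheets has the single entry 2 or -2.\<close>

definition anti_inc :: "'h set \<Rightarrow> 'v \<Rightarrow> int" where
  "anti_inc e = anti_row (lift (half_edge_of e))"

lemma undilated_verts_sub: "undilated_verts \<subseteq> verts (tgt p)"
  and undilated_edges_sub: "undilated_edges \<subseteq> edges (tgt p)"
  by (auto simp: undilated_verts_def undilated_edges_def)

lemma finite_undilated: "finite undilated_verts" "finite undilated_edges"
  using T.finite_verts T.finite_edges by (auto simp: undilated_verts_def undilated_edges_def)

lemma card_vfib:
  assumes "v \<in> verts (tgt p)"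
  shows "card (vfib v) = (if v \<in> undilated_verts then 2 else 1)"
  using assms by (cases rule: vfib_cases) (use assms in \<open>auto simp: undilated_verts_def\<close>)

lemma sum_verts_src:
  fixes f :: "'w \<Rightarrow> 'a::comm_monoid_add"
  shows "(\<Sum>w\<in>verts (src p). f w) = (\<Sum>v\<in>verts (tgt p). \<Sum>w\<in>vfib v. f w)"
  unfolding vfib_def
  by (rule sum.group[symmetric]) (auto simp: S.finite_verts T.finite_verts vmap_in)

lemma card_verts_src: "card (verts (src p)) = card (verts (tgt p)) + card undilated_verts"
proof -
  have "card (verts (src p)) = (\<Sum>v\<in>verts (tgt p). 1 + of_bool (v \<in> undilated_verts))"
    using sum_verts_src[of "\<lambda>_. 1::nat"] by (simp add: card_vfib cong: sum.cong) (auto intro!: sum.cong)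
  also have "\<dots> = card (verts (tgt p)) + card undilated_verts"
    using undilated_verts_sub T.finite_verts by (subst sum.distrib) (simp add: Int_absorb1)
  finally show ?thesis .
qed

lemma sum_vfib:
  fixes f :: "'w \<Rightarrow> 'a::comm_semiring_1"
  shows "(\<Sum>w\<in>verts (src p). f w * of_bool (vmap p w = v)) = (\<Sum>w\<in>vfib v. f w)"
  unfolding vfib_def using S.finite_verts
  by (simp add: of_bool_def if_distrib[of "(*) _"] sum.inter_filter[symmetric] cong: if_cong)

lemma sum_inc_sym:
  assumes "e \<in> edges (src p)"
  shows "(\<Sum>w\<in>verts (src p). of_bool (vmap p w = v) * real_of_int (incidence (src p) e w)) =
    of_bool (vmap p (root (src p) (opp (src p) (half_edge_of e))) = v)
      - of_bool (vmap p (root (src p) (half_edge_of e)) = v)"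
  using S.sum_incidence[OF assms, of "\<lambda>w. of_bool (vmap p w = v)"] by (simp add: mult.commute)

lemma sum_inc_anti:
  assumes "e \<in> edges (src p)"
  shows "(\<Sum>w\<in>verts (src p). (real_of_int (sheet w) * of_bool (vmap p w = v)) * real_of_int (incidence (src p) e w)) =
    real_of_int (anti_row (half_edge_of e) v)"
  using S.sum_incidence[OF assms, of "\<lambda>w. real_of_int (sheet w) * of_bool (vmap p w = v)"]
  by (simp add: mult.commute anti_row_def)

lemma sum_hdeg: "h \<in> hedges (tgt p) \<Longrightarrow> (\<Sum>k\<in>hfib h. real (hdeg p k)) = 2"
  using hedge_degree[of h] unfolding hfib_def of_nat_sum[symmetric] by simp

text \<open>Every lift of a half-edge sees the same difference of a pulled-back function, so the
  degrees in its fibre add up to the factor 2.\<close>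

lemma gram_sym:
  "(\<Sum>e\<in>edges (src p). 1 / len (src p) e
      * (\<Sum>w\<in>verts (src p). of_bool (vmap p w = v) * real_of_int (incidence (src p) e w))
      * (\<Sum>w\<in>verts (src p). of_bool (vmap p w = v') * real_of_int (incidence (src p) e w))) =
    2 * (\<Sum>e\<in>edges (tgt p). 1 / len (tgt p) e * real_of_int (incidence (tgt p) e v) * real_of_int (incidence (tgt p) e v'))"
    (is "?L = 2 * ?R")
proof -
  define d :: "'k \<Rightarrow> 'v \<Rightarrow> real" where
    "d k v = of_bool (vmap p (root (src p) (opp (src p) k)) = v) - of_bool (vmap p (root (src p) k) = v)" for k v
  define d' :: "'h \<Rightarrow> 'v \<Rightarrow> real" where
    "d' h v = of_bool (root (tgt p) (opp (tgt p) h) = v) - of_bool (root (tgt p) h = v)" for h v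
  have dd': "d k v = d' h v" if "k \<in> hfib h" for k h v
    using root_hfib[OF that] root_hfib[OF opp_hfib[OF that]] by (simp add: d_def d'_def)
  have "2 * ?L = 2 * (\<Sum>e\<in>edges (src p). 1 / len (src p) e * (d (half_edge_of e) v * d (half_edge_of e) v'))"
    by (simp add: sum_inc_sym d_def mult.assoc cong: sum.cong)
  also have "\<dots> = (\<Sum>h\<in>hedges (tgt p). 1 / len (tgt p) (edge_of (tgt p) h) *
      (\<Sum>k\<in>hfib h. real (hdeg p k) * (d k v * d k v')))"
    by (rule sum_src_edges) (simp add: d_def S.opp_opp algebra_simps)
  also have "\<dots> = (\<Sum>h\<in>hedges (tgt p). 1 / len (tgt p) (edge_of (tgt p) h) * (2 * (d' h v * d' h v')))"
    by (intro sum.cong refl arg_cong2[of _ _ _ _ "(*)"]) (simp add: dd' sum_distrib_right[symmetric] sum_hdeg cong: sum.cong)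
  also have "\<dots> = 2 * (\<Sum>e\<in>edges (tgt p). 1 / len (tgt p) (edge_of (tgt p) (half_edge_of e)) *
      (2 * (d' (half_edge_of e) v * d' (half_edge_of e) v')))"
    by (rule T.sum_hedges) (simp add: d'_def T.opp_opp T.edge_of_opp algebra_simps)
  also have "\<dots> = 2 * (2 * ?R)"
    by (simp add: T.half_edge_of_in d'_def incidence_def sum_distrib_left ac_simps cong: sum.cong)
  finally show ?thesis by simp
qed

text \<open>The factor from the pullback is constant on the fibre of a half-edge and can be taken
  out; the remaining weighted sum of antisymmetric rows is zero.\<close>

lemma gram_mixed:
  "(\<Sum>e\<in>edges (src p). 1 / len (src p) e
      * (\<Sum>w\<in>verts (src p). (real_of_int (sheet w) * of_bool (vmap p w = u)) * real_of_int (incidence (src p) e w))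
      * (\<Sum>w\<in>verts (src p). of_bool (vmap p w = v) * real_of_int (incidence (src p) e w))) = 0"
    (is "?L = 0")
proof -
  define d :: "'k \<Rightarrow> real" where
    "d k = of_bool (vmap p (root (src p) (opp (src p) k)) = v) - of_bool (vmap p (root (src p) k) = v)" for k
  define d' :: "'h \<Rightarrow> real" where
    "d' h = of_bool (root (tgt p) (opp (tgt p) h) = v) - of_bool (root (tgt p) h = v)" for h
  have dd': "d k = d' h" if "k \<in> hfib h" for k h
    using root_hfib[OF that] root_hfib[OF opp_hfib[OF that]] by (simp add: d_def d'_def)
  have "2 * ?L = 2 * (\<Sum>e\<in>edges (src p). 1 / len (src p) e * (real_of_int (anti_row (half_edge_of e) u) * d (half_edge_of e)))"
  proof (intro arg_cong[of _ _ "(*) 2"] sum.cong refl)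
    fix e assume e: "e \<in> edges (src p)"
    show "1 / len (src p) e
        * (\<Sum>w\<in>verts (src p). (real_of_int (sheet w) * of_bool (vmap p w = u)) * real_of_int (incidence (src p) e w))
        * (\<Sum>w\<in>verts (src p). of_bool (vmap p w = v) * real_of_int (incidence (src p) e w)) =
      1 / len (src p) e * (real_of_int (anti_row (half_edge_of e) u) * d (half_edge_of e))"
      unfolding sum_inc_sym[OF e] sum_inc_anti[OF e] d_def by (rule mult.assoc)
  qed
  also have "\<dots> = (\<Sum>h\<in>hedges (tgt p). 1 / len (tgt p) (edge_of (tgt p) h) *
      (\<Sum>k\<in>hfib h. real (hdeg p k) * (real_of_int (anti_row k u) * d k)))"
    by (rule sum_src_edges) (simp add: d_def S.opp_opp anti_row_opp algebra_simps)
  also have "\<dots> = 0"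
  proof (rule sum.neutral, rule ballI)
    fix h assume h: "h \<in> hedges (tgt p)"
    have "(\<Sum>k\<in>hfib h. real (hdeg p k) * (real_of_int (anti_row k u) * d k)) =
        real_of_int (\<Sum>k\<in>hfib h. int (hdeg p k) * anti_row k u) * d' h"
      by (simp add: dd' sum_distrib_right mult.assoc cong: sum.cong)
    then show "1 / len (tgt p) (edge_of (tgt p) h) *
        (\<Sum>k\<in>hfib h. real (hdeg p k) * (real_of_int (anti_row k u) * d k)) = 0"
      unfolding sum_anti_row[OF h] by simp
  qed
  finally show ?thesis by simp
qed

text \<open>The rows of two lifts differ by a sign, which a product of two entries does not see, so
  again the degrees sum to 2. Dilated edges drop out because both their ends are dilated.\<close>

lemma gram_anti:
  "(\<Sum>e\<in>edges (src p). 1 / len (src p) e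
      * (\<Sum>w\<in>verts (src p). (real_of_int (sheet w) * of_bool (vmap p w = u)) * real_of_int (incidence (src p) e w))
      * (\<Sum>w\<in>verts (src p). (real_of_int (sheet w) * of_bool (vmap p w = u')) * real_of_int (incidence (src p) e w))) =
    2 * (\<Sum>e\<in>undilated_edges. 1 / len (tgt p) e * real_of_int (anti_inc e u) * real_of_int (anti_inc e u'))"
    (is "?L = 2 * ?R")
proof -
  define q where "q k = real_of_int (anti_row k u) * real_of_int (anti_row k u')" for k
  have qlift: "q k = q (lift h)" if "h \<in> hedges (tgt p)" "k \<in> hfib h" for k h
    unfolding q_def using anti_row_prod[OF that, of u u'] by (metis of_int_mult)
  have "2 * ?L = 2 * (\<Sum>e\<in>edges (src p). 1 / len (src p) e * q (half_edge_of e))"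
  proof (intro arg_cong[of _ _ "(*) 2"] sum.cong refl)
    fix e assume e: "e \<in> edges (src p)"
    show "1 / len (src p) e
        * (\<Sum>w\<in>verts (src p). (real_of_int (sheet w) * of_bool (vmap p w = u)) * real_of_int (incidence (src p) e w))
        * (\<Sum>w\<in>verts (src p). (real_of_int (sheet w) * of_bool (vmap p w = u')) * real_of_int (incidence (src p) e w)) =
      1 / len (src p) e * q (half_edge_of e)"
      unfolding sum_inc_anti[OF e] q_def by (rule mult.assoc)
  qed
  also have "\<dots> = (\<Sum>h\<in>hedges (tgt p). 1 / len (tgt p) (edge_of (tgt p) h) * (\<Sum>k\<in>hfib h. real (hdeg p k) * q k))"
    by (rule sum_src_edges) (simp add: q_def anti_row_opp)
  also have "\<dots> = (\<Sum>h\<in>hedges (tgt p). 1 / len (tgt p) (edge_of (tgt p) h) * (2 * q (lift h)))"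
  proof (intro sum.cong refl arg_cong2[of _ _ _ _ "(*)"])
    fix h assume h: "h \<in> hedges (tgt p)"
    have "(\<Sum>k\<in>hfib h. real (hdeg p k) * q k) = (\<Sum>k\<in>hfib h. real (hdeg p k) * q (lift h))"
      by (intro sum.cong) (use qlift[OF h] in auto)
    then show "(\<Sum>k\<in>hfib h. real (hdeg p k) * q k) = 2 * q (lift h)"
      using sum_hdeg[OF h] by (simp add: sum_distrib_right[symmetric])
  qed
  also have "\<dots> = 2 * (\<Sum>e\<in>edges (tgt p). 1 / len (tgt p) (edge_of (tgt p) (half_edge_of e)) * (2 * q (lift (half_edge_of e))))"
  proof (rule T.sum_hedges)
    fix h assume h: "h \<in> hedges (tgt p)"
    have "q (lift (opp (tgt p) h)) = q (opp (src p) (lift h))"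
      using qlift[OF T.opp_in[OF h] opp_hfib[OF lift_in[OF h]]] by simp
    also have "\<dots> = q (lift h)"
      using lift_in[OF h] by (auto dest!: hfibD simp: q_def anti_row_opp)
    finally show "1 / len (tgt p) (edge_of (tgt p) (opp (tgt p) h)) * (2 * q (lift (opp (tgt p) h))) =
        1 / len (tgt p) (edge_of (tgt p) h) * (2 * q (lift h))"
      using h by (simp add: T.edge_of_opp)
  qed
  also have "\<dots> = 2 * (\<Sum>e\<in>edges (tgt p). 2 * (1 / len (tgt p) e * real_of_int (anti_inc e u) * real_of_int (anti_inc e u')))"
    by (simp add: T.half_edge_of_in q_def anti_inc_def ac_simps cong: sum.cong)
  also have "(\<Sum>e\<in>edges (tgt p). 2 * (1 / len (tgt p) e * real_of_int (anti_inc e u) * real_of_int (anti_inc e u'))) =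
      (\<Sum>e\<in>undilated_edges. 2 * (1 / len (tgt p) e * real_of_int (anti_inc e u) * real_of_int (anti_inc e u')))"
  proof (rule sum.mono_neutral_right[OF T.finite_edges undilated_edges_sub], rule ballI)
    fix e assume "e \<in> edges (tgt p) - undilated_edges"
    then have e: "e \<in> edges (tgt p)" "e \<in> dilated_edges p" by (auto simp: undilated_edges_def)
    then have "anti_inc e u = 0"
      using anti_row_dilated[OF T.half_edge_of_in(1)[OF e(1)] lift_in] T.half_edge_of_in[OF e(1)]
      by (simp add: anti_inc_def)
    then show "2 * (1 / len (tgt p) e * real_of_int (anti_inc e u) * real_of_int (anti_inc e u')) = 0"
      by simp
  qed
  also have "2 * \<dots> = 2 * (2 * ?R)"
    by (simp only: sum_distrib_left)
  finally show ?thesis by simp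
qed

lemma anti_inc_norm: "(\<Sum>v\<in>undilated_verts. \<bar>anti_inc e v\<bar>) \<le> 2"
proof -
  let ?k = "lift (half_edge_of e)"
  let ?a = "vmap p (root (src p) (opp (src p) ?k))" and ?b = "vmap p (root (src p) ?k)"
  have "(\<Sum>v\<in>undilated_verts. \<bar>anti_inc e v\<bar>) \<le>
      (\<Sum>v\<in>undilated_verts. (if ?a = v then 1 else 0) + (if ?b = v then 1 else 0))"
  proof (rule sum_mono)
    fix v
    show "\<bar>anti_inc e v\<bar> \<le> (if ?a = v then 1 else 0) + (if ?b = v then 1 else 0)"
      using abs_sheet[of "root (src p) (opp (src p) ?k)"] abs_sheet[of "root (src p) ?k"]
      unfolding anti_inc_def anti_row_def by (auto simp: abs_le_iff)
  qed
  also have "\<dots> \<le> 2"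
    using finite_undilated by (simp add: sum.distrib)
  finally show ?thesis .
qed

text \<open>By \<open>gram_light\<close>, the determinant of the signed Laplacian on the undilated
  vertices with conductances \<open>1 / len\<close>.\<close>

definition prym_sum :: real where
  "prym_sum = (\<Sum>B | B \<subseteq> undilated_edges \<and> card B = card undilated_verts \<and> nondeg undilated_verts anti_inc B.
     (\<Prod>e\<in>B. 1 / len (tgt p) e) * (real (card (parity_sets undilated_verts anti_inc B)))\<^sup>2)"

text \<open>The grounded Laplacian of the cover is evaluated in a basis of fibre indicators and
  antisymmetric vectors, one for each undilated fibre. Comparing determinants gives the
  factorisation; the Gram determinant of the basis and the doubled blocks account for the powers of
  two.\<close>

lemma tree_sum_factor:
  "2 ^ card undilated_verts * (\<Sum>B | S.spanning B. \<Prod>e\<in>B. 1 / len (src p) e) =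
    2 ^ (card (verts (tgt p)) - 1) * (\<Sum>B | T.spanning B. \<Prod>e\<in>B. 1 / len (tgt p) e) * prym_sum"
proof -
  let ?VS = "verts (src p)" and ?VT = "verts (tgt p)" and ?U = undilated_verts
  let ?n = "card ?VT" and ?m = "card ?U"
  let ?xS = "\<lambda>e. 1 / len (src p) e" and ?xT = "\<lambda>e. 1 / len (tgt p) e"
  let ?iS = "\<lambda>e w. real_of_int (incidence (src p) e w)" and ?iT = "\<lambda>e v. real_of_int (incidence (tgt p) e v)"
  obtain uT where uT: "bij_betw uT {..<?n} ?VT"
    using T.finite_verts by (metis ex_bij_betw_nat_finite lessThan_atLeast0)
  obtain uU where uU: "bij_betw uU {..<?m} ?U"
    using finite_undilated by (metis ex_bij_betw_nat_finite lessThan_atLeast0)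
  have N: "card ?VS = ?n + ?m" by (rule card_verts_src)
  obtain uS where uS: "bij_betw uS {..<?n + ?m} ?VS"
    using S.finite_verts N by (metis ex_bij_betw_nat_finite lessThan_atLeast0)
  have uT_in: "uT i \<in> ?VT" if "i < ?n" for i using bij_betw_apply[OF uT] that by simp
  have uU_in: "uU i \<in> ?U" if "i < ?m" for i using bij_betw_apply[OF uU] that by simp
  have uT_inj: "uT i = uT j \<longleftrightarrow> i = j" if "i < ?n" "j < ?n" for i j
    using uT that by (auto simp: bij_betw_def inj_on_eq_iff)
  have uU_inj: "uU i = uU j \<longleftrightarrow> i = j" if "i < ?m" "j < ?m" for i j
    using uU that by (auto simp: bij_betw_def inj_on_eq_iff)
  have UV: "u \<in> ?VT" if "u \<in> ?U" for u using that undilated_verts_sub by blast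
  obtain v0 where v0: "v0 \<in> ?VT" using T.verts_nonempty by blast
  define r where "r = real (card (vfib v0))"
  have r: "r \<noteq> 0" using card_vfib[OF v0] by (simp add: r_def)
  \<comment> \<open>Grounding at a whole fibre instead of a single point makes the functional
    orthogonal to the antisymmetric vectors; its total \<open>r\<close> is 1 or 2, as
    \<open>matrix_tree\<close> requires.\<close>
  define c :: "'w \<Rightarrow> int" where "c w = of_bool (vmap p w = v0)" for w
  have sum_c: "(\<Sum>w\<in>?VS. c w) = int (card (vfib v0))"
    using sum_vfib[of "\<lambda>_. 1::int" v0] by (simp add: c_def)
  define s :: "nat \<Rightarrow> 'w \<Rightarrow> real" where "s i w =
    (if i < ?n then of_bool (vmap p w = uT i) else real_of_int (sheet w) * of_bool (vmap p w = uU (i - ?n)))" for i w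
  have s1: "s i w = of_bool (vmap p w = uT i)" if "i < ?n" for i w using that by (simp add: s_def)
  have s2: "s (?n + i) w = real_of_int (sheet w) * of_bool (vmap p w = uU i)" for i w by (simp add: s_def)
  define E :: "'k set option set" where "E = insert None (Some ` edges (src p))"
  define y where "y eo = (case eo of None \<Rightarrow> 1 | Some e \<Rightarrow> ?xS e)" for eo
  define b where "b eo w = (case eo of None \<Rightarrow> real_of_int (c w) | Some e \<Rightarrow> ?iS e w)" for eo w
  have sumE: "(\<Sum>eo\<in>E. f eo) = (\<Sum>e\<in>edges (src p). f (Some e)) + f None" for f :: "'k set option \<Rightarrow> real"
    using S.finite_edges by (simp add: E_def sum.reindex)
  have sum_prod: "(\<Sum>w\<in>?VS. f w * of_bool (vmap p w = v) * (g w * of_bool (vmap p w = v'))) =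
      (if v = v' then \<Sum>w\<in>vfib v. f w * g w else 0)" for f g :: "'w \<Rightarrow> real" and v v'
  proof -
    have "(\<Sum>w\<in>?VS. f w * of_bool (vmap p w = v) * (g w * of_bool (vmap p w = v'))) =
        (\<Sum>w\<in>?VS. f w * g w * of_bool (v = v') * of_bool (vmap p w = v))"
      by (intro sum.cong) auto
    also have "\<dots> = (\<Sum>w\<in>vfib v. f w * g w * of_bool (v = v'))" by (rule sum_vfib)
    finally show ?thesis by simp
  qed
  have sheet0: "(\<Sum>w\<in>vfib v. real_of_int (sheet w)) = 0" if "v \<in> ?VT" for v
    using sum_sheet(1)[OF that] by (metis of_int_sum of_int_0)
  have sheet2: "(\<Sum>w\<in>vfib v. real_of_int (sheet w) * real_of_int (sheet w)) = 2" if v: "v \<in> ?U" for v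
  proof -
    have "(\<Sum>w\<in>vfib v. real_of_int (sheet w) * real_of_int (sheet w)) = (\<Sum>w\<in>vfib v. 1)"
    proof (rule sum.cong[OF refl])
      fix w assume "w \<in> vfib v"
      then have "\<bar>sheet w\<bar> = 1" using v sheet_undilated[of w] by (simp add: vfib_def undilated_verts_def)
      then have "sheet w = 1 \<or> sheet w = - 1" by linarith
      then show "real_of_int (sheet w) * real_of_int (sheet w) = 1" by auto
    qed
    then show ?thesis using card_vfib[OF UV[OF v]] v by simp
  qed
  have "fdet (?n + ?m) (\<lambda>i j. \<Sum>w\<in>?VS. s i w * s j w) = (\<Prod>i<?n + ?m. \<Sum>w\<in>?VS. s i w * s i w)"
  proof (rule fdet_diag)
    fix i j assume ij: "i < ?n + ?m" "j < ?n + ?m" "i \<noteq> j"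
    consider "i < ?n" "j < ?n" | "i < ?n" "?n \<le> j" | "?n \<le> i" "j < ?n" | "?n \<le> i" "?n \<le> j" by linarith
    then show "(\<Sum>w\<in>?VS. s i w * s j w) = 0"
    proof cases
      case 1
      then show ?thesis
        using sum_prod[of "\<lambda>_. 1" "uT i" "\<lambda>_. 1" "uT j"] ij uT_inj by (simp add: s1)
    next
      case 2
      then obtain j' where j': "j = ?n + j'" "j' < ?m" using ij nat_le_iff_add by auto
      then show ?thesis
        using sum_prod[of "\<lambda>_. 1" "uT i" sheet "uU j'"] 2 sheet0[OF UV[OF uU_in[OF j'(2)]]]
        by (simp add: s1 s2)
    next
      case 3
      then obtain i' where i': "i = ?n + i'" "i' < ?m" using ij nat_le_iff_add by auto
      then show ?thesis
        using sum_prod[of sheet "uU i'" "\<lambda>_. 1" "uT j"] 3 sheet0[OF UV[OF uU_in[OF i'(2)]]]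
        by (auto simp: s1 s2)
    next
      case 4
      then obtain i' j' where "i = ?n + i'" "i' < ?m" "j = ?n + j'" "j' < ?m" using ij nat_le_iff_add by auto
      then show ?thesis
        using sum_prod[of sheet "uU i'" sheet "uU j'"] ij uU_inj by (simp add: s2)
    qed
  qed
  also have "\<dots> = (\<Prod>i<?n. real (card (vfib (uT i)))) * (\<Prod>i<?m. 2)"
    unfolding prod_lessThan_add
  proof (intro arg_cong2[of _ _ _ _ "(*)"] prod.cong refl)
    fix i assume "i \<in> {..<?n}"
    then show "(\<Sum>w\<in>?VS. s i w * s i w) = real (card (vfib (uT i)))"
      using sum_prod[of "\<lambda>_. 1" "uT i" "\<lambda>_. 1" "uT i"] by (simp add: s1)
  next
    fix i assume "i \<in> {..<?m}"
    then show "(\<Sum>w\<in>?VS. s (?n + i) w * s (?n + i) w) = 2"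
      using sum_prod[of sheet "uU i" sheet "uU i"] sheet2[OF uU_in] by (simp add: s2)
  qed
  also have "(\<Prod>i<?n. real (card (vfib (uT i)))) = (\<Prod>v\<in>?VT. if v \<in> ?U then 2 else 1)"
    unfolding prod.reindex_bij_betw[OF uT, of "\<lambda>v. real (card (vfib v))"]
    by (intro prod.cong) (simp_all add: card_vfib)
  also have "\<dots> = 2 ^ ?m"
    using undilated_verts_sub T.finite_verts
    by (simp add: prod.If_cases Int_absorb1)
  \<comment> \<open>One factor \<open>2 ^ ?m\<close> comes from the sizes of the undilated fibres,
    the other from the squared norms of the antisymmetric vectors.\<close>
  finally have det_s: "fdet (?n + ?m) (\<lambda>i j. \<Sum>w\<in>?VS. s i w * s j w) = 2 ^ ?m * 2 ^ ?m" by simp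

  have "fdet (?n + ?m) (\<lambda>i j. \<Sum>eo\<in>E. y eo * b eo (uS i) * b eo (uS j)) =
      1 * (of_int (\<Sum>w\<in>?VS. c w))\<^sup>2 * (\<Sum>B | S.spanning B. \<Prod>e\<in>B. ?xS e)"
  proof -
    have "(\<Sum>w\<in>?VS. c w) = 1 \<or> (\<Sum>w\<in>?VS. c w) = 2"
      unfolding sum_c using card_vfib[OF v0] by auto
    from S.matrix_tree[unfolded N, OF uS _ this, of ?xS 1]
    show ?thesis by (simp add: sumE y_def b_def c_def)
  qed
  then have det_S: "fdet (?n + ?m) (\<lambda>i j. \<Sum>eo\<in>E. y eo * b eo (uS i) * b eo (uS j)) =
      r\<^sup>2 * (\<Sum>B | S.spanning B. \<Prod>e\<in>B. ?xS e)"
    unfolding sum_c r_def by simp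

  define M where "M i j = (\<Sum>eo\<in>E. y eo * (\<Sum>w\<in>?VS. s i w * b eo w) * (\<Sum>w\<in>?VS. s j w * b eo w))" for i j
  have sc1: "(\<Sum>w\<in>?VS. s i w * real_of_int (c w)) = r * of_bool (uT i = v0)" if "i < ?n" for i
    using sum_prod[of "\<lambda>_. 1" "uT i" "\<lambda>_. 1" v0] that by (auto simp: s1 c_def r_def)
  have sc2: "(\<Sum>w\<in>?VS. s (?n + i) w * real_of_int (c w)) = 0" if "i < ?m" for i
    using sum_prod[of sheet "uU i" "\<lambda>_. 1" v0] sheet0[OF UV[OF uU_in[OF that]]] by (auto simp: s2 c_def)
  have "fdet (?n + ?m) M = fdet ?n M * fdet ?m (\<lambda>i j. M (?n + i) (?n + j))"
  proof (rule fdet_block)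
    fix i j assume ij: "i < ?n" "j < ?m"
    show "M (?n + j) i = 0"
      using gram_mixed[of "uU j" "uT i"] sc2[OF ij(2)] ij(1)
      by (simp add: M_def sumE y_def b_def s2 s1)
  qed
  \<comment> \<open>Doubled conductances give a factor 2 for each of the \<open>?n - 1\<close> edges
    of a spanning tree. On a fibre indicator the grounding functional is \<open>r\<close> times
    evaluation at \<open>v0\<close>, so its rank-one term appears with weight \<open>r\<close>
    squared.\<close>
  moreover have "fdet ?n M = 2 ^ (?n - 1) * r\<^sup>2 * (\<Sum>B | T.spanning B. \<Prod>e\<in>B. ?xT e)"
  proof -
    define cT :: "'v \<Rightarrow> int" where "cT v = of_bool (v = v0)" for v
    have sum_cT: "(\<Sum>v\<in>?VT. cT v) = 1"
      using v0 T.finite_verts by (simp add: cT_def of_bool_def)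
    have "fdet ?n M = fdet ?n (\<lambda>i j. (\<Sum>e\<in>edges (tgt p). (2 * ?xT e) * ?iT e (uT i) * ?iT e (uT j))
        + r\<^sup>2 * real_of_int (cT (uT i)) * real_of_int (cT (uT j)))"
    proof (rule fdet_cong)
      fix i j assume ij: "i < ?n" "j < ?n"
      show "M i j = (\<Sum>e\<in>edges (tgt p). (2 * ?xT e) * ?iT e (uT i) * ?iT e (uT j))
          + r\<^sup>2 * real_of_int (cT (uT i)) * real_of_int (cT (uT j))"
      proof -
        have "M i j = 2 * (\<Sum>e\<in>edges (tgt p). ?xT e * ?iT e (uT i) * ?iT e (uT j))
            + (r * of_bool (uT i = v0)) * (r * of_bool (uT j = v0))"
          using gram_sym[of "uT i" "uT j"] sc1[OF ij(1)] sc1[OF ij(2)] ij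
          by (simp add: M_def sumE y_def b_def s1)
        then show ?thesis
          by (simp add: sum_distrib_left cT_def power2_eq_square mult.assoc)
      qed
    qed
    also have "\<dots> = r\<^sup>2 * (of_int (\<Sum>v\<in>?VT. cT v))\<^sup>2 * (\<Sum>B | T.spanning B. \<Prod>e\<in>B. 2 * ?xT e)"
      by (rule T.matrix_tree[OF uT]) (auto simp: sum_cT, simp add: cT_def)
    also have "(\<Sum>B | T.spanning B. \<Prod>e\<in>B. 2 * ?xT e) = (\<Sum>B | T.spanning B. 2 ^ (?n - 1) * (\<Prod>e\<in>B. ?xT e))"
    proof (rule sum.cong[OF refl])
      fix B assume "B \<in> {B. T.spanning B}"
      then have "card B = ?n - 1" by (auto simp: T.spanning_def)
      then show "(\<Prod>e\<in>B. 2 * ?xT e) = 2 ^ (?n - 1) * (\<Prod>e\<in>B. ?xT e)"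
        by (simp only: prod.distrib prod_constant)
    qed
    finally show ?thesis by (simp add: sum_cT sum_distrib_left ac_simps)
  qed
  moreover have "fdet ?m (\<lambda>i j. M (?n + i) (?n + j)) = 2 ^ ?m * prym_sum"
  proof -
    have "fdet ?m (\<lambda>i j. M (?n + i) (?n + j)) =
        fdet ?m (\<lambda>i j. \<Sum>e\<in>undilated_edges. (2 * ?xT e) * real_of_int (anti_inc e (uU i)) * real_of_int (anti_inc e (uU j)))"
    proof (rule fdet_cong)
      fix i j assume ij: "i < ?m" "j < ?m"
      have "M (?n + i) (?n + j) = 2 * (\<Sum>e\<in>undilated_edges. ?xT e * real_of_int (anti_inc e (uU i)) * real_of_int (anti_inc e (uU j)))"
        using gram_anti[of "uU i" "uU j"] sc2[OF ij(1)] by (simp add: M_def sumE y_def b_def s2)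
      then show "M (?n + i) (?n + j) =
          (\<Sum>e\<in>undilated_edges. (2 * ?xT e) * real_of_int (anti_inc e (uU i)) * real_of_int (anti_inc e (uU j)))"
        by (simp add: sum_distrib_left mult.assoc)
    qed
    also have "\<dots> = (\<Sum>B | B \<subseteq> undilated_edges \<and> card B = ?m \<and> nondeg ?U anti_inc B.
        (\<Prod>e\<in>B. 2 * ?xT e) * (real (card (parity_sets ?U anti_inc B)))\<^sup>2)"
      by (rule gram_light[OF finite_undilated(2) anti_inc_norm uU])
    also have "\<dots> = 2 ^ ?m * prym_sum"
      unfolding prym_sum_def sum_distrib_left
    proof (rule sum.cong[OF refl])
      fix B assume "B \<in> {B. B \<subseteq> undilated_edges \<and> card B = ?m \<and> nondeg ?U anti_inc B}"
      then have "card B = ?m" by simp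
      then have "(\<Prod>e\<in>B. 2 * ?xT e) = 2 ^ ?m * (\<Prod>e\<in>B. ?xT e)"
        by (simp only: prod.distrib prod_constant)
      then show "(\<Prod>e\<in>B. 2 * ?xT e) * (real (card (parity_sets ?U anti_inc B)))\<^sup>2 =
          2 ^ ?m * ((\<Prod>e\<in>B. ?xT e) * (real (card (parity_sets ?U anti_inc B)))\<^sup>2)"
        by (simp only: mult.assoc)
    qed
    finally show ?thesis .
  qed
  moreover have "fdet (?n + ?m) (\<lambda>i j. \<Sum>w\<in>?VS. s i w * s j w) *
      fdet (?n + ?m) (\<lambda>i j. \<Sum>eo\<in>E. y eo * b eo (uS i) * b eo (uS j)) = fdet (?n + ?m) M"
    unfolding M_def by (rule gram_congruence[OF uS])
  ultimately have "(2 ^ ?m * 2 ^ ?m) * (r\<^sup>2 * (\<Sum>B | S.spanning B. \<Prod>e\<in>B. ?xS e)) =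
      (2 ^ (?n - 1) * r\<^sup>2 * (\<Sum>B | T.spanning B. \<Prod>e\<in>B. ?xT e)) * (2 ^ ?m * prym_sum)"
    unfolding det_s det_S by simp
  then have "(2 ^ ?m * r\<^sup>2) * (2 ^ ?m * (\<Sum>B | S.spanning B. \<Prod>e\<in>B. ?xS e)) =
      (2 ^ ?m * r\<^sup>2) * (2 ^ (?n - 1) * (\<Sum>B | T.spanning B. \<Prod>e\<in>B. ?xT e) * prym_sum)"
    by (simp only: ac_simps)
  then show ?thesis using r by simp
qed

end

section \<open>Ogods as nonzero minors\<close>

lemma (in half_edge_graph) half_edge_subgraph_del:
  assumes "B \<subseteq> edges G"
  shows "half_edge_subgraph (del_edges G (edges G - B))"
  by unfold_locales
    (auto simp: hedges_del[OF assms] finite_verts root_in opp_in opp_opp edge_of_opp)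

context double_cover
begin

text \<open>What remains of the base after removing the candidate ogod
  \<open>undilated_edges - B\<close>: the edges of \<open>B\<close> and all dilated edges. The set
  \<open>B\<close> indexes the rows of the minor.\<close>

definition kept :: "'h set set \<Rightarrow> ('v, 'h) mgraph" where
  "kept B = del_edges (tgt p) (undilated_edges - B)"

lemma kept_simps [simp]:
  "verts (kept B) = verts (tgt p)" "root (kept B) = root (tgt p)" "opp (kept B) = opp (tgt p)"
  by (simp_all add: kept_def)

lemma kept_eq:
  assumes "B \<subseteq> undilated_edges"
  shows "kept B = del_edges (tgt p) (edges (tgt p) - (B \<union> dilated_edges p))"
    and "B \<union> dilated_edges p \<subseteq> edges (tgt p)"
  using assms by (auto simp: kept_def undilated_edges_def dilated_edges_def intro!: arg_cong[of _ _ "del_edges (tgt p)"])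

lemma hedges_kept:
  assumes "B \<subseteq> undilated_edges"
  shows "hedges (kept B) = {h \<in> hedges (tgt p). edge_of (tgt p) h \<in> B \<union> dilated_edges p}"
  unfolding kept_eq(1)[OF assms] by (rule T.hedges_del[OF kept_eq(2)[OF assms]])

lemma subgraph_kept: "B \<subseteq> undilated_edges \<Longrightarrow> half_edge_subgraph (kept B)"
  using T.half_edge_subgraph_del[OF kept_eq(2)] kept_eq(1) by simp

abbreviation cover_kept :: "'h set set \<Rightarrow> ('w, 'k) mgraph" where
  "cover_kept B \<equiv> preimage_subgraph p (kept B)"

lemma cover_kept_simps [simp]:
  "root (preimage_subgraph p K) = root (src p)" "opp (preimage_subgraph p K) = opp (src p)"
  "hedges (preimage_subgraph p K) = {k \<in> hedges (src p). hmap p k \<in> hedges K}"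
  "verts (preimage_subgraph p K) = {w \<in> verts (src p). vmap p w \<in> verts K}"
  by (simp_all add: preimage_subgraph_def)

lemma opp_cover_kept:
  assumes B: "B \<subseteq> undilated_edges" and k: "k \<in> hedges (cover_kept B)"
  shows "opp (src p) k \<in> hedges (cover_kept B)"
proof -
  interpret K: half_edge_subgraph "kept B" by (rule subgraph_kept[OF B])
  show ?thesis
    using k K.opp_hedges[of "hmap p k"] S.opp_in[of k] opp_hmap[of k] by simp
qed

text \<open>The ogod condition without reference to components. Taking two points of one fibre shows
  that it contains the connectedness of each fibre inside the preimage.\<close>

definition fibre_connected :: "'h set set \<Rightarrow> bool" where
  "fibre_connected B \<longleftrightarrow> (\<forall>w\<in>verts (src p). \<forall>w'\<in>verts (src p).
     (vmap p w, vmap p w') \<in> (adj (kept B))\<^sup>* \<longrightarrow> (w, w') \<in> (adj (cover_kept B))\<^sup>*)"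

lemma components_connected_iff:
  assumes B: "B \<subseteq> undilated_edges"
  shows "(\<forall>K\<in>components (kept B). connected_graph (preimage_subgraph p K)) \<longleftrightarrow> fibre_connected B"
proof -
  interpret K: half_edge_subgraph "kept B" by (rule subgraph_kept[OF B])
  let ?R = "conn_rel (kept B)"
  have hK: "hedges (subgraph_on (kept B) A) = {h \<in> hedges (kept B). root (tgt p) h \<in> A}"
    "verts (subgraph_on (kept B) A) = A" for A
    by (simp_all add: subgraph_on_def)
  show ?thesis
  proof
    assume conn: "\<forall>K\<in>components (kept B). connected_graph (preimage_subgraph p K)"
    show "fibre_connected B"
      unfolding fibre_connected_def
    proof (intro ballI impI)
      fix w w' assume w: "w \<in> verts (src p)" "w' \<in> verts (src p)"
        and path: "(vmap p w, vmap p w') \<in> (adj (kept B))\<^sup>*"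
      let ?A = "?R `` {vmap p w}" and ?P = "preimage_subgraph p (subgraph_on (kept B) (?R `` {vmap p w}))"
      have "?A \<in> verts (kept B) // ?R" using vmap_in[OF w(1)] by (simp add: quotientI)
      then have "connected_graph ?P" using conn by (auto simp: components_def)
      moreover have "w \<in> verts ?P" "w' \<in> verts ?P"
        using w path vmap_in by (auto simp: hK conn_rel_def)
      ultimately have "(w, w') \<in> (adj ?P)\<^sup>*" by (auto simp: connected_graph_def conn_rel_def)
      moreover have "adj ?P \<subseteq> adj (cover_kept B)" by (auto simp: adj_def hK)
      ultimately show "(w, w') \<in> (adj (cover_kept B))\<^sup>*" using rtrancl_mono by blast
    qed
  next
    assume fc: "fibre_connected B"
    show "\<forall>K\<in>components (kept B). connected_graph (preimage_subgraph p K)"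
    proof
      fix K assume "K \<in> components (kept B)"
      then obtain v0 where v0: "v0 \<in> verts (tgt p)" and K: "K = subgraph_on (kept B) (?R `` {v0})"
        by (auto simp: components_def quotient_def)
      let ?A = "?R `` {v0}" and ?P = "preimage_subgraph p K"
      have symR: "(u, v) \<in> (adj (kept B))\<^sup>* \<Longrightarrow> (v, u) \<in> (adj (kept B))\<^sup>*" for u v
        using sym_rtrancl[OF K.sym_adj] by (auto dest: symD)
      show "connected_graph ?P"
        unfolding connected_graph_def
      proof (intro conjI ballI)
        obtain w where "w \<in> vfib v0" using v0 by (cases rule: vfib_cases) auto
        then have "w \<in> verts ?P" using v0 by (auto simp: K hK vfib_def conn_rel_def)
        then show "verts ?P \<noteq> {}" by blast
        fix w w' assume wP: "w \<in> verts ?P" "w' \<in> verts ?P"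
        then have w: "w \<in> verts (src p)" "w' \<in> verts (src p)" "vmap p w \<in> ?A" "vmap p w' \<in> ?A"
          by (simp_all add: K hK)
        then have "(vmap p w, vmap p w') \<in> (adj (kept B))\<^sup>*"
          by (auto simp: conn_rel_def intro: rtrancl_trans symR)
        then have "(w, w') \<in> (adj (cover_kept B))\<^sup>*" using fc w by (simp add: fibre_connected_def)
        \<comment> \<open>A path in the preimage of the whole kept graph never leaves the preimage
          of the component in which it starts, so the induction carries membership in that component
          along.\<close>
        then have "(w, w') \<in> (adj ?P)\<^sup>* \<and> vmap p w' \<in> ?A"
        proof (induction rule: rtrancl_induct)
          case base
          then show ?case using w by simp
        next
          case (step x z)
          then obtain k where k: "k \<in> hedges (src p)" "hmap p k \<in> hedges (kept B)"
            "x = root (src p) k" "z = root (src p) (opp (src p) k)"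
            by (auto simp: adj_def)
          have x: "vmap p x = root (tgt p) (hmap p k)" and z: "vmap p z = root (tgt p) (opp (tgt p) (hmap p k))"
            using k root_hmap[of k] root_hmap[of "opp (src p) k"] S.opp_in opp_hmap by auto
          have "(vmap p x, vmap p z) \<in> adj (kept B)"
            unfolding x z using k(2) by (auto simp: adj_def)
          then have zA: "vmap p z \<in> ?A"
            using step.IH k z by (auto simp: conn_rel_def T.root_in T.opp_in hmap_in intro: rtrancl_into_rtrancl)
          have "k \<in> hedges ?P" using k step.IH x by (simp add: K hK)
          then have "(x, z) \<in> adj ?P" using k by (auto simp: adj_def)
          then show ?case using step.IH zA by (auto intro: rtrancl_into_rtrancl)
        qed
        then have "(w, w') \<in> (adj ?P)\<^sup>*" by (rule conjunct1)
        then show "(w, w') \<in> conn_rel ?P" using wP unfolding conn_rel_def by blast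
      qed
    qed
  qed
qed

text \<open>Passing to the other lift or to the opposite half-edge negates a row. Kernels and
  parities can therefore be tested on any lift.\<close>

lemma anti_row_edge:
  assumes k: "k \<in> hedges (src p)"
  shows "(\<forall>u. anti_row k u = anti_inc (edge_of (tgt p) (hmap p k)) u) \<or>
    (\<forall>u. anti_row k u = - anti_inc (edge_of (tgt p) (hmap p k)) u)"
proof -
  let ?h = "hmap p k" and ?g = "half_edge_of (edge_of (tgt p) (hmap p k))"
  have h: "?h \<in> hedges (tgt p)" using hmap_in[OF k] .
  have *: "(\<forall>u. anti_row k' u = anti_row (lift h') u) \<or> (\<forall>u. anti_row k' u = - anti_row (lift h') u)"
    if "k' \<in> hfib h'" "h' \<in> hedges (tgt p)" for k' h'
    using anti_row_swap[OF that(2) lift_in[OF that(2)] that(1)] by (cases "lift h' = k'") auto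
  consider "?g = ?h" | "?g = opp (tgt p) ?h" using T.half_edge_of_edge[OF h] by blast
  then show ?thesis
  proof cases
    case 1
    have "k \<in> hfib ?h" using k by (simp add: hfib_def)
    from *[OF this h] show ?thesis unfolding anti_inc_def 1 .
  next
    case 2
    have "opp (src p) k \<in> hfib (opp (tgt p) ?h)" using k by (intro opp_hfib) (simp add: hfib_def)
    note row = *[OF this T.opp_in[OF h]]
    have neg: "anti_row k u = - anti_row (opp (src p) k) u" for u by (simp add: anti_row_opp[OF k])
    from row show ?thesis
      unfolding anti_inc_def 2 by (auto simp: neg)
  qed
qed

lemma sum_anti_row_mult:
  fixes f :: "'v \<Rightarrow> real"
  assumes k: "k \<in> hedges (src p)"
  shows "(\<Sum>u\<in>undilated_verts. real_of_int (anti_row k u) * f u) =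
    real_of_int (sheet (root (src p) (opp (src p) k))) * f (vmap p (root (src p) (opp (src p) k)))
      - real_of_int (sheet (root (src p) k)) * f (vmap p (root (src p) k))"
proof -
  have *: "(\<Sum>u\<in>undilated_verts. real_of_int (sheet w) * (of_bool (vmap p w = u) * f u)) =
      real_of_int (sheet w) * f (vmap p w)" if w: "w \<in> verts (src p)" for w
  proof (cases "vmap p w \<in> undilated_verts")
    case True
    have "(\<Sum>u\<in>undilated_verts. real_of_int (sheet w) * (of_bool (vmap p w = u) * f u)) =
        (\<Sum>u\<in>undilated_verts. if vmap p w = u then real_of_int (sheet w) * f u else 0)"
      by (intro sum.cong) auto
    then show ?thesis using True finite_undilated by simp
  next
    case False
    then have "sheet w = 0" using vmap_in[OF w] by (auto simp: undilated_verts_def sheet_dilated)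
    then show ?thesis by simp
  qed
  show ?thesis
    unfolding *[OF S.root_in[OF k], symmetric] *[OF S.root_in[OF S.opp_in[OF k]], symmetric] sum_subtractf[symmetric]
    by (intro sum.cong) (simp_all add: anti_row_def algebra_simps)
qed

text \<open>So \<open>f\<close> solves the equation of an edge iff the antisymmetric function with
  value \<open>sheet w * f (vmap p w)\<close> at \<open>w\<close> agrees at the two ends of a lift
  of that edge.\<close>

lemma sum_anti_inc_zero:
  fixes f :: "'v \<Rightarrow> real"
  assumes k: "k \<in> hedges (src p)"
  shows "(\<Sum>u\<in>undilated_verts. real_of_int (anti_inc (edge_of (tgt p) (hmap p k)) u) * f u) = 0 \<longleftrightarrow>
    real_of_int (sheet (root (src p) (opp (src p) k))) * f (vmap p (root (src p) (opp (src p) k))) =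
      real_of_int (sheet (root (src p) k)) * f (vmap p (root (src p) k))"
proof -
  have "(\<Sum>u\<in>undilated_verts. real_of_int (anti_inc (edge_of (tgt p) (hmap p k)) u) * f u) = 0 \<longleftrightarrow>
      (\<Sum>u\<in>undilated_verts. real_of_int (anti_row k u) * f u) = 0"
    using anti_row_edge[OF k] by (auto simp: sum_negf)
  then show ?thesis unfolding sum_anti_row_mult[OF k] by simp
qed

lemma sheet_root_dilated_edge:
  assumes "k \<in> hedges (src p)" "edge_of (tgt p) (hmap p k) \<in> dilated_edges p"
  shows "vmap p (root (src p) k) \<in> dilated_verts p" "vmap p (root (src p) (opp (src p) k)) \<in> dilated_verts p"
proof -
  have h: "hmap p k \<in> hedges (tgt p)" using hmap_in assms by simp
  show "vmap p (root (src p) k) \<in> dilated_verts p"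
    using dilated_edge_root[OF h assms(2)] root_hmap[OF assms(1)] by simp
  have "edge_of (tgt p) (opp (tgt p) (hmap p k)) \<in> dilated_edges p"
    using assms(2) T.edge_of_opp[OF h] by simp
  then show "vmap p (root (src p) (opp (src p) k)) \<in> dilated_verts p"
    using dilated_edge_root[OF T.opp_in[OF h]] root_hmap[OF S.opp_in[OF assms(1)]] opp_hmap[OF assms(1)] by simp
qed

text \<open>The antisymmetric function \<phi> attached to a kernel vector is constant along kept
  edges. The two points over an undilated vertex are joined, so \<phi> takes there a value equal to
  its own negative.\<close>

lemma fibre_connected_imp_nondeg:
  assumes B: "B \<subseteq> undilated_edges" and fc: "fibre_connected B"
  shows "nondeg undilated_verts anti_inc B"
  unfolding nondeg_def
proof (intro allI impI ballI)
  fix f :: "'v \<Rightarrow> real" and u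
  assume f: "\<forall>e\<in>B. (\<Sum>w\<in>undilated_verts. real_of_int (anti_inc e w) * f w) = 0" and u: "u \<in> undilated_verts"
  define \<phi> where "\<phi> w = real_of_int (sheet w) * f (vmap p w)" for w
  have step: "\<phi> (root (cover_kept B) k) = \<phi> (root (cover_kept B) (opp (cover_kept B) k))"
    if "k \<in> hedges (cover_kept B)" for k
  proof -
    have k: "k \<in> hedges (src p)" "edge_of (tgt p) (hmap p k) \<in> B \<union> dilated_edges p"
      using that hedges_kept[OF B] by auto
    then consider "edge_of (tgt p) (hmap p k) \<in> B" | "edge_of (tgt p) (hmap p k) \<in> dilated_edges p" by blast
    then show ?thesis
    proof cases
      case 1
      then show ?thesis using f sum_anti_inc_zero[OF k(1), of f] by (simp add: \<phi>_def)
    next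
      case 2
      then show ?thesis using sheet_root_dilated_edge[OF k(1)] by (simp add: \<phi>_def sheet_dilated)
    qed
  qed
  have uV: "u \<in> verts (tgt p)" "u \<notin> dilated_verts p" using u by (auto simp: undilated_verts_def)
  from uV(1) show "f u = 0"
  proof (cases rule: vfib_cases)
    case (und a b)
    then have ab: "a \<in> vfib u" "b \<in> vfib u" by auto
    then have v: "a \<in> verts (src p)" "b \<in> verts (src p)" "vmap p a = u" "vmap p b = u" by (auto simp: vfib_def)
    then have "(a, b) \<in> (adj (cover_kept B))\<^sup>*" using fc by (simp add: fibre_connected_def)
    then have "\<phi> a = \<phi> b" by (rule adj_const) (rule step)
    moreover have "sheet b = - sheet a" by (rule sheet_swap[OF uV ab und(2)])
    moreover have "\<bar>sheet a\<bar> = 1" using sheet_undilated[of a] v uV by simp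
    ultimately show ?thesis using v by (auto simp: \<phi>_def)
  qed (use uV in simp)
qed

text \<open>Antisymmetrising the indicator of the component \<open>Z\<close> of \<open>w1\<close>
  gives a kernel vector, which must vanish; hence \<open>Z\<close> is a union of fibres. Lifting a
  path of the base edge by edge then never leaves \<open>Z\<close>.\<close>

lemma nondeg_imp_fibre_connected:
  assumes B: "B \<subseteq> undilated_edges" and nd: "nondeg undilated_verts anti_inc B"
  shows "fibre_connected B"
  unfolding fibre_connected_def
proof (intro ballI impI)
  fix w1 w2 assume w: "w1 \<in> verts (src p)" "w2 \<in> verts (src p)"
    and path: "(vmap p w1, vmap p w2) \<in> (adj (kept B))\<^sup>*"
  interpret K: half_edge_subgraph "kept B" by (rule subgraph_kept[OF B])
  define Z where "Z = {x. (w1, x) \<in> (adj (cover_kept B))\<^sup>*}"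
  have Z_step: "root (src p) k \<in> Z \<longleftrightarrow> root (src p) (opp (src p) k) \<in> Z"
    if k: "k \<in> hedges (src p)" "hmap p k \<in> hedges (kept B)" for k
  proof -
    have "k \<in> hedges (cover_kept B)" using k by simp
    then have "(root (src p) k, root (src p) (opp (src p) k)) \<in> adj (cover_kept B)"
      by (auto simp: adj_def)
    moreover have "opp (src p) k \<in> hedges (cover_kept B)" by (rule opp_cover_kept[OF B]) (use k in simp)
    then have "(root (src p) (opp (src p) k), root (src p) k) \<in> adj (cover_kept B)"
      using S.opp_opp[OF k(1)] by (auto simp: adj_def intro!: exI[of _ "opp (src p) k"])
    ultimately show ?thesis by (auto simp: Z_def intro: rtrancl_into_rtrancl)
  qed
  define f :: "'v \<Rightarrow> real" where "f u = (\<Sum>w\<in>vfib u. real_of_int (sheet w) * of_bool (w \<in> Z))" for u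
  \<comment> \<open>Over a dilated vertex both lifts start at the same point and both sides are 0.
    Over an undilated one they start at the two points of the fibre, and the factor
    \<open>sheet\<close> removes the dependence on the labelling.\<close>
  have f_swap: "real_of_int (sheet (root (src p) k)) * f (vmap p (root (src p) k)) =
      of_bool (root (src p) k \<in> Z) - of_bool (root (src p) k' \<in> Z)"
    if h: "h \<in> hedges (tgt p)" and k: "k \<in> hfib h" "k' \<in> hfib h" "k \<noteq> k'" for h k k'
  proof -
    let ?v = "root (tgt p) h" and ?a = "root (src p) k" and ?b = "root (src p) k'"
    have v: "vmap p ?a = ?v" "vmap p ?b = ?v" using root_hfib k by auto
    have ab: "?a \<in> vfib ?v" "?b \<in> vfib ?v" using v k S.root_in by (auto simp: vfib_def hfib_def)
    show ?thesis
      using T.root_in[OF h]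
    proof (cases rule: vfib_cases)
      case (dil x)
      then show ?thesis using ab v by (auto simp: sheet_dilated)
    next
      case (und x y)
      have s: "sheet ?b = - sheet ?a" by (rule sheet_root_swap[OF h k])
      have s1: "\<bar>sheet ?a\<bar> = 1" using sheet_undilated[of ?a] v und by simp
      have "?a \<noteq> ?b"
      proof
        assume "?a = ?b"
        then have "sheet ?a = - sheet ?a" using s by metis
        then show False using s1 by linarith
      qed
      then have "vfib ?v = {?a, ?b}" using und ab by auto
      then have fv: "f ?v = real_of_int (sheet ?a) * of_bool (?a \<in> Z) + real_of_int (sheet ?b) * of_bool (?b \<in> Z)"
        using \<open>?a \<noteq> ?b\<close> by (simp add: f_def)
      have "sheet ?a = 1 \<or> sheet ?a = - 1" using s1 by linarith
      then show ?thesis unfolding v fv s by auto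
    qed
  qed
  have "(\<Sum>u\<in>undilated_verts. real_of_int (anti_inc e u) * f u) = 0" if e: "e \<in> B" for e
  proof -
    have eE: "e \<in> edges (tgt p)" "e \<notin> dilated_edges p" using e B by (auto simp: undilated_edges_def)
    define h where "h = half_edge_of e"
    have h: "h \<in> hedges (tgt p)" "edge_of (tgt p) h = e" using T.half_edge_of_in[OF eE(1)] by (auto simp: h_def)
    from h(1) show ?thesis
    proof (cases rule: hfib_cases)
      case (und k k')
      have kf: "k \<in> hfib h" "k' \<in> hfib h" using und by auto
      have ks: "k \<in> hedges (src p)" "k' \<in> hedges (src p)" "hmap p k = h" "hmap p k' = h"
        using kf by (auto simp: hfib_def)
      have hk: "h \<in> hedges (kept B)" using h e hedges_kept[OF B] by simp
      have ne: "opp (src p) k \<noteq> opp (src p) k'" using und(2) ks S.opp_opp by metis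
      have "real_of_int (sheet (root (src p) k)) * f (vmap p (root (src p) k)) =
          of_bool (root (src p) k \<in> Z) - of_bool (root (src p) k' \<in> Z)"
        by (rule f_swap[OF h(1) kf und(2)])
      also have "\<dots> = of_bool (root (src p) (opp (src p) k) \<in> Z) - of_bool (root (src p) (opp (src p) k') \<in> Z)"
        using Z_step[OF ks(1)] Z_step[OF ks(2)] ks hk by simp
      also have "\<dots> = real_of_int (sheet (root (src p) (opp (src p) k))) * f (vmap p (root (src p) (opp (src p) k)))"
        by (rule f_swap[OF T.opp_in[OF h(1)] opp_hfib[OF kf(1)] opp_hfib[OF kf(2)] ne, symmetric])
      finally show ?thesis using sum_anti_inc_zero[OF ks(1), of f] ks h by simp
    qed (use h eE in simp)
  qed
  then have f0: "f u = 0" if "u \<in> undilated_verts" for u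
    using nd that unfolding nondeg_def by blast
  \<comment> \<open>On a two-point fibre \<open>f\<close> is, up to sign, the difference of the two
    indicator values of \<open>Z\<close>; its vanishing says that both points or neither belong to
    \<open>Z\<close>.\<close>
  have sat: "x \<in> Z \<longleftrightarrow> x' \<in> Z" if x: "x \<in> verts (src p)" "x' \<in> verts (src p)" "vmap p x = vmap p x'" for x x'
  proof -
    let ?v = "vmap p x"
    have xv: "x \<in> vfib ?v" "x' \<in> vfib ?v" using x by (auto simp: vfib_def)
    have vV: "?v \<in> verts (tgt p)" using vmap_in x by simp
    then show ?thesis
    proof (cases rule: vfib_cases)
      case (dil a)
      then show ?thesis using xv by auto
    next
      case (und a b)
      show ?thesis
      proof (cases "x = x'")
        case False
        then have "vfib ?v = {x, x'}" using und xv by auto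
        then have "f ?v = real_of_int (sheet x) * of_bool (x \<in> Z) + real_of_int (sheet x') * of_bool (x' \<in> Z)"
          using False by (simp add: f_def)
        moreover have "sheet x' = - sheet x" by (rule sheet_swap[OF vV und(1) xv False])
        moreover have "f ?v = 0" using f0 vV und(1) by (simp add: undilated_verts_def)
        moreover have "\<bar>sheet x\<bar> = 1" using sheet_undilated und(1) by simp
        ultimately show ?thesis by (auto simp: of_bool_def split: if_splits)
      qed simp
    qed
  qed
  \<comment> \<open>Path lifting for a single half-edge: since \<open>Z\<close> is a union of
    fibres, it does not matter at which point over the root the chosen lift starts.\<close>
  have P_half: "\<exists>x\<in>Z \<inter> verts (src p). vmap p x = root (tgt p) (opp (tgt p) h)"
    if h: "h \<in> hedges (kept B)" and x: "x \<in> Z \<inter> verts (src p)" "vmap p x = root (tgt p) h" for h x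
  proof -
    have hT: "h \<in> hedges (tgt p)" using h hedges_kept[OF B] by simp
    let ?k = "lift h"
    have k: "?k \<in> hedges (src p)" "hmap p ?k = h" using lift_in[OF hT] by (auto simp: hfib_def)
    have "vmap p (root (src p) ?k) = root (tgt p) h" using root_hfib[OF lift_in[OF hT]] .
    then have "root (src p) ?k \<in> Z" using sat[of x "root (src p) ?k"] x S.root_in[OF k(1)] by simp
    then have "root (src p) (opp (src p) ?k) \<in> Z" using Z_step[OF k(1)] k(2) h by simp
    moreover have "vmap p (root (src p) (opp (src p) ?k)) = root (tgt p) (opp (tgt p) h)"
      by (rule root_hfib[OF opp_hfib[OF lift_in[OF hT]]])
    ultimately show ?thesis using S.root_in[OF S.opp_in[OF k(1)]] by blast
  qed
  have "(\<exists>x\<in>Z \<inter> verts (src p). vmap p x = vmap p w1) \<longleftrightarrow> (\<exists>x\<in>Z \<inter> verts (src p). vmap p x = vmap p w2)"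
  proof (rule adj_closed[OF path], rule ballI)
    fix h assume h: "h \<in> hedges (kept B)"
    have o: "opp (tgt p) h \<in> hedges (kept B)" "opp (tgt p) (opp (tgt p) h) = h"
      using K.opp_hedges[OF h] K.opp_invol[OF h] by simp_all
    show "(\<exists>x\<in>Z \<inter> verts (src p). vmap p x = root (kept B) h) \<longleftrightarrow>
        (\<exists>x\<in>Z \<inter> verts (src p). vmap p x = root (kept B) (opp (kept B) h))"
      using P_half[OF h] P_half[OF o(1)] o(2) by auto
  qed
  moreover have "w1 \<in> Z \<inter> verts (src p)" using w by (simp add: Z_def)
  ultimately obtain x where "x \<in> Z \<inter> verts (src p)" "vmap p x = vmap p w2" by blast
  then have "w2 \<in> Z" using sat[of x w2] w by simp
  then show "(w1, w2) \<in> (adj (cover_kept B))\<^sup>*" by (simp add: Z_def)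
qed

section \<open>The dilation subgraph and solutions modulo 2\<close>

lemma hedges_dilation: "hedges (dilation_subgraph p) = {h \<in> hedges (tgt p). edge_of (tgt p) h \<in> dilated_edges p}"
proof -
  have "\<Union>(dilated_edges p) = {h \<in> hedges (tgt p). edge_of (tgt p) h \<in> dilated_edges p}"
  proof (intro equalityI subsetI)
    fix h assume "h \<in> \<Union>(dilated_edges p)"
    then obtain e where e: "e \<in> dilated_edges p" "h \<in> e" by blast
    then obtain h0 where h0: "h0 \<in> hedges (tgt p)" "e = edge_of (tgt p) h0"
      by (auto simp: dilated_edges_def edges_def)
    then have "h = h0 \<or> h = opp (tgt p) h0" using e by (auto simp: edge_of_def)
    then show "h \<in> {h \<in> hedges (tgt p). edge_of (tgt p) h \<in> dilated_edges p}"
      using h0 e T.opp_in T.edge_of_opp by auto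
  next
    fix h assume "h \<in> {h \<in> hedges (tgt p). edge_of (tgt p) h \<in> dilated_edges p}"
    then show "h \<in> \<Union>(dilated_edges p)" by (auto simp: edge_of_def)
  qed
  then show ?thesis by (simp add: dilation_subgraph_def)
qed

lemma dilation_simps [simp]:
  "verts (dilation_subgraph p) = dilated_verts p" "root (dilation_subgraph p) = root (tgt p)"
  "opp (dilation_subgraph p) = opp (tgt p)"
  by (simp_all add: dilation_subgraph_def)

lemma edges_dilation: "edges (dilation_subgraph p) = dilated_edges p"
proof -
  have "edge_of (dilation_subgraph p) = edge_of (tgt p)" by (auto simp: edge_of_def)
  then show ?thesis
    unfolding edges_def hedges_dilation by (auto simp: dilated_edges_def edges_def)
qed

lemma dilated_verts_sub: "dilated_verts p \<subseteq> verts (tgt p)"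
  by (auto simp: dilated_verts_def)

lemma subgraph_dilation: "half_edge_subgraph (dilation_subgraph p)"
  by unfold_locales
    (auto simp: hedges_dilation dilated_edge_root T.opp_in T.opp_opp T.edge_of_opp
      intro: finite_subset[OF dilated_verts_sub T.finite_verts])

text \<open>Modulo 2 the signs disappear: on sets of undilated vertices a row merely counts how many
  of its two ends lie in \<open>S\<close>.\<close>

lemma sum_anti_row_set:
  assumes S: "S \<subseteq> undilated_verts" and k: "k \<in> hedges (src p)"
  shows "even (\<Sum>u\<in>S. anti_row k u) \<longleftrightarrow>
    (vmap p (root (src p) k) \<in> S \<longleftrightarrow> vmap p (root (src p) (opp (src p) k)) \<in> S)"
proof -
  have fin: "finite S" using S finite_undilated finite_subset by blast
  have *: "even (\<Sum>u\<in>S. sheet w * of_bool (vmap p w = u)) \<longleftrightarrow> vmap p w \<notin> S" for w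
  proof (cases "vmap p w \<in> S")
    case True
    have "(\<Sum>u\<in>S. sheet w * of_bool (vmap p w = u)) = (\<Sum>u\<in>S. if vmap p w = u then sheet w else 0)"
      by (intro sum.cong) auto
    then have "(\<Sum>u\<in>S. sheet w * of_bool (vmap p w = u)) = sheet w" using True fin by simp
    moreover have "\<bar>sheet w\<bar> = 1" using sheet_undilated[of w] True S by (auto simp: undilated_verts_def)
    then have "sheet w = 1 \<or> sheet w = - 1" by linarith
    ultimately show ?thesis using True by auto
  next
    case False
    then have "(\<Sum>u\<in>S. sheet w * of_bool (vmap p w = u)) = 0"
      by (intro sum.neutral) auto
    then show ?thesis using False by simp
  qed
  show ?thesis
    unfolding anti_row_def sum_subtractf even_diff by (auto simp: *)
qed

lemma sum_anti_inc_set: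
  assumes S: "S \<subseteq> undilated_verts" and h: "h \<in> hedges (tgt p)"
  shows "even (\<Sum>u\<in>S. anti_inc (edge_of (tgt p) h) u) \<longleftrightarrow>
    (root (tgt p) h \<in> S \<longleftrightarrow> root (tgt p) (opp (tgt p) h) \<in> S)"
proof -
  let ?k = "lift h"
  have k: "?k \<in> hedges (src p)" "hmap p ?k = h" using lift_in[OF h] by (auto simp: hfib_def)
  have "even (\<Sum>u\<in>S. anti_inc (edge_of (tgt p) h) u) \<longleftrightarrow> even (\<Sum>u\<in>S. anti_row ?k u)"
    using anti_row_edge[OF k(1)] k(2) by (auto simp: sum_negf)
  then show ?thesis
    unfolding sum_anti_row_set[OF S k(1)] root_hfib[OF lift_in[OF h]] root_hfib[OF opp_hfib[OF lift_in[OF h]]] .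
qed

text \<open>Dilated edges are kept but impose nothing on \<open>S\<close>, since both their ends are
  dilated and \<open>S\<close> avoids such vertices.\<close>

lemma parity_sets_eq:
  assumes B: "B \<subseteq> undilated_edges"
  shows "parity_sets undilated_verts anti_inc B = {S \<in> closed_sets (kept B). S \<subseteq> undilated_verts}"
proof (intro equalityI subsetI)
  fix S assume "S \<in> parity_sets undilated_verts anti_inc B"
  then have S: "S \<subseteq> undilated_verts" "\<And>e. e \<in> B \<Longrightarrow> even (\<Sum>u\<in>S. anti_inc e u)"
    by (auto simp: parity_sets_def)
  have "root (tgt p) h \<in> S \<longleftrightarrow> root (tgt p) (opp (tgt p) h) \<in> S" if h: "h \<in> hedges (kept B)" for h
  proof -
    have h: "h \<in> hedges (tgt p)" "edge_of (tgt p) h \<in> B \<union> dilated_edges p"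
      using h hedges_kept[OF B] by auto
    then consider "edge_of (tgt p) h \<in> B" | "edge_of (tgt p) h \<in> dilated_edges p" by blast
    then show ?thesis
    proof cases
      case 1
      then show ?thesis using sum_anti_inc_set[OF S(1) h(1)] S(2) by simp
    next
      case 2
      then have "root (tgt p) h \<in> dilated_verts p" "root (tgt p) (opp (tgt p) h) \<in> dilated_verts p"
        using dilated_edge_root[OF h(1)] dilated_edge_root[OF T.opp_in[OF h(1)]] T.edge_of_opp[OF h(1)] by auto
      then show ?thesis using S(1) by (auto simp: undilated_verts_def)
    qed
  qed
  then show "S \<in> {S \<in> closed_sets (kept B). S \<subseteq> undilated_verts}"
    using S(1) undilated_verts_sub by (auto simp: closed_sets_def)
next
  fix S assume "S \<in> {S \<in> closed_sets (kept B). S \<subseteq> undilated_verts}"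
  then have S: "S \<subseteq> undilated_verts"
    "\<And>h. h \<in> hedges (kept B) \<Longrightarrow> root (tgt p) h \<in> S \<longleftrightarrow> root (tgt p) (opp (tgt p) h) \<in> S"
    by (auto simp: closed_sets_def)
  have "even (\<Sum>u\<in>S. anti_inc e u)" if e: "e \<in> B" for e
  proof -
    have "e \<in> edges (tgt p)" using e B undilated_edges_sub by blast
    then obtain h where h: "h \<in> hedges (tgt p)" "e = edge_of (tgt p) h" by (auto simp: edges_def)
    then have "h \<in> hedges (kept B)" using e hedges_kept[OF B] by simp
    then show ?thesis using sum_anti_inc_set[OF S(1) h(1)] S(2) h(2) by simp
  qed
  then show "S \<in> parity_sets undilated_verts anti_inc B" using S(1) by (simp add: parity_sets_def)
qed

text \<open>
  The signed system has a unique solution with prescribed values on the dilated vertices; its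
  absolute value is constant along edges and so shows that \<open>kept B\<close> joins no two components of
  the dilation subgraph.
\<close>

lemma closed_set_extend:
  assumes B: "B \<subseteq> undilated_edges" "card B = card undilated_verts"
    and nd: "nondeg undilated_verts anti_inc B"
    and T0: "T0 \<in> closed_sets (dilation_subgraph p)"
  shows "\<exists>T1\<in>closed_sets (kept B). T1 \<inter> dilated_verts p = T0"
proof -
  have finB: "finite B" using B(1) finite_undilated finite_subset by blast
  have T0D: "T0 \<subseteq> dilated_verts p" using T0 by (simp add: closed_sets_def)
  define k where "k e = lift (half_edge_of e)" for e
  define \<tau> :: "'w \<Rightarrow> real" where "\<tau> w = of_bool (vmap p w \<in> T0)" for w
  \<comment> \<open>The prescribed values \<tau> at dilated ends form the right-hand side; the
    equations then say that \<psi> below agrees at the two ends of the chosen lift of every edge of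
    \<open>B\<close>.\<close>
  obtain f where f: "\<forall>e\<in>B. (\<Sum>u\<in>undilated_verts. real_of_int (anti_inc e u) * f u) =
      \<tau> (root (src p) (k e)) - \<tau> (root (src p) (opp (src p) (k e)))"
    using nondeg_solve[OF nd B(2) finite_undilated(1) finB,
        of "\<lambda>e. \<tau> (root (src p) (k e)) - \<tau> (root (src p) (opp (src p) (k e)))"] by blast
  \<comment> \<open>On an undilated fibre \<psi> takes the values \<open>f\<close> and
    \<open>- f\<close>, so only its absolute value descends to the base. At dilated vertices it is 0
    or 1, with 1 exactly on \<open>T0\<close>, which is why the level 1 is taken.\<close>
  define T1 where "T1 = T0 \<union> {u \<in> undilated_verts. \<bar>f u\<bar> = 1}"
  define \<psi> where "\<psi> w = real_of_int (sheet w) * f (vmap p w) + \<tau> w" for w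
  have mem: "vmap p w \<in> T1 \<longleftrightarrow> \<bar>\<psi> w\<bar> = 1" if w: "w \<in> verts (src p)" for w
  proof (cases "vmap p w \<in> dilated_verts p")
    case True
    then show ?thesis by (auto simp: T1_def \<psi>_def sheet_dilated undilated_verts_def \<tau>_def)
  next
    case False
    then have "vmap p w \<in> undilated_verts" "vmap p w \<notin> T0"
      using vmap_in[OF w] T0D by (auto simp: undilated_verts_def)
    moreover have "\<bar>sheet w\<bar> = 1" by (rule sheet_undilated[OF False])
    then have "\<bar>real_of_int (sheet w)\<bar> = 1" by linarith
    ultimately show ?thesis by (simp add: T1_def \<psi>_def \<tau>_def abs_mult)
  qed
  have T1D: "T1 \<inter> dilated_verts p = T0" using T0D by (auto simp: T1_def undilated_verts_def)
  have "root (tgt p) h \<in> T1 \<longleftrightarrow> root (tgt p) (opp (tgt p) h) \<in> T1" if h: "h \<in> hedges (kept B)" for h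
  proof -
    have h: "h \<in> hedges (tgt p)" "edge_of (tgt p) h \<in> B \<union> dilated_edges p"
      using h hedges_kept[OF B(1)] by auto
    then consider "edge_of (tgt p) h \<in> B" | "edge_of (tgt p) h \<in> dilated_edges p" by blast
    then show ?thesis
    proof cases
      case 1
      let ?e = "edge_of (tgt p) h"
      let ?g = "half_edge_of ?e"
      have g: "?g \<in> {h, opp (tgt p) h}" by (rule T.half_edge_of_edge[OF h(1)])
      then have gT: "?g \<in> hedges (tgt p)" using h T.opp_in by auto
      have kf: "k ?e \<in> hfib ?g" unfolding k_def by (rule lift_in[OF gT])
      have kS: "k ?e \<in> hedges (src p)" using kf by (simp add: hfib_def)
      have "(\<Sum>u\<in>undilated_verts. real_of_int (anti_inc ?e u) * f u) =
          real_of_int (sheet (root (src p) (opp (src p) (k ?e)))) * f (vmap p (root (src p) (opp (src p) (k ?e))))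
          - real_of_int (sheet (root (src p) (k ?e))) * f (vmap p (root (src p) (k ?e)))"
        using sum_anti_row_mult[OF kS, of f] by (simp add: anti_inc_def k_def)
      then have "\<psi> (root (src p) (k ?e)) = \<psi> (root (src p) (opp (src p) (k ?e)))"
        using bspec[OF f 1] by (simp add: \<psi>_def)
      then have "vmap p (root (src p) (k ?e)) \<in> T1 \<longleftrightarrow> vmap p (root (src p) (opp (src p) (k ?e))) \<in> T1"
        using mem S.root_in kS S.opp_in by simp
      then have "root (tgt p) ?g \<in> T1 \<longleftrightarrow> root (tgt p) (opp (tgt p) ?g) \<in> T1"
        unfolding root_hfib[OF kf] root_hfib[OF opp_hfib[OF kf]] .
      then show ?thesis using g T.opp_opp[OF h(1)] by auto
    next
      case 2
      then have "root (tgt p) h \<in> dilated_verts p" "root (tgt p) (opp (tgt p) h) \<in> dilated_verts p"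
        using dilated_edge_root[OF h(1)] dilated_edge_root[OF T.opp_in[OF h(1)]] T.edge_of_opp[OF h(1)] by auto
      moreover have "root (tgt p) h \<in> T0 \<longleftrightarrow> root (tgt p) (opp (tgt p) h) \<in> T0"
        using T0 2 h(1) by (auto simp: closed_sets_def hedges_dilation)
      ultimately show ?thesis using T1D by blast
    qed
  qed
  moreover have "T1 \<subseteq> verts (tgt p)"
    using T0D dilated_verts_sub undilated_verts_sub by (auto simp: T1_def)
  ultimately have "T1 \<in> closed_sets (kept B)" by (simp add: closed_sets_def)
  then show ?thesis using T1D by blast
qed

text \<open>Under symmetric difference the closed sets form a vector space over the field with two
  elements. Restriction to the dilated vertices is linear, onto by \<open>closed_set_extend\<close>,
  and its kernel consists of the parity sets.\<close>

lemma card_closed_sets_kept: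
  assumes B: "B \<subseteq> undilated_edges" "card B = card undilated_verts"
    and nd: "nondeg undilated_verts anti_inc B"
  shows "card (closed_sets (kept B)) =
    card (closed_sets (dilation_subgraph p)) * card (parity_sets undilated_verts anti_inc B)"
proof -
  let ?K = "closed_sets (kept B)" and ?D = "closed_sets (dilation_subgraph p)" and ?dv = "dilated_verts p"
  let ?P = "parity_sets undilated_verts anti_inc B"
  \<comment> \<open>Any section of the restriction map suffices: translating by
    \<open>ext T0\<close> identifies the closed sets over \<open>T0\<close> with the kernel.\<close>
  define ext where "ext T0 = (SOME T1. T1 \<in> ?K \<and> T1 \<inter> ?dv = T0)" for T0
  have ext: "ext T0 \<in> ?K" "ext T0 \<inter> ?dv = T0" if "T0 \<in> ?D" for T0
  proof -
    have "\<exists>T1. T1 \<in> ?K \<and> T1 \<inter> ?dv = T0" using closed_set_extend[OF B nd that] by blast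
    then have "ext T0 \<in> ?K \<and> ext T0 \<inter> ?dv = T0" unfolding ext_def by (rule someI_ex)
    then show "ext T0 \<in> ?K" "ext T0 \<inter> ?dv = T0" by blast+
  qed
  define sd :: "'v set \<Rightarrow> 'v set \<Rightarrow> 'v set" where "sd X Y = (X - Y) \<union> (Y - X)" for X Y
  have sd_K: "sd X Y \<in> ?K" if "X \<in> ?K" "Y \<in> ?K" for X Y
    using that unfolding closed_sets_def sd_def by blast
  have sd_sd: "sd X (sd X Y) = Y" for X Y by (auto simp: sd_def)
  have K_D: "X \<inter> ?dv \<in> ?D" if X: "X \<in> ?K" for X
  proof -
    have "root (tgt p) h \<in> X \<inter> ?dv \<longleftrightarrow> root (tgt p) (opp (tgt p) h) \<in> X \<inter> ?dv"
      if h: "h \<in> hedges (dilation_subgraph p)" for h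
    proof -
      have hT: "h \<in> hedges (tgt p)" "edge_of (tgt p) h \<in> dilated_edges p"
        using h by (auto simp: hedges_dilation)
      then have "h \<in> hedges (kept B)" using hedges_kept[OF B(1)] by simp
      then have "root (tgt p) h \<in> X \<longleftrightarrow> root (tgt p) (opp (tgt p) h) \<in> X"
        using X by (auto simp: closed_sets_def)
      then show ?thesis
        using dilated_edge_root[OF hT] dilated_edge_root[OF T.opp_in[OF hT(1)]] T.edge_of_opp[OF hT(1)] hT(2)
        by auto
    qed
    then show ?thesis by (auto simp: closed_sets_def)
  qed
  have P: "S \<in> ?P \<longleftrightarrow> S \<in> ?K \<and> S \<inter> ?dv = {}" for S
    unfolding parity_sets_eq[OF B(1)] by (auto simp: closed_sets_def undilated_verts_def)
  have "bij_betw (\<lambda>(T0, S). sd (ext T0) S) (?D \<times> ?P) ?K"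
  proof (rule bij_betw_byWitness[where f' = "\<lambda>X. (X \<inter> ?dv, sd (ext (X \<inter> ?dv)) X)"])
    have dv: "sd (ext T0) S \<inter> ?dv = T0" if "T0 \<in> ?D" "S \<in> ?P" for T0 S
      using ext(2)[OF that(1)] that(2)[unfolded P] by (auto simp: sd_def)
    then show "\<forall>a\<in>?D \<times> ?P. (\<lambda>X. (X \<inter> ?dv, sd (ext (X \<inter> ?dv)) X)) ((\<lambda>(T0, S). sd (ext T0) S) a) = a"
      by (auto simp: sd_sd)
    show "\<forall>X\<in>?K. (\<lambda>(T0, S). sd (ext T0) S) (X \<inter> ?dv, sd (ext (X \<inter> ?dv)) X) = X"
      by (simp add: sd_sd)
    show "(\<lambda>(T0, S). sd (ext T0) S) ` (?D \<times> ?P) \<subseteq> ?K"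
      using ext(1) sd_K P by auto
    show "(\<lambda>X. (X \<inter> ?dv, sd (ext (X \<inter> ?dv)) X)) ` ?K \<subseteq> ?D \<times> ?P"
    proof (rule image_subsetI)
      fix X assume X: "X \<in> ?K"
      have "sd (ext (X \<inter> ?dv)) X \<inter> ?dv = {}"
        using ext(2)[OF K_D[OF X]] by (auto simp: sd_def)
      then have "sd (ext (X \<inter> ?dv)) X \<in> ?P" using P sd_K[OF ext(1)[OF K_D[OF X]] X] by simp
      then show "(X \<inter> ?dv, sd (ext (X \<inter> ?dv)) X) \<in> ?D \<times> ?P" using K_D[OF X] by simp
    qed
  qed
  then have "card (?D \<times> ?P) = card ?K" by (rule bij_betw_same_card)
  then show ?thesis by (simp add: card_cartesian_product)
qed

text \<open>The count of closed sets reads \<open>2 ^ r = 2 ^ d * card P\<close>, with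
  \<open>P\<close> the parity sets; squaring gives the powers of 4. Thus the weight of an ogod is
  its squared minor up to a factor that is the same for all ogods.\<close>

lemma four_power_rank:
  assumes B: "B \<subseteq> undilated_edges" "card B = card undilated_verts"
    and nd: "nondeg undilated_verts anti_inc B"
  shows "4 * 4 ^ (ogod_rank p (undilated_edges - B) - 1) =
    (4 ^ num_dilated_components p * (real (card (parity_sets undilated_verts anti_inc B)))\<^sup>2)"
proof -
  interpret K: half_edge_subgraph "kept B" by (rule subgraph_kept[OF B(1)])
  interpret D: half_edge_subgraph "dilation_subgraph p" by (rule subgraph_dilation)
  let ?r = "ogod_rank p (undilated_edges - B)" and ?d = "num_dilated_components p"
  have r: "?r = card (components (kept B))" by (simp add: ogod_rank_def kept_def)
  have "2 ^ ?r = 2 ^ ?d * card (parity_sets undilated_verts anti_inc B)"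
    using card_closed_sets_kept[OF B nd] unfolding K.card_closed_sets D.card_closed_sets r num_dilated_components_def .
  then have "real (2 ^ ?r) = real (2 ^ ?d * card (parity_sets undilated_verts anti_inc B))" by simp
  then have "((2::real) ^ ?r)\<^sup>2 = (2 ^ ?d * real (card (parity_sets undilated_verts anti_inc B)))\<^sup>2" by simp
  moreover have "((2::real) ^ i)\<^sup>2 = 4 ^ i" for i
    by (simp add: power2_eq_square flip: power_mult_distrib)
  ultimately have "(4::real) ^ ?r = 4 ^ ?d * (real (card (parity_sets undilated_verts anti_inc B)))\<^sup>2"
    by (simp only: power_mult_distrib)
  \<comment> \<open>A positive rank is what allows the extra factor 4 to absorb the truncated
    subtraction in the exponent.\<close>
  moreover have "?r > 0"
  proof -
    have "finite (verts (kept B) // conn_rel (kept B))"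
      using K.fin_verts by (rule finite_quotient) (auto simp: conn_rel_def)
    moreover have "verts (kept B) // conn_rel (kept B) \<noteq> {}"
      using T.verts_nonempty by (auto simp: quotient_def)
    ultimately show ?thesis unfolding r K.card_components by (simp add: card_gt_0_iff)
  qed
  ultimately show ?thesis by (cases ?r) simp_all
qed

section \<open>Edge counts, edge lengths and the final identity\<close>

lemma edge_src_fibre:
  fixes g :: "'k set \<Rightarrow> 'a::comm_monoid_mult"
  assumes "h \<in> hedges (tgt p)"
  shows "(\<Prod>e' | e' \<in> edges (src p) \<and> emap p e' = edge_of (tgt p) h. g e') = (\<Prod>k\<in>hfib h. g (edge_of (src p) k))"
  by (rule prod.reindex_bij_betw[OF edge_fibre_bij[OF assms], symmetric])

lemma emap_in: "e' \<in> edges (src p) \<Longrightarrow> emap p e' \<in> edges (tgt p)"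
  by (auto simp: edges_def emap_edge_of hmap_in)

lemma card_edges_src: "card (edges (src p)) = 2 * card undilated_edges + card (dilated_edges p)"
proof -
  have "card (edges (src p)) = (\<Sum>e\<in>edges (tgt p). card {e' \<in> edges (src p). emap p e' = e})"
  proof -
    have "emap p ` edges (src p) \<subseteq> edges (tgt p)" using emap_in by blast
    from sum.group[OF S.finite_edges T.finite_edges this, of "\<lambda>_. 1::nat"] show ?thesis by simp
  qed
  also have "\<dots> = (\<Sum>e\<in>edges (tgt p). if e \<in> dilated_edges p then 1 else 2)"
  proof (rule sum.cong[OF refl])
    fix e assume "e \<in> edges (tgt p)"
    then obtain h where h: "h \<in> hedges (tgt p)" "e = edge_of (tgt p) h" by (auto simp: edges_def)
    from h(1) show "card {e' \<in> edges (src p). emap p e' = e} = (if e \<in> dilated_edges p then 1 else 2)"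
      unfolding h(2) card_edge_fibre[OF h(1)] by (cases rule: hfib_cases) auto
  qed
  also have "\<dots> = (\<Sum>e\<in>undilated_edges. 2) + (\<Sum>e\<in>dilated_edges p. 1)"
  proof -
    have "dilated_edges p \<subseteq> edges (tgt p)" by (auto simp: dilated_edges_def)
    from sum.subset_diff[OF this T.finite_edges, of "\<lambda>e. if e \<in> dilated_edges p then 1 else 2 :: nat"]
    show ?thesis by (simp add: undilated_edges_def)
  qed
  finally show ?thesis by simp
qed

lemma card_edges_tgt: "card (edges (tgt p)) = card undilated_edges + card (dilated_edges p)"
  and prod_edges_tgt: "(\<Prod>e\<in>edges (tgt p). g e) = (\<Prod>e\<in>undilated_edges. g e) * (\<Prod>e\<in>dilated_edges p. g e :: real)"
proof -
  have sub: "dilated_edges p \<subseteq> edges (tgt p)" by (auto simp: dilated_edges_def)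
  show "card (edges (tgt p)) = card undilated_edges + card (dilated_edges p)"
    using sum.subset_diff[OF sub T.finite_edges, of "\<lambda>_. 1::nat"] by (simp add: undilated_edges_def)
  show "(\<Prod>e\<in>edges (tgt p). g e) = (\<Prod>e\<in>undilated_edges. g e) * (\<Prod>e\<in>dilated_edges p. g e)"
    unfolding undilated_edges_def by (rule prod.subset_diff[OF sub T.finite_edges])
qed

text \<open>An undilated edge has two lifts of its own length, a dilated edge one lift of half its
  length.\<close>

lemma prod_len_src:
  "2 ^ card (dilated_edges p) * (\<Prod>e\<in>edges (src p). len (src p) e) =
    (\<Prod>e\<in>undilated_edges. len (tgt p) e) * (\<Prod>e\<in>edges (tgt p). len (tgt p) e)"
proof -
  let ?l = "len (tgt p)"
  have "(\<Prod>e\<in>edges (src p). len (src p) e) = (\<Prod>e\<in>edges (tgt p). \<Prod>e' | e' \<in> edges (src p) \<and> emap p e' = e. len (src p) e')"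
    by (rule prod.group[symmetric]) (auto simp: S.finite_edges T.finite_edges emap_in)
  also have "\<dots> = (\<Prod>e\<in>edges (tgt p). if e \<in> dilated_edges p then ?l e / 2 else ?l e * ?l e)"
  proof (rule prod.cong[OF refl])
    fix e assume "e \<in> edges (tgt p)"
    then obtain h where h: "h \<in> hedges (tgt p)" "e = edge_of (tgt p) h" by (auto simp: edges_def)
    have len: "len (src p) (edge_of (src p) k) = ?l e / real (hdeg p k)" if "k \<in> hfib h" for k
    proof -
      have "1 / (1 / len (src p) (edge_of (src p) k)) = 1 / (real (hdeg p k) / ?l e)"
        using that h(2) by (subst len_src) (auto simp: hfib_def)
      then show ?thesis by simp
    qed
    from h(1) show "(\<Prod>e' | e' \<in> edges (src p) \<and> emap p e' = e. len (src p) e') =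
        (if e \<in> dilated_edges p then ?l e / 2 else ?l e * ?l e)"
      unfolding h(2) edge_src_fibre[OF h(1)]
      by (cases rule: hfib_cases) (simp_all add: len h(2))
  qed
  also have "\<dots> = (\<Prod>e\<in>undilated_edges. ?l e * ?l e) * (\<Prod>e\<in>dilated_edges p. ?l e / 2)"
    unfolding prod_edges_tgt by (intro arg_cong2[of _ _ _ _ "(*)"] prod.cong) (auto simp: undilated_edges_def)
  also have "2 ^ card (dilated_edges p) * \<dots> = (\<Prod>e\<in>undilated_edges. ?l e) * (\<Prod>e\<in>edges (tgt p). ?l e)"
    unfolding prod_edges_tgt prod.distrib prod_dividef by simp
  finally show ?thesis by simp
qed

text \<open>In the difference of genera the dilated edges and vertices cancel, leaving the undilated
  edges minus the undilated vertices. The size condition on an ogod thus says that the complementary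
  minor is square, and the connectedness condition that it is nonzero.\<close>

lemma is_ogod_iff:
  assumes B: "B \<subseteq> undilated_edges"
  shows "is_ogod p (undilated_edges - B) \<longleftrightarrow>
    card B = card undilated_verts \<and> nondeg undilated_verts anti_inc B"
proof -
  have finB: "finite B" using B finite_undilated finite_subset by blast
  have "card (undilated_edges - B) + card B = card undilated_edges"
    using B finB finite_undilated by (metis card_Diff_subset card_mono le_add_diff_inverse2)
  moreover have "genus (src p) - genus (tgt p) = int (card undilated_edges) - int (card undilated_verts)"
    by (simp add: genus_def card_edges_src card_edges_tgt card_verts_src)
  ultimately have card: "int (card (undilated_edges - B)) = genus (src p) - genus (tgt p) \<longleftrightarrow> card B = card undilated_verts"
    by linarith
  have "nondeg undilated_verts anti_inc B \<longleftrightarrow>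
      (\<forall>K\<in>components (del_edges (tgt p) (undilated_edges - B)). connected_graph (preimage_subgraph p K))"
    using components_connected_iff[OF B] nondeg_imp_fibre_connected[OF B] fibre_connected_imp_nondeg[OF B]
    unfolding kept_def by blast
  then show ?thesis
    unfolding is_ogod_def card using undilated_edges_sub by (auto simp: undilated_edges_def)
qed

text \<open>Passing from an ogod to its complement among the undilated edges exchanges lengths for
  conductances. The factors 4 and \<open>4 ^ num_dilated_components p\<close> are those of
  \<open>four_power_rank\<close>.\<close>

lemma prym_poly_eq:
  "4 * prym_poly p = 4 ^ num_dilated_components p * (\<Prod>e\<in>undilated_edges. len (tgt p) e) * prym_sum"
proof -
  let ?U = undilated_edges and ?l = "len (tgt p)"
  let ?par = "\<lambda>B. real (card (parity_sets undilated_verts anti_inc B))"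
  have "4 * prym_poly p = (\<Sum>F | is_ogod p F. 4 * 4 ^ (ogod_rank p F - 1) * (\<Prod>e\<in>F. ?l e))"
    by (simp add: prym_poly_def sum_distrib_left mult.assoc)
  also have "\<dots> = (\<Sum>B | B \<subseteq> ?U \<and> card B = card undilated_verts \<and> nondeg undilated_verts anti_inc B.
      4 ^ num_dilated_components p * (\<Prod>e\<in>?U. ?l e) * ((\<Prod>e\<in>B. 1 / ?l e) * (?par B)\<^sup>2))"
  proof (rule sum.reindex_bij_witness[of _ "\<lambda>B. ?U - B" "\<lambda>F. ?U - F"])
    fix F assume "F \<in> {F. is_ogod p F}"
    then have F: "is_ogod p F" "F \<subseteq> ?U" by (auto simp: is_ogod_def undilated_edges_def)
    have UF: "?U - (?U - F) = F" using F(2) by auto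
    then show "?U - (?U - F) = F" .
    have B: "?U - F \<subseteq> ?U" "card (?U - F) = card undilated_verts" "nondeg undilated_verts anti_inc (?U - F)"
      using is_ogod_iff[of "?U - F"] F UF by auto
    then show "?U - F \<in> {B. B \<subseteq> ?U \<and> card B = card undilated_verts \<and> nondeg undilated_verts anti_inc B}" by simp
    have split: "(\<Prod>e\<in>?U. ?l e) = (\<Prod>e\<in>?U - F. ?l e) * (\<Prod>e\<in>F. ?l e)"
      by (rule prod.subset_diff[OF F(2) finite_undilated(2)])
    have inv: "(\<Prod>e\<in>?U - F. ?l e) * (\<Prod>e\<in>?U - F. 1 / ?l e) = 1"
      unfolding prod.distrib[symmetric]
    proof (rule prod.neutral, rule ballI)
      fix e assume "e \<in> ?U - F"
      then have "?l e > 0" using T.len_pos undilated_edges_sub by blast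
      then show "?l e * (1 / ?l e) = 1" by simp
    qed
    have "4 ^ num_dilated_components p * (\<Prod>e\<in>?U. ?l e) * ((\<Prod>e\<in>?U - F. 1 / ?l e) * (?par (?U - F))\<^sup>2) =
        (4 ^ num_dilated_components p * (?par (?U - F))\<^sup>2) * (\<Prod>e\<in>F. ?l e) *
          ((\<Prod>e\<in>?U - F. ?l e) * (\<Prod>e\<in>?U - F. 1 / ?l e))"
      unfolding split by (simp only: ac_simps)
    also have "\<dots> = 4 * 4 ^ (ogod_rank p F - 1) * (\<Prod>e\<in>F. ?l e)"
      unfolding inv four_power_rank[OF B, symmetric] UF by simp
    finally show "4 ^ num_dilated_components p * (\<Prod>e\<in>?U. ?l e) * ((\<Prod>e\<in>?U - F. 1 / ?l e) * (?par (?U - F))\<^sup>2) =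
        4 * 4 ^ (ogod_rank p F - 1) * (\<Prod>e\<in>F. ?l e)" .
  next
    fix B assume "B \<in> {B. B \<subseteq> ?U \<and> card B = card undilated_verts \<and> nondeg undilated_verts anti_inc B}"
    then show "?U - (?U - B) = B" "?U - B \<in> {F. is_ogod p F}"
      using is_ogod_iff[of B] by auto
  qed
  finally show ?thesis by (simp add: prym_sum_def sum_distrib_left)
qed

lemma jacobian_poly_src:
  "jacobian_poly (src p) =
    2 powi (1 - int (num_dilated_edges p) + int (num_dilated_verts p) - 2 * int (num_dilated_components p))
      * prym_poly p * jacobian_poly (tgt p)"
proof -
  let ?n = "card (verts (tgt p))" and ?m = "card undilated_verts" and ?md = "num_dilated_edges p"
  let ?nd = "num_dilated_verts p" and ?d = "num_dilated_components p"
  let ?ts = "\<Sum>B | S.spanning B. \<Prod>e\<in>B. 1 / len (src p) e" and ?tt = "\<Sum>B | T.spanning B. \<Prod>e\<in>B. 1 / len (tgt p) e"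
  let ?ls = "\<Prod>e\<in>edges (src p). len (src p) e" and ?lt = "\<Prod>e\<in>edges (tgt p). len (tgt p) e"
  let ?lu = "\<Prod>e\<in>undilated_edges. len (tgt p) e"
  let ?z = "1 - int ?md + int ?nd - 2 * int ?d"
  have md: "?md = card (dilated_edges p)" by (simp add: num_dilated_edges_def edges_dilation)
  have nd: "?n = ?m + ?nd"
    using card_Diff_subset[OF finite_subset[OF dilated_verts_sub T.finite_verts] dilated_verts_sub]
      card_mono[OF T.finite_verts dilated_verts_sub]
    by (simp add: num_dilated_verts_def undilated_verts_def)
  have n: "?n > 0" using T.verts_nonempty T.finite_verts by (simp add: card_gt_0_iff)
  have four: "(4::real) ^ ?d = 2 powi (2 * int ?d)"
    by (simp add: power_int_def nat_mult_distrib power_mult)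
  have two: "(2::real) \<noteq> 0" by simp
  \<comment> \<open>As \<open>?n = ?m + ?nd\<close>, the exponents add up to \<open>?n + 1\<close>;
    the surplus of two over the \<open>?n - 1\<close> of the tree sum is the factor 4 of
    \<open>prym_poly_eq\<close>.\<close>
  have exps: "2 ^ (?m + ?md) * 2 powi ?z * 4 ^ ?d = (4::real) * 2 ^ (?n - 1)"
  proof -
    have "2 ^ (?m + ?md) * 2 powi ?z * 4 ^ ?d = (2::real) powi (int (?m + ?md) + ?z + 2 * int ?d)"
      unfolding four by (simp only: power_int_of_nat[symmetric] power_int_add[OF disjI1[OF two]])
    also have "int (?m + ?md) + ?z + 2 * int ?d = int (2 + (?n - 1))"
      using nd n by simp
    also have "(2::real) powi int (2 + (?n - 1)) = 4 * 2 ^ (?n - 1)"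
      unfolding power_int_of_nat power_add by simp
    finally show ?thesis .
  qed
  have "2 ^ (?m + ?md) * jacobian_poly (src p) = (2 ^ ?md * ?ls) * (2 ^ ?m * ?ts)"
    by (simp add: S.jacobian_poly_eq power_add)
  also have "\<dots> = 2 ^ (?n - 1) * (?lu * prym_sum) * (?lt * ?tt)"
    unfolding md prod_len_src tree_sum_factor by (simp only: ac_simps)
  \<comment> \<open>Multiplying by \<open>2 ^ (?m + ?md)\<close> and 4 clears the denominators of
    the length identity, the tree factorisation and the Prym identity at once; it is cancelled at
    the end.\<close>
  finally have "4 * (2 ^ (?m + ?md) * jacobian_poly (src p)) =
      (2 ^ (?m + ?md) * 2 powi ?z * 4 ^ ?d) * (?lu * prym_sum) * jacobian_poly (tgt p)"
    unfolding exps T.jacobian_poly_eq by (simp only: ac_simps)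
  also have "\<dots> = 2 ^ (?m + ?md) * 2 powi ?z * (4 ^ ?d * ?lu * prym_sum) * jacobian_poly (tgt p)"
    by (simp only: ac_simps)
  also have "\<dots> = 4 * (2 ^ (?m + ?md) * (2 powi ?z * prym_poly p * jacobian_poly (tgt p)))"
    unfolding prym_poly_eq[symmetric] by (simp only: ac_simps)
  finally show ?thesis by simp
qed

end

theorem theorem3p10:
  fixes p :: "('w, 'k, 'v, 'h) cover"
  assumes "double_cover p"
    and "connected_graph (tgt p)"
    and "connected_graph (src p)"
  shows "jacobian_poly (src p) =
    2 powi (1 - int (num_dilated_edges p) + int (num_dilated_verts p)
              - 2 * int (num_dilated_components p))
      * prym_poly p * jacobian_poly (tgt p)"
  using double_cover.jacobian_poly_src[OF assms(1)] .

end
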